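(* Let $\Omega\subset\mathbb{R}^d$ be a bounded Lipschitz domain, let $R>0$ be such that $\delta_\Omega(x)<R$ for all $x\in\Omega$, and let $\beta>1$. Then there exists a constant $C=C(d,\Omega,\beta)>0$ (depending only on $d,\Omega,\beta$) such that for every integer $m\ge1$ and all $u\in BV(\Omega)$, $$\int_\Omega\frac{|u(x)-(u)_\Omega|}{\delta_\Omega(x)}\,\mathcal{L}_1\!\left(\frac{\delta_\Omega(x)}{R}\right)\cdots\mathcal{L}_{m-1}\!\left(\frac{\delta_\Omega(x)}{R}\right)\mathcal{L}_m^{\,1+\rho^*\left(\frac{\delta_\Omega(x)}{R}\right)}\!\left(\frac{\delta_\Omega(x)}{R}\right)dx\le C2^m[u]_{BV(\Omega)},$$ where, for $t\in(0,1)$, $$\rho^*(t)=\frac{\beta\,\ln\left(1-\ln(\mathcal{L}_m(t))\right)}{\ln\left(1-\ln(\mathcal{L}_{m-1}(t))\right)}.$$ Furthermore, for each integer $m\ge1$, the inequality $$\int_\Omega\frac{|u(x)-(u)_\Omega|}{\delta_\Omega(x)}\,\mathcal{L}_1\!\left(\frac{\delta_\Omega(x)}{R}\right)\cdots\mathcal{L}_{m-1}\!\left(\frac{\delta_\Omega(x)}{R}\right)\mathcal{L}_m^{\,1+\rho^*\left(\frac{\delta_\Omega(x)}{R}\right)}\!\left(\frac{\delta_\Omega(x)}{R}\right)dx\le C2^m[u]_{BV(\Omega)}$$ fails when $0<\beta\le1$ in the definition of $\rho^*$ (that is, for such $\beta$ there is no finite constant $C$ for which it holds for all $u\in BV(\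Omega)$).
   Context: For a bounded domain $\Omega\subset\mathbb{R}^d$, $d\ge1$, $\delta_\Omega(x)=\min_{y\in\partial\Omega}|x-y|$ is the distance to the boundary. The functions $\mathcal{L}_m$ are defined on $(0,1)$ by $\mathcal{L}_0(t)=t$, $\mathcal{L}_1(t)=\frac{1}{1-\ln t}$ and recursively $\mathcal{L}_m(t)=\mathcal{L}_1(\mathcal{L}_{m-1}(t))$ for $m\ge2$; $\mathcal{L}_m^{a}(t)$ means $(\mathcal{L}_m(t))^{a}$. The function $\rho^*$ depends on $m$ and $\beta$. For $m=1$ the product $\mathcal{L}_1\cdots\mathcal{L}_{m-1}$ is understood to be $1$. A function $u\in L^1(\Omega)$ belongs to $BV(\Omega)$ if $[u]_{BV(\Omega)}:=\sup\{\int_\Omega u\,\mathrm{div}(\phi)\,dx:\phi\in C_c^1(\Omega;\mathbb{R}^d),\ |\phi(x)|\le1\text{ on }\Omega\}<\infty$. The average of $u$ is $(u)_\Omega=\frac1{|\Omega|}\int_\Omega u(y)\,dy$. *)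

theory Defs
  imports "HOL-Analysis.Analysis"
begin

definition bdist :: "'a::euclidean_space set \<Rightarrow> 'a \<Rightarrow> real"
  where "bdist \<Omega> x = infdist x (frontier \<Omega>)"

text \<open>Near each boundary point, after a rotation sending the unit vector \<open>e\<close> to the last
  coordinate direction, \<open>\<Omega>\<close> is the strict epigraph of a Lipschitz function of the
  remaining coordinates; these are the points of the hyperplane orthogonal to \<open>e\<close>. In dimension
  one that hyperplane is \<open>{0}\<close>, and the domains obtained are the bounded open intervals.\<close>

definition bounded_Lipschitz_domain :: "'a::euclidean_space set \<Rightarrow> bool"
  where "bounded_Lipschitz_domain \<Omega> \<longleftrightarrow>
    open \<Omega> \<and> connected \<Omega> \<and> \<Omega> \<noteq> {} \<and> bounded \<Omega> \<and>
    (\<forall>p\<in>frontier \<Omega>. \<exists>r>0. \<exists>e \<gamma> K. norm e = 1 \<and> K-lipschitz_on {y. y \<bullet> e = 0} \<gamma> \<and>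
       \<Omega> \<inter> ball p r = {x \<in> ball p r. x \<bullet> e > \<gamma> (x - (x \<bullet> e) *\<^sub>R e)})"

text \<open>A test field on \<open>\<Omega>\<close> is identified with its extension by zero, which is continuously
  differentiable on the whole space.\<close>

definition C1_compact_support :: "'a::euclidean_space set \<Rightarrow> ('a \<Rightarrow> 'a) set"
  where "C1_compact_support \<Omega> = {\<phi>. \<phi> differentiable_on UNIV \<and>
    (\<forall>b\<in>Basis. continuous_on UNIV (\<lambda>x. frechet_derivative \<phi> (at x) b)) \<and>
    compact (closure {x. \<phi> x \<noteq> 0}) \<and> closure {x. \<phi> x \<noteq> 0} \<subseteq> \<Omega>}"

definition divergence :: "('a::euclidean_space \<Rightarrow> 'a) \<Rightarrow> 'a \<Rightarrow> real"
  where "divergence \<phi> x = (\<Sum>b\<in>Basis. frechet_derivative \<phi> (at x) b \<bullet> b)"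

definition BV_seminorm :: "'a::euclidean_space set \<Rightarrow> ('a \<Rightarrow> real) \<Rightarrow> ereal"
  where "BV_seminorm \<Omega> u =
    (SUP \<phi> \<in> {\<phi> \<in> C1_compact_support \<Omega>. \<forall>x\<in>\<Omega>. norm (\<phi> x) \<le> 1}.
       ereal (LINT x:\<Omega>|lebesgue. u x * divergence \<phi> x))"

text \<open>Elements are functions rather than almost-everywhere classes; their values outside
  \<open>\<Omega>\<close> are irrelevant.\<close>

definition BV :: "'a::euclidean_space set \<Rightarrow> ('a \<Rightarrow> real) set"
  where "BV \<Omega> = {u. u absolutely_integrable_on \<Omega> \<and> BV_seminorm \<Omega> u < \<infinity>}"

definition average :: "'a::euclidean_space set \<Rightarrow> ('a \<Rightarrow> real) \<Rightarrow> real"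
  where "average \<Omega> u = (1 / measure lebesgue \<Omega>) * (LINT y:\<Omega>|lebesgue. u y)"

definition L1 :: "real \<Rightarrow> real"
  where "L1 t = 1 / (1 - ln t)"

primrec Llog :: "nat \<Rightarrow> real \<Rightarrow> real"
  where
    "Llog 0 t = t"
  | "Llog (Suc m) t = L1 (Llog m t)"

definition rho_star :: "real \<Rightarrow> nat \<Rightarrow> real \<Rightarrow> real"
  where "rho_star \<beta> m t = \<beta> * ln (1 - ln (Llog m t)) / ln (1 - ln (Llog (m - 1) t))"

text \<open>The integral is taken in the extended nonnegative reals, so that a non-integrable
  integrand has integral \<open>\<infinity>\<close> and not the default value \<open>0\<close> of the Bochner integral.\<close>

definition log_Hardy_integral ::
    "'a::euclidean_space set \<Rightarrow> real \<Rightarrow> real \<Rightarrow> nat \<Rightarrow> ('a \<Rightarrow> real) \<Rightarrow> ennreal"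
  where "log_Hardy_integral \<Omega> R \<beta> m u =
    (\<integral>\<^sup>+x\<in>\<Omega>. ennreal (\<bar>u x - average \<Omega> u\<bar> / bdist \<Omega> x
        * (\<Prod>i\<in>{1..<m}. Llog i (bdist \<Omega> x / R))
        * Llog m (bdist \<Omega> x / R) powr (1 + rho_star \<beta> m (bdist \<Omega> x / R))) \<partial>lebesgue)"

end

theory Submission
  imports Defs
begin

text \<open>Since \<open>ln (1 - ln (L\<^sub>m\<^sub>-\<^sub>1 t)) = - ln (L\<^sub>m t)\<close>, the weight is
  \<open>G(\<delta>/R)/\<delta>\<close> with \<open>G = L\<^sub>1 \<cdots> L\<^sub>m L\<^sub>m\<^sub>+\<^sub>1\<^sup>\<beta>\<close>, and \<open>G(t)/t\<close> has the primitive
  \<open>L\<^sub>m\<^sub>+\<^sub>1\<^sup>\<beta>\<^sup>-\<^sup>1/(\<beta> - 1)\<close>, or \<open>ln L\<^sub>m\<^sub>+\<^sub>1\<close> when \<open>\<beta> = 1\<close>. Hence the dyadic sums of \<open>G\<close> are bounded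
  uniformly in \<open>m\<close> and \<open>R\<close> for \<open>\<beta> > 1\<close> and diverge for \<open>\<beta> \<le> 1\<close>.

  All that is used about a BV function is that translation by \<open>h\<close> changes it in \<open>L\<^sup>1\<close> by at most
  \<open>\<bar>h\<bar> [u]\<close> on the set where the translating segments stay in \<open>\<Omega>\<close>. Translating the layer
  \<open>\<delta> < \<tau>\<close> repeatedly by about \<open>\<tau>\<close> in the direction transversal to the boundary bounds the
  \<open>L\<^sup>1\<close>-norm of \<open>u - c\<close> on this layer by \<open>C \<tau> ([u] + \<parallel>u - c\<parallel>\<^sub>1)\<close>. Summing over dyadic layers
  gives the inequality once \<open>\<parallel>u - c\<parallel>\<^sub>1 \<le> C [u]\<close> is known; the latter follows from the Poincare
  inequality along chains of balls, the boundary layer being absorbed by the layer estimate.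

  For \<open>\<beta> \<le> 1\<close> the integral is infinite for a Lipschitz bump, which differs from its mean by a
  nonzero constant near the boundary.\<close>

section \<open>Iterated logarithms\<close>

text \<open>The constant may depend on neither \<open>m\<close> nor \<open>R\<close>, so nothing may
  be lost per logarithm: all \<open>m\<close> factors are integrated at once through the exact
  primitive, and the dyadic scale starts at the boundary distance of a fixed point of \<Omega>
  instead of at \<open>R\<close>. The translation bound is obtained by duality directly for a
  nonsmooth \<open>u\<close>, the test functions being C1 approximations of the sign of the
  difference. In the layer estimate the term with the L^1 norm of \<open>u - c\<close> cannot be
  dropped, since \<open>c\<close> is arbitrary there and a constant \<open>u\<close> has no
  variation. It forces a Poincare inequality, and the layer estimate can itself feed that inequality
  because on a thin enough layer the term has coefficient 1/2. For \<beta> \<le> 1 one function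
  serves all \<open>m\<close> and \<beta>, and the divergence is already visible in a single
  boundary chart, where only lower bounds for the measures of the dyadic layers are
  required.\<close>

lemma L1_bounds: assumes "0 < t" "t < 1" shows "0 < L1 t" "L1 t < 1"
proof -
  have "ln t < 0" using assms by simp
  then show "0 < L1 t" "L1 t < 1" by (auto simp: L1_def)
qed

lemma Llog_bounds:
  assumes "0 < t" "t < 1" shows "0 < Llog m t \<and> Llog m t < 1"
  using assms by (induction m) (auto simp: L1_bounds)

lemma Llog_pos: "0 < t \<Longrightarrow> t < 1 \<Longrightarrow> 0 < Llog m t"
  using Llog_bounds by auto

lemma L1_mono: assumes "0 < s" "s \<le> t" "t < 1" shows "L1 s \<le> L1 t"
proof -
  have "ln s \<le> ln t" "ln t < 0" using assms by auto
  then show ?thesis by (auto simp: L1_def field_simps)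
qed

lemma Llog_mono: assumes "0 < s" "s \<le> t" "t < 1" shows "Llog m s \<le> Llog m t"
proof (induction m)
  case (Suc m)
  then show ?case using assms Llog_bounds[of s m] Llog_bounds[of t m] by (auto intro!: L1_mono)
qed (use assms in auto)

section \<open>The weight as a product of iterated logarithms, and its dyadic sums\<close>

definition log_weight :: "real \<Rightarrow> nat \<Rightarrow> real \<Rightarrow> real"
  where "log_weight \<beta> m t = (\<Prod>i\<in>{1..m}. Llog i t) * Llog (Suc m) t powr \<beta>"

lemma Llog_Suc_inverse: "Llog (Suc m) t = inverse (1 - ln (Llog m t))"
  by (simp add: L1_def divide_inverse)

lemma ln_one_minus_ln_Llog: assumes "0 < t" "t < 1" shows "ln (1 - ln (Llog m t)) = - ln (Llog (Suc m) t)"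
proof -
  have "ln (Llog m t) < 0" using Llog_bounds[OF assms, of m] by simp
  then show ?thesis unfolding Llog_Suc_inverse by (simp add: ln_inverse)
qed

text \<open>The exponent is made for this: by \<open>ln_one_minus_ln_Llog\<close> the numerator and
  denominator of \<open>rho_star\<close> are \<open>- \<beta> * ln (Llog (Suc m) t)\<close> and
  \<open>- ln (Llog m t)\<close>, so raising \<open>Llog m t\<close> to it leaves
  \<open>Llog (Suc m) t powr \<beta>\<close>. The remaining exponent 1 completes the
  product.\<close>

lemma Llog_powr_rho_star:
  assumes t: "0 < t" "t < 1" and "m \<ge> 1"
  shows "(\<Prod>i\<in>{1..<m}. Llog i t) * Llog m t powr (1 + rho_star \<beta> m t) = log_weight \<beta> m t"
proof -
  obtain n where n: "m = Suc n" using \<open>m \<ge> 1\<close> by (cases m) auto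
  have neg: "ln (Llog m t) < 0" and pos: "Llog m t > 0" "Llog (Suc m) t > 0"
    using Llog_bounds[OF t, of m] Llog_bounds[OF t, of "Suc m"] by simp_all
  have "rho_star \<beta> m t * ln (Llog m t) = \<beta> * ln (Llog (Suc m) t)"
    using neg ln_one_minus_ln_Llog[OF t, of m] ln_one_minus_ln_Llog[OF t, of n]
    by (simp add: rho_star_def n del: Llog.simps)
  then have "Llog m t powr rho_star \<beta> m t = Llog (Suc m) t powr \<beta>"
    using pos by (simp add: powr_def del: Llog.simps)
  moreover have "{1..m} = insert m {1..<m}" using \<open>m \<ge> 1\<close> by auto
  ultimately show ?thesis
    using pos by (simp add: log_weight_def powr_add mult_ac del: Llog.simps)
qed

lemma log_weight_nonneg: "0 < t \<Longrightarrow> t < 1 \<Longrightarrow> 0 \<le> log_weight \<beta> m t"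
  unfolding log_weight_def by (intro mult_nonneg_nonneg prod_nonneg ballI less_imp_le[OF Llog_pos]) auto

lemma log_weight_le_one:
  assumes "0 < t" "t < 1" "0 \<le> \<beta>" shows "log_weight \<beta> m t \<le> 1"
proof -
  have "(\<Prod>i\<in>{1..m}. Llog i t) \<le> 1"
    using Llog_bounds[OF assms(1,2)] by (intro prod_le_1) (auto intro: less_imp_le)
  moreover have "Llog (Suc m) t powr \<beta> \<le> 1"
    using Llog_bounds[OF assms(1,2), of "Suc m"] assms(3) by (auto intro!: powr_le1)
  ultimately show ?thesis unfolding log_weight_def by (intro mult_le_one) auto
qed

text \<open>Every factor increases with \<open>t\<close>. On a dyadic interval the weight can
  therefore be replaced by its value at an end point, in upper as well as in lower bounds.\<close>

lemma log_weight_mono: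
  assumes "0 < s" "s \<le> t" "t < 1" "0 \<le> \<beta>" shows "log_weight \<beta> m s \<le> log_weight \<beta> m t"
proof -
  have "s < 1" "0 < t" using assms by auto
  note b = Llog_pos[OF \<open>0 < s\<close> \<open>s < 1\<close>] Llog_pos[OF \<open>0 < t\<close> \<open>t < 1\<close>]
  show ?thesis unfolding log_weight_def
    by (intro mult_mono prod_mono powr_mono2 prod_nonneg conjI ballI Llog_mono less_imp_le[OF b(1)]
        less_imp_le[OF b(2)]) (use assms in auto)
qed

text \<open>The base lies below 1, so a smaller exponent gives a larger weight; divergence for
  \<beta> \<le> 1 is thereby reduced to the critical exponent 1.\<close>

lemma log_weight_antimono_exponent:
  assumes "0 < t" "t < 1" "\<beta> \<le> \<beta>'" shows "log_weight \<beta>' m t \<le> log_weight \<beta> m t"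
  unfolding log_weight_def using Llog_bounds[OF assms(1,2)] assms(3)
  by (intro mult_left_mono powr_mono' prod_nonneg) (auto intro: less_imp_le simp del: Llog.simps)

lemma has_real_derivative_L1:
  assumes "0 < s" "s < 1" shows "(L1 has_real_derivative ((L1 s)\<^sup>2 / s)) (at s)"
proof -
  have "1 - ln s > 0" using ln_less_zero[of s] assms by linarith
  then have "((\<lambda>t. 1 / (1 - ln t)) has_real_derivative ((1 / (1 - ln s))\<^sup>2 / s)) (at s)"
    using assms by (auto intro!: derivative_eq_intros simp: field_simps power2_eq_square)
  then show ?thesis by (simp add: L1_def[abs_def])
qed

text \<open>The derivative of \<open>L1\<close> at \<open>s\<close> is
  \<open>(L1 s)\<^sup>2 / s\<close>. In the chain rule the division by \<open>Llog (Suc m) t\<close>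
  cancels one factor of the square from the induction hypothesis, and the other one joins the
  product.\<close>

lemma has_real_derivative_Llog:
  assumes t: "0 < t" "t < 1"
  shows "(Llog (Suc m) has_real_derivative
           ((\<Prod>i\<in>{1..m}. Llog i t) * (Llog (Suc m) t)\<^sup>2 / t)) (at t)"
proof (induction m)
  case 0
  then show ?case using has_real_derivative_L1[OF t] by (simp add: Llog.simps[abs_def])
next
  case (Suc m)
  have b: "0 < Llog (Suc m) t" "Llog (Suc m) t < 1" using Llog_bounds[OF t, of "Suc m"] by blast+
  have "Llog (Suc (Suc m)) = (\<lambda>t. L1 (Llog (Suc m) t))" by (simp add: fun_eq_iff)
  then show ?case
    using DERIV_chain2[OF has_real_derivative_L1[OF b] Suc.IH] b by (simp add: power2_eq_square mult_ac del: Llog.simps(2))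
qed

text \<open>Comparison with the integral of \<open>log_weight \<beta> m s / s\<close> over the
  dyadic intervals below \<open>t\<close>. Its primitive lies between 0 and
  \<open>1 / (\<beta> - 1)\<close> whatever \<open>m\<close> and \<open>t\<close> are, so
  telescoping costs at most \<open>2 / (\<beta> - 1)\<close>; the summand 1 pays for the term
  \<open>k = 0\<close>, whose interval would extend above \<open>t\<close>.\<close>

lemma log_weight_sum_le:
  assumes "\<beta> > 1" and t: "0 < t" "t < 1"
  shows "(\<Sum>k<n. log_weight \<beta> m (t / 2 ^ k)) \<le> 1 + 2 / (\<beta> - 1)"
proof -
  define P where "P s = Llog (Suc m) s powr (\<beta> - 1) / (\<beta> - 1)" for s
  have tk: "0 < t / 2 ^ k \<and> t / 2 ^ k < 1" for k
    using t by (auto simp: field_simps intro: less_le_trans[of t 1])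
  have dP: "(P has_real_derivative log_weight \<beta> m s / s) (at s)" if s: "0 < s" "s < 1" for s
  proof -
    have b: "0 < Llog (Suc m) s" using Llog_bounds[OF s, of "Suc m"] by blast
    \<comment> \<open>Differentiating the power lowers the exponent to \<open>\<beta> - 2\<close>;
      the square in the derivative of \<open>Llog (Suc m)\<close> restores \<beta>.\<close>
    have "Llog (Suc m) s powr \<beta> = Llog (Suc m) s powr (\<beta> - 2) * (Llog (Suc m) s)\<^sup>2"
      using b by (simp add: powr_diff powr_numeral del: Llog.simps)
    moreover have "\<beta> - 1 - 1 = \<beta> - 2" by simp
    ultimately show ?thesis unfolding P_def log_weight_def
      using b \<open>\<beta> > 1\<close> has_real_derivative_Llog[OF s, of m]
      by (auto intro!: derivative_eq_intros simp del: Llog.simps)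
  qed
  \<comment> \<open>At the mean value point \<open>z\<close> the weight is at least its value at the
    left end \<open>b\<close>, while \<open>1 / z\<close> exceeds \<open>1 / (2 * b)\<close>; hence
    the factor 1/2.\<close>
  have step: "log_weight \<beta> m (t / 2 ^ Suc k) / 2 \<le> P (t / 2 ^ k) - P (t / 2 ^ Suc k)" for k
  proof -
    define b where "b = t / 2 ^ Suc k"
    have b: "0 < b" "2 * b < 1" "t / 2 ^ k = 2 * b"
      using tk[of "Suc k"] tk[of k] by (auto simp: b_def field_simps)
    obtain z where z: "b < z" "z < 2 * b" "P (2 * b) - P b = (2 * b - b) * (log_weight \<beta> m z / z)"
      using MVT2[of b "2 * b" P "\<lambda>s. log_weight \<beta> m s / s"] dP b by auto
    have "log_weight \<beta> m b \<le> log_weight \<beta> m z"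
      using z b \<open>\<beta> > 1\<close> by (intro log_weight_mono) auto
    moreover have "0 \<le> log_weight \<beta> m b" using b by (intro log_weight_nonneg) auto
    ultimately have "log_weight \<beta> m b / (2 * b) \<le> log_weight \<beta> m z / z"
      using z b by (intro frac_le) auto
    then have "b * (log_weight \<beta> m b / (2 * b)) \<le> b * (log_weight \<beta> m z / z)"
      using b by (intro mult_left_mono) auto
    then show ?thesis using z(3) b unfolding b_def[symmetric] b(3) by simp
  qed
  have "(\<Sum>k<n. log_weight \<beta> m (t / 2 ^ Suc k) / 2) \<le> P (t / 2 ^ 0) - P (t / 2 ^ n)" for n
  proof (induction n)
    case (Suc n)
    then show ?case using step[of n] by simp
  qed simp
  then have "(\<Sum>k<n. log_weight \<beta> m (t / 2 ^ Suc k)) \<le> 2 * P t - 2 * P (t / 2 ^ n)"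
    unfolding sum_divide_distrib[symmetric] by (simp add: field_simps)
  moreover have "P t \<le> 1 / (\<beta> - 1)" "0 \<le> P (t / 2 ^ n)"
    using Llog_bounds[OF t, of "Suc m"] \<open>\<beta> > 1\<close> unfolding P_def
    by (auto intro!: divide_right_mono powr_le1 simp del: Llog.simps)
  moreover have "log_weight \<beta> m t \<le> 1"
    using t \<open>\<beta> > 1\<close> by (intro log_weight_le_one) auto
  moreover have "(\<Sum>k<n. log_weight \<beta> m (t / 2 ^ k)) \<le> (\<Sum>k<Suc n. log_weight \<beta> m (t / 2 ^ k))"
    using tk[of n] log_weight_nonneg[of "t / 2 ^ n" \<beta> m] by simp
  ultimately show ?thesis unfolding sum.lessThan_Suc_shift by simp
qed

lemma tendsto_Llog_zero:
  assumes t: "0 < t" "t < 1" shows "(\<lambda>n. Llog m (t / 2 ^ n)) \<longlonglongrightarrow> 0"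
proof (induction m)
  case 0
  have "(\<lambda>n. t * (1 / 2) ^ n) \<longlonglongrightarrow> t * 0" by (intro tendsto_intros) simp
  then show ?case by (simp add: power_one_over field_simps)
next
  case (Suc m)
  have "Llog m (t / 2 ^ n) > 0" for n
  proof (rule Llog_pos)
    show "t / 2 ^ n < 1" using t by (simp add: field_simps less_le_trans[of t 1])
  qed (use t in auto)
  then have "filterlim (\<lambda>n. Llog m (t / 2 ^ n)) (at_right 0) sequentially"
    using Suc by (intro tendsto_imp_filterlim_at_right) auto
  moreover have "((\<lambda>s. 1 / (1 - ln s)) \<longlongrightarrow> 0) (at_right (0::real))"
  proof (intro tendsto_divide_0[OF tendsto_const] filterlim_at_top_imp_at_infinity)
    have "filterlim (\<lambda>s. - ln s) at_top (at_right (0::real))"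
      using ln_at_0 by (simp add: filterlim_uminus_at_top)
    then show "filterlim (\<lambda>s. 1 - ln s) at_top (at_right (0::real))"
      using filterlim_tendsto_add_at_top[OF tendsto_const, of "\<lambda>s. - ln s" "at_right (0::real)" 1] by simp
  qed
  ultimately show ?case unfolding Llog.simps L1_def by (rule filterlim_compose[rotated])
qed

text \<open>The same comparison read from below: for exponent 1 the primitive is
  \<open>ln (Llog (Suc m) s)\<close>, which tends to minus infinity at 0. Each increment is at most
  the weight at the right end point, since the interval has length \<open>b\<close> and
  \<open>1 / z\<close> is less than \<open>1 / b\<close> on it.\<close>

lemma log_weight_sum_unbounded:
  assumes "\<beta> \<le> 1" and t: "0 < t" "t < 1"
  shows "\<exists>n. B \<le> (\<Sum>k<n. log_weight \<beta> m (t / 2 ^ k))"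
proof -
  define Q where "Q s = ln (Llog (Suc m) s)" for s
  have tk: "0 < t / 2 ^ k \<and> t / 2 ^ k < 1" for k
    using t by (auto simp: field_simps intro: less_le_trans[of t 1])
  have dQ: "(Q has_real_derivative log_weight 1 m s / s) (at s)" if s: "0 < s" "s < 1" for s
  proof -
    have b: "0 < Llog (Suc m) s" using Llog_bounds[OF s, of "Suc m"] by blast
    then show ?thesis unfolding Q_def log_weight_def
      using has_real_derivative_Llog[OF s, of m]
      by (auto intro!: derivative_eq_intros simp: power2_eq_square simp del: Llog.simps)
  qed
  have step: "Q (t / 2 ^ k) - Q (t / 2 ^ Suc k) \<le> log_weight \<beta> m (t / 2 ^ k)" for k
  proof -
    define b where "b = t / 2 ^ Suc k"
    have b: "0 < b" "2 * b < 1" "t / 2 ^ k = 2 * b"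
      using tk[of "Suc k"] tk[of k] by (auto simp: b_def field_simps)
    obtain z where z: "b < z" "z < 2 * b" "Q (2 * b) - Q b = (2 * b - b) * (log_weight 1 m z / z)"
      using MVT2[of b "2 * b" Q "\<lambda>s. log_weight 1 m s / s"] dQ b by auto
    have "log_weight 1 m z \<le> log_weight 1 m (2 * b)" using z b by (intro log_weight_mono) auto
    also have "\<dots> \<le> log_weight \<beta> m (2 * b)"
      using b \<open>\<beta> \<le> 1\<close> by (intro log_weight_antimono_exponent) auto
    finally have "log_weight 1 m z / z \<le> log_weight \<beta> m (2 * b) / b"
      using z b by (intro frac_le log_weight_nonneg) auto
    then have "b * (log_weight 1 m z / z) \<le> b * (log_weight \<beta> m (2 * b) / b)"
      using b by (intro mult_left_mono) auto
    then show ?thesis using z(3) b unfolding b_def[symmetric] b(3) by simp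
  qed
  have sum: "Q (t / 2 ^ 0) - Q (t / 2 ^ n) \<le> (\<Sum>k<n. log_weight \<beta> m (t / 2 ^ k))" for n
  proof (induction n)
    case (Suc n)
    then show ?case using step[of n] by simp
  qed simp
  have "filterlim (\<lambda>n. Llog (Suc m) (t / 2 ^ n)) (at_right 0) sequentially"
    by (intro tendsto_imp_filterlim_at_right tendsto_Llog_zero t always_eventually allI Llog_pos) (use tk in auto)
  then have "filterlim (\<lambda>n. Q (t / 2 ^ n)) at_bot sequentially"
    unfolding Q_def by (rule filterlim_compose[OF ln_at_0])
  then obtain n where "Q (t / 2 ^ n) \<le> Q t - B"
    by (auto simp: filterlim_at_bot eventually_sequentially)
  then show ?thesis using sum[of n] by (intro exI[of _ n]) auto
qed

section \<open>Translation estimate\<close>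

definition C1_scalar :: "('a::euclidean_space \<Rightarrow> real) \<Rightarrow> ('a \<Rightarrow> 'a) \<Rightarrow> bool"
  where "C1_scalar \<psi> g \<longleftrightarrow>
    (\<forall>x. (\<psi> has_derivative (\<lambda>v. g x \<bullet> v)) (at x)) \<and> continuous_on UNIV g"

lemma C1_scalar_continuous: "C1_scalar \<psi> g \<Longrightarrow> continuous_on UNIV \<psi>"
  unfolding C1_scalar_def
  by (meson continuous_at_imp_continuous_on has_derivative_continuous)

lemma C1_scalar_const: "C1_scalar (\<lambda>x. c) (\<lambda>x. 0)"
  by (auto simp: C1_scalar_def)

lemma C1_scalar_add:
  assumes "C1_scalar \<psi> g" "C1_scalar \<psi>' g'"
  shows "C1_scalar (\<lambda>x. \<psi> x + \<psi>' x) (\<lambda>x. g x + g' x)"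
proof -
  have "((\<lambda>x. \<psi> x + \<psi>' x) has_derivative (\<lambda>v. (g x + g' x) \<bullet> v)) (at x)" for x
    using assms unfolding C1_scalar_def inner_add_left by (intro has_derivative_add) auto
  then show ?thesis using assms unfolding C1_scalar_def by (auto intro!: continuous_intros)
qed

lemma C1_scalar_mult:
  assumes "C1_scalar \<psi> g" "C1_scalar \<psi>' g'"
  shows "C1_scalar (\<lambda>x. \<psi> x * \<psi>' x) (\<lambda>x. \<psi> x *\<^sub>R g' x + \<psi>' x *\<^sub>R g x)"
proof -
  note [continuous_intros] = C1_scalar_continuous[OF assms(1)] C1_scalar_continuous[OF assms(2)]
  have "((\<lambda>x. \<psi> x * \<psi>' x) has_derivative (\<lambda>v. (\<psi> x *\<^sub>R g' x + \<psi>' x *\<^sub>R g x) \<bullet> v)) (at x)" for x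
  proof -
    have "(\<psi> has_derivative (\<lambda>v. g x \<bullet> v)) (at x)" "(\<psi>' has_derivative (\<lambda>v. g' x \<bullet> v)) (at x)"
      using assms by (auto simp: C1_scalar_def)
    from has_derivative_mult[OF this] show ?thesis
      by (rule has_derivative_eq_rhs) (auto simp: inner_add_left algebra_simps)
  qed
  then show ?thesis
    using assms unfolding C1_scalar_def by (auto intro!: continuous_intros)
qed

lemma C1_scalar_compose:
  assumes "C1_scalar \<psi> g" and d: "\<And>s. (p has_real_derivative p' s) (at s)" and c: "continuous_on UNIV p'"
  shows "C1_scalar (\<lambda>x. p (\<psi> x)) (\<lambda>x. p' (\<psi> x) *\<^sub>R g x)"
proof -
  have "((\<lambda>x. p (\<psi> x)) has_derivative (\<lambda>v. (p' (\<psi> x) *\<^sub>R g x) \<bullet> v)) (at x)" for x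
  proof -
    have "(\<psi> has_derivative (\<lambda>v. g x \<bullet> v)) (at x)"
      using assms by (auto simp: C1_scalar_def)
    from has_derivative_compose[OF this d[THEN has_field_derivative_imp_has_derivative]] show ?thesis
      by (rule has_derivative_eq_rhs) auto
  qed
  moreover have "continuous_on UNIV (\<lambda>x. p' (\<psi> x) *\<^sub>R g x)"
    using assms(1) C1_scalar_continuous[OF assms(1)] unfolding C1_scalar_def
    by (auto intro!: continuous_intros continuous_on_compose2[OF c])
  ultimately show ?thesis unfolding C1_scalar_def by blast
qed

lemma C1_scalar_sum:
  assumes "\<And>i. i \<in> I \<Longrightarrow> \<exists>g. C1_scalar (\<psi> i) g"
  shows "\<exists>g. C1_scalar (\<lambda>x. \<Sum>i\<in>I. \<psi> i x) g"
proof (cases "finite I")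
  case True
  then show ?thesis using assms
  proof (induction I)
    case (insert i I)
    then obtain g g' where "C1_scalar (\<psi> i) g" "C1_scalar (\<lambda>x. \<Sum>i\<in>I. \<psi> i x) g'"
      by (meson insertCI)
    from C1_scalar_add[OF this] show ?case using insert by auto
  qed (auto intro: C1_scalar_const)
qed (auto intro: C1_scalar_const)

text \<open>Polynomials enter because Stone-Weierstrass supplies them as C1 approximants of
  continuous functions on a compact set.\<close>

lemma C1_scalar_polynomial:
  assumes "real_polynomial_function p" shows "\<exists>g. C1_scalar p g"
  using assms
proof induction
  case (linear f)
  have eq: "f = (\<lambda>x. (\<Sum>b\<in>Basis. f b *\<^sub>R b) \<bullet> x)"
  proof
    fix x
    have "f x = f (\<Sum>b\<in>Basis. (x \<bullet> b) *\<^sub>R b)" by (simp add: euclidean_representation)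
    also have "\<dots> = (\<Sum>b\<in>Basis. (x \<bullet> b) * f b)"
      using linear by (simp add: linear_simps bounded_linear.linear linear_sum linear_scale)
    finally show "f x = (\<Sum>b\<in>Basis. f b *\<^sub>R b) \<bullet> x"
      by (simp add: inner_sum_left inner_sum_right inner_commute mult.commute[of "f _"])
  qed
  have "(f has_derivative (\<lambda>x. (\<Sum>b\<in>Basis. f b *\<^sub>R b) \<bullet> x)) (at x)" for x
    using bounded_linear_imp_has_derivative[OF linear] eq by metis
  then have "C1_scalar f (\<lambda>_. \<Sum>b\<in>Basis. f b *\<^sub>R b)" by (simp add: C1_scalar_def)
  then show ?case by blast
next
  case (const c)
  then show ?case using C1_scalar_const by blast
next
  case (add f g)
  then show ?case using C1_scalar_add by blast
next
  case (mult f g)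
  then show ?case using C1_scalar_mult by blast
qed

text \<open>Squaring the positive part makes it C1: the derivative \<open>2 * max 0 s\<close> is
  continuous through 0, and at 0 the difference quotient of the square is at most the step in
  absolute value.\<close>

lemma C1_scalar_bump:
  fixes c :: "'a::euclidean_space"
  shows "\<exists>g. C1_scalar (\<lambda>x. (max 0 (r\<^sup>2 - (norm (x - c))\<^sup>2))\<^sup>2) g"
proof -
  have q: "C1_scalar (\<lambda>x. r\<^sup>2 - (norm (x - c))\<^sup>2) (\<lambda>x. - 2 *\<^sub>R (x - c))"
    unfolding C1_scalar_def power2_norm_eq_inner
    by (auto intro!: derivative_eq_intros continuous_intros simp: inner_commute inner_diff_left inner_diff_right algebra_simps)
  have d: "((\<lambda>s. (max 0 s)\<^sup>2) has_real_derivative 2 * max 0 s) (at s)" for s :: real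
  proof -
    consider "s < 0" | "s > 0" | "s = 0" by linarith
    then show ?thesis
    proof cases
      case 1
      have "((\<lambda>s. 0) has_real_derivative 2 * max 0 s) (at s)" using 1 by auto
      then show ?thesis
        by (rule has_field_derivative_transform_within_open[of _ _ _ "{..<0}"]) (use 1 in auto)
    next
      case 2
      have "((\<lambda>s. s\<^sup>2) has_real_derivative 2 * max 0 s) (at s)"
        using 2 by (auto intro!: derivative_eq_intros)
      then show ?thesis
        by (rule has_field_derivative_transform_within_open[of _ _ _ "{0<..}"]) (use 2 in auto)
    next
      case 3
      have "((\<lambda>h. ((max 0 h)\<^sup>2 - (max 0 0)\<^sup>2) / h) \<longlongrightarrow> (0::real)) (at 0)"
      proof (rule Lim_null_comparison)
        show "\<forall>\<^sub>F h in at 0. norm (((max 0 h)\<^sup>2 - (max 0 0)\<^sup>2) / h) \<le> \<bar>h::real\<bar>"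
          by (auto simp: eventually_at_filter max_def power2_eq_square)
        show "((\<lambda>h::real. \<bar>h\<bar>) \<longlongrightarrow> 0) (at 0)"
          by (auto intro!: tendsto_eq_intros)
      qed
      then show ?thesis using 3 by (simp add: DERIV_def)
    qed
  qed
  have "continuous_on UNIV (\<lambda>s::real. 2 * max 0 s)" by (intro continuous_intros)
  from C1_scalar_compose[OF q d this] show ?thesis by blast
qed

text \<open>The divergence of the field spread along the segments in direction \<open>h\<close> is a difference of
  \<open>\<psi>\<close>, so testing the variation with it bounds a difference quotient dually.\<close>

lemma transport_field:
  fixes \<psi> :: "'a::euclidean_space \<Rightarrow> real"
  assumes \<psi>: "C1_scalar \<psi> g" and le: "\<And>x. \<bar>\<psi> x\<bar> \<le> 1"
    and K: "compact K" "\<And>x. x \<notin> K \<Longrightarrow> \<psi> x = 0"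
    and \<Omega>: "\<And>x t. x \<in> K \<Longrightarrow> t \<in> {0..1} \<Longrightarrow> x + t *\<^sub>R h \<in> \<Omega>"
  obtains \<Phi> where "\<Phi> \<in> C1_compact_support \<Omega>" "\<And>x. norm (\<Phi> x) \<le> norm h"
    "\<And>x. divergence \<Phi> x = \<psi> (x - h) - \<psi> x"
proof -
  define \<Phi> where "\<Phi> = (\<lambda>x. (- integral {0..1} (\<lambda>t. \<psi> (x - t *\<^sub>R h))) *\<^sub>R h)"
  \<comment> \<open>The average of the gradient along the segment. Having the gradient as an
    argument of \<open>C1_scalar\<close> allows the derivative of \<open>\<Phi>\<close> to be
    written down explicitly in terms of \<open>I x\<close>.\<close>
  define I where "I = (\<lambda>x. integral {0..1} (\<lambda>t. g (x - t *\<^sub>R h)))"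
  have d\<psi>: "(\<psi> has_derivative (\<lambda>v. g x \<bullet> v)) (at x)" for x
    using \<psi> by (auto simp: C1_scalar_def)
  have g: "continuous_on UNIV g" using \<psi> by (auto simp: C1_scalar_def)
  note \<psi>c = C1_scalar_continuous[OF \<psi>]
  note cont = continuous_on_compose2[OF \<psi>c] continuous_on_compose2[OF g]
  have I_cont: "continuous_on UNIV I"
  proof -
    have "continuous_on (UNIV \<times> cbox 0 1) (\<lambda>(x, t::real). g (x - t *\<^sub>R h))"
      by (auto intro!: continuous_intros cont simp: split_beta)
    from integral_continuous_on_param[OF this] show ?thesis by (simp add: I_def)
  qed
  have d: "(\<Phi> has_derivative (\<lambda>v. (- (I x \<bullet> v)) *\<^sub>R h)) (at x)" for x
  proof -
    have "((\<lambda>x. integral (cbox 0 1) (\<lambda>t. \<psi> (x - t *\<^sub>R h))) has_derivative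
        integral (cbox 0 1) (\<lambda>t::real. blinfun_inner_right (g (x - t *\<^sub>R h)))) (at x within UNIV)"
    proof (rule leibniz_rule)
      fix x t
      show "((\<lambda>x. \<psi> (x - t *\<^sub>R h)) has_derivative blinfun_inner_right (g (x - t *\<^sub>R h))) (at x within UNIV)"
        by (rule has_derivative_eq_rhs[OF has_derivative_compose[OF _ d\<psi>]])
          (auto intro!: derivative_eq_intros)
      show "(\<lambda>t. \<psi> (x - t *\<^sub>R h)) integrable_on cbox 0 (1::real)"
        by (intro integrable_continuous continuous_intros cont) auto
    next
      show "continuous_on (UNIV \<times> cbox 0 1) (\<lambda>(x, t::real). blinfun_inner_right (g (x - t *\<^sub>R h)))"
        by (auto intro!: continuous_intros cont bounded_linear.continuous_on[OF bounded_linear_blinfun_inner_right]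
            simp: split_beta)
    qed auto
    moreover have "integral (cbox 0 1) (\<lambda>t::real. blinfun_inner_right (g (x - t *\<^sub>R h))) = blinfun_inner_right (I x)"
    proof -
      have "(\<lambda>t. g (x - t *\<^sub>R h)) integrable_on cbox 0 (1::real)"
        by (intro integrable_continuous continuous_intros cont) auto
      from integral_linear[OF this bounded_linear_blinfun_inner_right] show ?thesis
        by (simp add: I_def o_def)
    qed
    ultimately have "((\<lambda>x. integral {0..1} (\<lambda>t. \<psi> (x - t *\<^sub>R h))) has_derivative (\<lambda>v. I x \<bullet> v)) (at x)"
      by simp
    then show ?thesis unfolding \<Phi>_def by (auto intro!: derivative_eq_intros)
  qed
  have fd: "frechet_derivative \<Phi> (at x) = (\<lambda>v. (- (I x \<bullet> v)) *\<^sub>R h)" for x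
    by (rule frechet_derivative_at[OF d, symmetric])
  \<comment> \<open>The compact set swept by \<open>K\<close> along the segments carries the support
    of \<open>\<Phi>\<close>; the hypothesis on segments says exactly that it lies in
    \<Omega>.\<close>
  define K' where "K' = (\<lambda>(x, t). x + t *\<^sub>R h) ` (K \<times> {0..1::real})"
  have "compact K'" unfolding K'_def
    by (intro compact_continuous_image compact_Times K) (auto intro!: continuous_intros simp: split_beta)
  have "\<Phi> x = 0" if "x \<notin> K'" for x
  proof -
    have "\<psi> (x - t *\<^sub>R h) = 0" if "t \<in> {0..1}" for t
    proof (rule K(2), rule notI)
      assume "x - t *\<^sub>R h \<in> K"
      then have "x - t *\<^sub>R h + t *\<^sub>R h \<in> K'" using that unfolding K'_def by force
      then show False using \<open>x \<notin> K'\<close> by simp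
    qed
    then have "integral {0..1} (\<lambda>t. \<psi> (x - t *\<^sub>R h)) = integral {0..1::real} (\<lambda>t. 0)"
      by (rule Henstock_Kurzweil_Integration.integral_cong)
    then show ?thesis by (simp add: \<Phi>_def)
  qed
  then have sub: "closure {x. \<Phi> x \<noteq> 0} \<subseteq> K'"
    by (intro closure_minimal compact_imp_closed \<open>compact K'\<close>) auto
  then have "compact (closure {x. \<Phi> x \<noteq> 0})"
    using \<open>compact K'\<close> by (meson bounded_subset closed_closure compact_eq_bounded_closed)
  moreover have "K' \<subseteq> \<Omega>" using \<Omega> by (auto simp: K'_def)
  ultimately have mem: "\<Phi> \<in> C1_compact_support \<Omega>"
    using sub d I_cont unfolding C1_compact_support_def
    by (auto intro!: continuous_intros simp: fd differentiable_on_def differentiable_def)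
  have bound: "norm (\<Phi> x) \<le> norm h" for x
  proof -
    have "norm (integral {0..1} (\<lambda>t. \<psi> (x - t *\<^sub>R h))) \<le> 1 * measure lborel (cbox 0 (1::real))"
      unfolding cbox_interval[symmetric]
    proof (rule integrable_bound)
      show "(\<lambda>t. \<psi> (x - t *\<^sub>R h)) integrable_on cbox 0 (1::real)"
        by (intro integrable_continuous continuous_intros cont) auto
    qed (use le in auto)
    then have "\<bar>integral {0..1} (\<lambda>t. \<psi> (x - t *\<^sub>R h))\<bar> * norm h \<le> 1 * norm h"
      by (intro mult_right_mono) auto
    then show ?thesis by (simp add: \<Phi>_def)
  qed
  have div: "divergence \<Phi> x = \<psi> (x - h) - \<psi> x" for x
  proof -
    have "((\<lambda>t. - (g (x - t *\<^sub>R h) \<bullet> h)) has_integral \<psi> (x - 1 *\<^sub>R h) - \<psi> (x - 0 *\<^sub>R h)) {0..1}"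
    proof (rule fundamental_theorem_of_calculus)
      fix t :: real
      have "((\<lambda>t. \<psi> (x - t *\<^sub>R h)) has_derivative (\<lambda>s. g (x - t *\<^sub>R h) \<bullet> (- (s *\<^sub>R h)))) (at t)"
        by (rule has_derivative_compose[OF _ d\<psi>]) (auto intro!: derivative_eq_intros)
      then show "((\<lambda>t. \<psi> (x - t *\<^sub>R h)) has_vector_derivative - (g (x - t *\<^sub>R h) \<bullet> h)) (at t within {0..1})"
        unfolding has_vector_derivative_def by (rule has_derivative_eq_rhs[OF has_derivative_at_withinI]) auto
    qed simp
    then have "integral {0..1} (\<lambda>t. - (g (x - t *\<^sub>R h) \<bullet> h)) = \<psi> (x - 1 *\<^sub>R h) - \<psi> (x - 0 *\<^sub>R h)"
      by (rule integral_unique)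
    moreover have "integral {0..1} (\<lambda>t. g (x - t *\<^sub>R h) \<bullet> h) = I x \<bullet> h"
    proof -
      have "(\<lambda>t. g (x - t *\<^sub>R h)) integrable_on cbox 0 (1::real)"
        by (intro integrable_continuous continuous_intros cont) auto
      from integral_linear[OF this bounded_linear_inner_left[of h]] show ?thesis
        by (simp add: I_def o_def)
    qed
    ultimately have "- (I x \<bullet> h) = \<psi> (x - h) - \<psi> x" by simp
    moreover have "divergence \<Phi> x = - (I x \<bullet> h)"
      unfolding divergence_def fd euclidean_inner[of "I x" h] by (simp add: sum_negf)
    ultimately show ?thesis by simp
  qed
  show ?thesis by (rule that[OF mem bound div])
qed

text \<open>Here \<open>f\<close> plays the role of a Borel representative of \<open>u\<close> extended by zero.\<close>

definition variation_le :: "'a::euclidean_space set \<Rightarrow> ('a \<Rightarrow> real) \<Rightarrow> real \<Rightarrow> bool"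
  where "variation_le \<Omega> f V \<longleftrightarrow> (\<forall>\<phi>\<in>C1_compact_support \<Omega>. (\<forall>x\<in>\<Omega>. norm (\<phi> x) \<le> 1) \<longrightarrow>
    (LINT x|lborel. f x * divergence \<phi> x) \<le> V)"

lemma C1_compact_support_frechet:
  assumes "\<phi> \<in> C1_compact_support \<Omega>"
  shows "(\<phi> has_derivative frechet_derivative \<phi> (at x)) (at x)"
proof -
  have "\<phi> differentiable (at x)" using assms by (simp add: C1_compact_support_def differentiable_on_def)
  then show ?thesis by (rule frechet_derivative_works[THEN iffD1])
qed

lemma C1_compact_support_scaleR:
  assumes \<phi>: "\<phi> \<in> C1_compact_support \<Omega>"
  shows "(\<lambda>x. c *\<^sub>R \<phi> x) \<in> C1_compact_support \<Omega>"
    and "divergence (\<lambda>x. c *\<^sub>R \<phi> x) x = c * divergence \<phi> x"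
proof -
  have d: "((\<lambda>x. c *\<^sub>R \<phi> x) has_derivative (\<lambda>v. c *\<^sub>R frechet_derivative \<phi> (at x) v)) (at x)" for x
    by (intro derivative_intros C1_compact_support_frechet[OF \<phi>])
  then have fd: "frechet_derivative (\<lambda>x. c *\<^sub>R \<phi> x) (at x) = (\<lambda>v. c *\<^sub>R frechet_derivative \<phi> (at x) v)" for x
    by (rule frechet_derivative_at[symmetric])
  have sub: "closure {x. c *\<^sub>R \<phi> x \<noteq> 0} \<subseteq> closure {x. \<phi> x \<noteq> 0}"
    by (intro closure_mono) auto
  then have "compact (closure {x. c *\<^sub>R \<phi> x \<noteq> 0})"
    using \<phi> unfolding C1_compact_support_def
    by (metis (no_types, lifting) bounded_subset closed_closure compact_eq_bounded_closed mem_Collect_eq)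
  then show "(\<lambda>x. c *\<^sub>R \<phi> x) \<in> C1_compact_support \<Omega>"
    using \<phi> sub d unfolding C1_compact_support_def
    by (auto simp: fd differentiable_on_def differentiable_def intro!: continuous_intros)
  show "divergence (\<lambda>x. c *\<^sub>R \<phi> x) x = c * divergence \<phi> x"
    by (simp add: divergence_def fd sum_distrib_left)
qed

section \<open>Translation invariance and differences of integrable functions\<close>

lemma nn_integral_lborel_translate:
  fixes h :: "'a::euclidean_space"
  assumes [measurable]: "F \<in> borel_measurable borel"
  shows "(\<integral>\<^sup>+x. F (h + x) \<partial>lborel) = (\<integral>\<^sup>+x. F x \<partial>lborel)"
proof -
  have "(\<integral>\<^sup>+x. F x \<partial>distr lborel borel ((+) h)) = (\<integral>\<^sup>+x. F (h + x) \<partial>lborel)"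
    by (rule nn_integral_distr) auto
  then show ?thesis by (simp add: lborel_distr_plus)
qed

lemma integral_lborel_translate:
  fixes h :: "'a::euclidean_space" and F :: "'a \<Rightarrow> real"
  assumes [measurable]: "F \<in> borel_measurable borel"
  shows "(LINT x|lborel. F (h + x)) = (LINT x|lborel. F x)"
proof -
  have "(LINT x|distr lborel borel ((+) h). F x) = (LINT x|lborel. F (h + x))"
    by (rule integral_distr) auto
  then show ?thesis by (simp add: lborel_distr_plus)
qed

lemma integrable_lborel_translate:
  fixes h :: "'a::euclidean_space" and F :: "'a \<Rightarrow> real"
  assumes "integrable lborel F"
  shows "integrable lborel (\<lambda>x. F (h + x))"
proof -
  have [measurable]: "F \<in> borel_measurable borel" using assms by auto
  have "integrable (distr lborel borel ((+) h)) F" using assms by (simp add: lborel_distr_plus)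
  then show ?thesis by (subst (asm) integrable_distr_eq) auto
qed

text \<open>Integrating \<open>f\<close> against the divergence of the transport field gives the
  integral of \<open>f x * (\<psi> (x - h) - \<psi> x)\<close>; a change of variables moves the
  difference onto \<open>f\<close>. The field has norm at most \<open>norm h\<close>, so it is
  tested after division by \<open>norm h\<close>. A one-sided bound is enough, the sign of \<psi>
  being free.\<close>

lemma integral_difference_C1_le:
  fixes f :: "'a::euclidean_space \<Rightarrow> real"
  assumes f: "integrable lborel f" and V: "variation_le \<Omega> f V"
    and \<psi>: "C1_scalar \<psi> g" and le: "\<And>x. \<bar>\<psi> x\<bar> \<le> 1"
    and K: "compact K" "\<And>x. x \<notin> K \<Longrightarrow> \<psi> x = 0"
    and \<Omega>: "\<And>x t. x \<in> K \<Longrightarrow> t \<in> {0..1} \<Longrightarrow> x + t *\<^sub>R h \<in> \<Omega>"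
  shows "(LINT x|lborel. (f (x + h) - f x) * \<psi> x) \<le> norm h * V"
proof (cases "h = 0")
  case False
  obtain \<Phi> where \<Phi>: "\<Phi> \<in> C1_compact_support \<Omega>" "\<And>x. norm (\<Phi> x) \<le> norm h"
    "\<And>x. divergence \<Phi> x = \<psi> (x - h) - \<psi> x"
    using transport_field[OF \<psi> le K \<Omega>] by blast
  have [measurable]: "f \<in> borel_measurable borel" using f by auto
  have [measurable]: "\<psi> \<in> borel_measurable borel"
    by (intro borel_measurable_continuous_onI C1_scalar_continuous[OF \<psi>])
  have int: "integrable lborel (\<lambda>x. f x * \<psi> (x - a))" for a
    by (rule Bochner_Integration.integrable_bound[OF f]) (auto simp: abs_mult intro!: mult_left_le le)
  have int': "integrable lborel (\<lambda>x. f (x + h) * \<psi> x)"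
    using integrable_lborel_translate[OF int[of h], of h] by (simp add: add.commute)
  have "(LINT x|lborel. f x * divergence (\<lambda>x. (1 / norm h) *\<^sub>R \<Phi> x) x) \<le> V"
    using V C1_compact_support_scaleR(1)[OF \<Phi>(1), of "1 / norm h"] \<Phi>(2) False
    unfolding variation_le_def by (auto simp: field_simps)
  also have "(LINT x|lborel. f x * divergence (\<lambda>x. (1 / norm h) *\<^sub>R \<Phi> x) x)
      = (1 / norm h) * (LINT x|lborel. f x * (\<psi> (x - h) - \<psi> x))"
    unfolding C1_compact_support_scaleR(2)[OF \<Phi>(1)] \<Phi>(3)
    by (subst integral_mult_right_zero[symmetric]) (simp add: mult_ac)
  finally have "(LINT x|lborel. f x * (\<psi> (x - h) - \<psi> x)) \<le> norm h * V"
    using False by (simp add: field_simps)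
  also have "(LINT x|lborel. f x * (\<psi> (x - h) - \<psi> x))
      = (LINT x|lborel. f x * \<psi> (x - h)) - (LINT x|lborel. f x * \<psi> x)"
    using int[of h] int[of 0] by (simp add: right_diff_distrib)
  also have "(LINT x|lborel. f x * \<psi> (x - h)) = (LINT x|lborel. f (x + h) * \<psi> x)"
    using integral_lborel_translate[of "\<lambda>x. f x * \<psi> (x - h)" h] by (simp add: add.commute)
  also have "\<dots> - (LINT x|lborel. f x * \<psi> x) = (LINT x|lborel. (f (x + h) - f x) * \<psi> x)"
    using int' int[of 0] by (simp add: left_diff_distrib)
  finally show ?thesis .
qed simp

text \<open>A finite sum of the bumps of \<open>C1_scalar_bump\<close> over a cover of
  \<open>C\<close>, scaled below 1. Only positivity on \<open>C\<close> is arranged; powers of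
  \<open>1 - S\<close> later sharpen this to an indicator.\<close>

lemma ex_C1_bump:
  fixes C :: "'a::euclidean_space set"
  assumes "compact C" "open U" "C \<subseteq> U"
  obtains S g K where "C1_scalar S g" "compact K" "K \<subseteq> U" "\<And>x. x \<notin> K \<Longrightarrow> S x = 0"
    "\<And>x. x \<in> C \<Longrightarrow> 0 < S x" "\<And>x. 0 \<le> S x" "\<And>x. S x \<le> 1"
proof -
  have "\<forall>c\<in>C. \<exists>r>0. cball c r \<subseteq> U"
    using assms(2,3) by (meson open_contains_cball subsetD)
  then obtain r where r: "\<And>c. c \<in> C \<Longrightarrow> 0 < r c \<and> cball c (r c) \<subseteq> U" by metis
  obtain D where D: "D \<subseteq> C" "finite D" "C \<subseteq> (\<Union>c\<in>D. ball c (r c))"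
  proof (rule compactE_image[OF \<open>compact C\<close>, of C "\<lambda>c. ball c (r c)"])
    show "C \<subseteq> (\<Union>c\<in>C. ball c (r c))" using r by force
  qed auto
  define B where "B c x = (max 0 ((r c)\<^sup>2 - (norm (x - c))\<^sup>2))\<^sup>2" for c x
  define M where "M = (\<Sum>c\<in>D. ((r c)\<^sup>2)\<^sup>2)"
  \<comment> \<open>The divisor \<open>M + 1\<close> stays positive even when \<open>D\<close> is
    empty.\<close>
  define S where "S x = (\<Sum>c\<in>D. B c x) * (1 / (M + 1))" for x
  have "M \<ge> 0" by (auto simp: M_def intro: sum_nonneg)
  have B: "0 \<le> B c x" "B c x \<le> ((r c)\<^sup>2)\<^sup>2" for c x
    unfolding B_def by (intro zero_le_power2 power_mono; simp)+
  have "\<exists>g. C1_scalar (\<lambda>x. \<Sum>c\<in>D. B c x) g"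
    unfolding B_def by (intro C1_scalar_sum C1_scalar_bump)
  then obtain g' where "C1_scalar (\<lambda>x. \<Sum>c\<in>D. B c x) g'" ..
  from C1_scalar_mult[OF this C1_scalar_const[of "1 / (M + 1)"]]
  obtain g where g: "C1_scalar S g" unfolding S_def[abs_def] by blast
  show thesis
  proof (rule that[OF g, of "\<Union>c\<in>D. cball c (r c)"])
    show "compact (\<Union>c\<in>D. cball c (r c))" using D by (intro compact_UN) auto
    show "(\<Union>c\<in>D. cball c (r c)) \<subseteq> U" using D r by blast
  next
    fix x assume "x \<notin> (\<Union>c\<in>D. cball c (r c))"
    then have "B c x = 0" if "c \<in> D" for c
    proof -
      have "r c < norm (x - c)" "0 < r c"
        using \<open>x \<notin> _\<close> that D r by (auto simp: dist_norm norm_minus_commute)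
      then have "(r c)\<^sup>2 \<le> (norm (x - c))\<^sup>2" by (intro power_mono) auto
      then show ?thesis by (simp add: B_def)
    qed
    then show "S x = 0" by (simp add: S_def)
  next
    fix x assume "x \<in> C"
    then obtain c where c: "c \<in> D" "x \<in> ball c (r c)" using D by auto
    then have "(norm (x - c))\<^sup>2 < (r c)\<^sup>2"
      by (intro power_strict_mono) (auto simp: dist_norm norm_minus_commute)
    then have "0 < B c x" by (simp add: B_def)
    then have "0 < (\<Sum>c\<in>D. B c x)" using c D B by (intro sum_pos2) auto
    then show "0 < S x" using \<open>M \<ge> 0\<close> by (auto simp: S_def)
  next
    fix x
    show "0 \<le> S x"
      using B \<open>M \<ge> 0\<close> by (auto simp: S_def intro!: divide_nonneg_nonneg sum_nonneg)
    have "(\<Sum>c\<in>D. B c x) \<le> M" unfolding M_def by (intro sum_mono B)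
    then show "S x \<le> 1" using \<open>M \<ge> 0\<close> by (simp add: S_def)
  qed
qed

text \<open>The extremal test function would be \<open>sgn (f (x + h) - f x)\<close> on
  \<open>A\<close> and 0 elsewhere. It is only measurable, so it is approximated almost everywhere
  by C1 functions bounded by 1 that vanish off one compact subset of \<open>U\<close>; dominated
  convergence carries the bound of \<open>integral_difference_C1_le\<close> to the limit.\<close>

lemma nn_integral_difference_compact_le:
  fixes f :: "'a::euclidean_space \<Rightarrow> real"
  assumes f: "integrable lborel f" and V: "variation_le \<Omega> f V"
    and A[measurable]: "A \<in> sets borel" and C: "compact C" "A \<subseteq> C" "open U" "C \<subseteq> U"
    and \<Omega>: "\<And>x t. x \<in> U \<Longrightarrow> t \<in> {0..1} \<Longrightarrow> x + t *\<^sub>R h \<in> \<Omega>"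
  shows "(\<integral>\<^sup>+x\<in>A. ennreal \<bar>f (x + h) - f x\<bar> \<partial>lborel) \<le> ennreal (norm h * V)"
proof -
  obtain S g K where S: "C1_scalar S g" "\<And>x. x \<notin> K \<Longrightarrow> S x = 0"
    "\<And>x. x \<in> C \<Longrightarrow> 0 < S x" "\<And>x. 0 \<le> S x" "\<And>x. S x \<le> 1" and K: "compact K" "K \<subseteq> U"
    using ex_C1_bump[OF \<open>compact C\<close> \<open>open U\<close> \<open>C \<subseteq> U\<close>] by metis
  have [measurable]: "f \<in> borel_measurable borel" using f by auto
  define D where "D x = f (x + h) - f x" for x
  define \<sigma> where "\<sigma> x = sgn (D x) * indicator A x" for x
  have [measurable]: "D \<in> borel_measurable borel" unfolding D_def[abs_def] by measurable
  have [measurable]: "\<sigma> \<in> borel_measurable borel" unfolding \<sigma>_def[abs_def] sgn_real_def by measurable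
  have D_int: "integrable lborel D" unfolding D_def[abs_def]
    using f integrable_lborel_translate[OF f, of h] by (auto simp: add.commute)
  have "\<sigma> measurable_on UNIV"
    by (rule lebesgue_measurable_imp_measurable_on) (auto intro: measurable_completion)
  then obtain N G where N: "negligible N" and G: "\<And>n. continuous_on UNIV (G n)"
    and lim: "\<And>x. x \<notin> N \<Longrightarrow> (\<lambda>n. G n x) \<longlonglongrightarrow> \<sigma> x"
    unfolding measurable_on_def by auto
  \<comment> \<open>Truncation to the interval from -1 to 1 does not change the limit, since
    \<open>\<sigma>\<close> takes only the values -1, 0 and 1.\<close>
  define H where "H n x = max (- 1) (min 1 (G n x))" for n x
  have H_lim: "(\<lambda>n. H n x) \<longlonglongrightarrow> \<sigma> x" if "x \<notin> N" for x
  proof -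
    have "(\<lambda>n. H n x) \<longlonglongrightarrow> max (- 1) (min 1 (\<sigma> x))"
      unfolding H_def by (intro tendsto_intros lim that)
    moreover have "max (- 1) (min 1 (\<sigma> x)) = \<sigma> x"
      by (auto simp: \<sigma>_def sgn_real_def indicator_def)
    ultimately show ?thesis by simp
  qed
  have "\<exists>p. real_polynomial_function p \<and> (\<forall>x\<in>K. \<bar>H n x - p x\<bar> < 1 / (real n + 1))" for n
  proof -
    have "continuous_on K (H n)"
      unfolding H_def by (intro continuous_intros continuous_on_subset[OF G]) auto
    then obtain p where "real_polynomial_function p" "\<And>x. x \<in> K \<Longrightarrow> \<bar>H n x - p x\<bar> < 1 / (real n + 1)"
      by (rule Stone_Weierstrass_real_polynomial_function[OF K(1), of "H n" "1 / (real n + 1)"]) auto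
    then show ?thesis by blast
  qed
  then obtain p where p: "\<And>n. real_polynomial_function (p n)"
    "\<And>n x. x \<in> K \<Longrightarrow> \<bar>H n x - p n x\<bar> < 1 / (real n + 1)" by metis
  \<comment> \<open>A polynomial within \<open>1 / (n + 1)\<close> of \<open>H n\<close> may exceed
    1 in absolute value by that much; the factor \<open>c n\<close>, which tends to 1, restores the
    bound 1 demanded of \<psi>.\<close>
  define c where "c n = 1 / (1 + 1 / (real n + 1))" for n
  have c_pos: "c n > 0" for n by (auto simp: c_def intro!: divide_pos_pos add_pos_nonneg)
  \<comment> \<open>The factor \<open>1 - (1 - S)\<^sup>n\<close> is C1 and tends to the indicator of the set where \<open>S\<close> is positive.\<close>
  define \<psi> where "\<psi> n x = c n * p n x * (1 - (1 - S x) ^ n)" for n x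
  have \<psi>_C1: "\<exists>g. C1_scalar (\<psi> n) g" for n
  proof -
    obtain gp where gp: "C1_scalar (p n) gp" using C1_scalar_polynomial[OF p(1)] by blast
    have "((\<lambda>s. 1 - (1 - s) ^ n) has_real_derivative real n * (1 - s) ^ (n - 1)) (at s)" for s :: real
      by (auto intro!: derivative_eq_intros)
    moreover have "continuous_on UNIV (\<lambda>s::real. real n * (1 - s) ^ (n - 1))"
      by (intro continuous_intros)
    ultimately have "C1_scalar (\<lambda>x. 1 - (1 - S x) ^ n) (\<lambda>x. (real n * (1 - S x) ^ (n - 1)) *\<^sub>R g x)"
      by (rule C1_scalar_compose[OF S(1)])
    from C1_scalar_mult[OF C1_scalar_mult[OF C1_scalar_const[of "c n"] gp] this]
    show ?thesis unfolding \<psi>_def[abs_def] by blast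
  qed
  have \<chi>: "0 \<le> 1 - (1 - S x) ^ n" "1 - (1 - S x) ^ n \<le> 1" for n x
    using S(4)[of x] S(5)[of x] by (auto intro: power_le_one)
  have \<psi>_le: "\<bar>\<psi> n x\<bar> \<le> 1" for n x
  proof (cases "x \<in> K")
    case True
    have "\<bar>H n x\<bar> \<le> 1" by (auto simp: H_def)
    then have "\<bar>p n x\<bar> \<le> 1 + 1 / (real n + 1)" using p(2)[OF True, of n] by linarith
    then have "c n * \<bar>p n x\<bar> \<le> c n * (1 + 1 / (real n + 1))"
      using c_pos[of n] by (intro mult_left_mono) auto
    also have "\<dots> = 1"
    proof -
      have "1 + 1 / (real n + 1) > 0" by (intro add_pos_pos) auto
      then show ?thesis by (simp add: c_def)
    qed
    finally have "\<bar>c n * p n x\<bar> \<le> 1" using c_pos[of n] by (simp add: abs_mult)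
    then have "\<bar>c n * p n x\<bar> * \<bar>1 - (1 - S x) ^ n\<bar> \<le> 1"
      using \<chi>[of x n] by (intro mult_le_one) auto
    then show ?thesis by (simp add: \<psi>_def abs_mult)
  qed (simp add: \<psi>_def S(2))
  have \<psi>_lim: "(\<lambda>n. \<psi> n x) \<longlonglongrightarrow> \<sigma> x" if "x \<notin> N" for x
  proof (cases "x \<in> K")
    case True
    have c_lim: "c \<longlonglongrightarrow> 1"
    proof -
      have "(\<lambda>n. 1 / (real n + 1)) \<longlonglongrightarrow> 0"
        using LIMSEQ_inverse_real_of_nat by (simp add: inverse_eq_divide add.commute)
      then have "(\<lambda>n. 1 / (1 + 1 / (real n + 1))) \<longlonglongrightarrow> 1 / (1 + 0)"
        by (intro tendsto_intros) auto
      then show ?thesis by (simp add: c_def[abs_def])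
    qed
    have "(\<lambda>n. H n x - p n x) \<longlonglongrightarrow> 0"
    proof (rule Lim_null_comparison)
      show "\<forall>\<^sub>F n in sequentially. norm (H n x - p n x) \<le> 1 / (real n + 1)"
        using p(2)[OF True] by (auto intro: less_imp_le always_eventually)
      show "(\<lambda>n. 1 / (real n + 1)) \<longlonglongrightarrow> 0"
        using LIMSEQ_inverse_real_of_nat by (simp add: inverse_eq_divide add.commute)
    qed
    from tendsto_diff[OF H_lim[OF that] this] have p_lim: "(\<lambda>n. p n x) \<longlonglongrightarrow> \<sigma> x" by simp
    from tendsto_mult[OF c_lim this] have cp_lim: "(\<lambda>n. c n * p n x) \<longlonglongrightarrow> \<sigma> x" by simp
    show ?thesis
    proof (cases "x \<in> A")
      case True
      then have "0 < S x" using C S(3) by auto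
      then have "(\<lambda>n. (1 - S x) ^ n) \<longlonglongrightarrow> 0"
        using S(5)[of x] by (intro LIMSEQ_power_zero) auto
      then have "(\<lambda>n. c n * p n x * (1 - (1 - S x) ^ n)) \<longlonglongrightarrow> \<sigma> x * (1 - 0)"
        by (intro tendsto_mult cp_lim tendsto_diff tendsto_const)
      then show ?thesis by (simp add: \<psi>_def)
    next
      case False
      then have "\<sigma> x = 0" by (simp add: \<sigma>_def)
      \<comment> \<open>On \<open>K\<close> outside \<open>A\<close> the cutoff factor merely stays
        between 0 and 1; the convergence comes from \<open>c n * p n x\<close>, whose limit is 0
        here.\<close>
      show ?thesis unfolding \<open>\<sigma> x = 0\<close>
      proof (rule Lim_null_comparison)
        show "(\<lambda>n. \<bar>c n * p n x\<bar>) \<longlonglongrightarrow> 0"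
          using cp_lim \<open>\<sigma> x = 0\<close> by (auto intro: tendsto_rabs_zero)
        show "\<forall>\<^sub>F n in sequentially. norm (\<psi> n x) \<le> \<bar>c n * p n x\<bar>"
          using \<chi> by (auto simp: \<psi>_def abs_mult intro!: always_eventually mult_left_le)
      qed
    qed
  next
    case False
    then have "\<psi> n x = 0" for n by (simp add: \<psi>_def S(2))
    moreover have "x \<notin> A" using False S(2)[OF False] S(3)[of x] C by auto
    ultimately show ?thesis by (simp add: \<sigma>_def)
  qed
  have \<psi>_meas[measurable]: "\<psi> n \<in> borel_measurable borel" for n
  proof -
    obtain g where "C1_scalar (\<psi> n) g" using \<psi>_C1[of n] ..
    then show ?thesis by (intro borel_measurable_continuous_onI C1_scalar_continuous)
  qed
  have "N \<in> null_sets lebesgue" using N by (simp add: negligible_iff_null_sets)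
  from AE_not_in[OF this] have AE: "AE x in lborel. x \<notin> N"
    by (simp add: AE_completion_iff)
  have "(\<lambda>n. LINT x|lborel. D x * \<psi> n x) \<longlonglongrightarrow> (LINT x|lborel. D x * \<sigma> x)"
  proof (rule integral_dominated_convergence)
    show "integrable lborel (\<lambda>x. \<bar>D x\<bar>)" using D_int by (rule integrable_abs)
    show "AE x in lborel. (\<lambda>n. D x * \<psi> n x) \<longlonglongrightarrow> D x * \<sigma> x"
      using AE by eventually_elim (intro tendsto_intros \<psi>_lim)
    show "AE x in lborel. norm (D x * \<psi> n x) \<le> \<bar>D x\<bar>" for n
      using \<psi>_le by (auto simp: abs_mult intro!: mult_left_le)
  qed measurable
  moreover have "(LINT x|lborel. D x * \<psi> n x) \<le> norm h * V" for n
  proof -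
    obtain g where "C1_scalar (\<psi> n) g" using \<psi>_C1[of n] ..
    then show ?thesis unfolding D_def
    proof (rule integral_difference_C1_le[OF f V _ \<psi>_le K(1)])
      show "\<psi> n x = 0" if "x \<notin> K" for x using that S(2) by (simp add: \<psi>_def)
      show "x + t *\<^sub>R h \<in> \<Omega>" if "x \<in> K" "t \<in> {0..1}" for x t using that K(2) \<Omega> by blast
    qed
  qed
  ultimately have le: "(LINT x|lborel. D x * \<sigma> x) \<le> norm h * V"
    by (intro LIMSEQ_le_const2) auto
  have "D x * \<sigma> x = \<bar>D x\<bar> * indicator A x" for x by (auto simp: \<sigma>_def sgn_real_def)
  moreover have "integrable lborel (\<lambda>x. \<bar>D x\<bar> * indicator A x)"
    by (rule Bochner_Integration.integrable_bound[OF D_int]) (auto simp: indicator_def)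
  then have "(\<integral>\<^sup>+x. ennreal (\<bar>D x\<bar> * indicator A x) \<partial>lborel) = ennreal (LINT x|lborel. \<bar>D x\<bar> * indicator A x)"
    by (intro nn_integral_eq_integral) auto
  moreover have "(\<integral>\<^sup>+x\<in>A. ennreal \<bar>D x\<bar> \<partial>lborel) = (\<integral>\<^sup>+x. ennreal (\<bar>D x\<bar> * indicator A x) \<partial>lborel)"
    by (simp add: ennreal_mult' ennreal_indicator)
  ultimately have "(\<integral>\<^sup>+x\<in>A. ennreal \<bar>D x\<bar> \<partial>lborel) = ennreal (LINT x|lborel. D x * \<sigma> x)"
    by presburger
  also have "\<dots> \<le> ennreal (norm h * V)" using le by (rule ennreal_leI)
  finally show ?thesis by (simp only: D_def)
qed

section \<open>Differences on the whole set of admissible segments\<close>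

definition segment_set :: "'a::euclidean_space set \<Rightarrow> 'a \<Rightarrow> 'a set"
  where "segment_set \<Omega> h = {x. \<forall>t\<in>{0..1}. x + t *\<^sub>R h \<in> \<Omega>}"

text \<open>The complement is the Minkowski sum of the closed set \<open>- \<Omega>\<close> and a
  compact segment, hence closed.\<close>

lemma open_segment_set:
  assumes "open \<Omega>" shows "open (segment_set \<Omega> h)"
proof -
  have "closed (\<Union>y\<in>- \<Omega>. \<Union>z\<in>(\<lambda>t. - (t *\<^sub>R h)) ` {0..1}. {y + z})"
    using \<open>open \<Omega>\<close>
    by (intro closed_compact_sums compact_continuous_image continuous_intros compact_Icc) auto
  also have "(\<Union>y\<in>- \<Omega>. \<Union>z\<in>(\<lambda>t. - (t *\<^sub>R h)) ` {0..1}. {y + z}) = - segment_set \<Omega> h"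
  proof (intro equalityI subsetI)
    fix x assume "x \<in> - segment_set \<Omega> h"
    then obtain t where "t \<in> {0..1}" "x + t *\<^sub>R h \<notin> \<Omega>" by (auto simp: segment_set_def)
    then show "x \<in> (\<Union>y\<in>- \<Omega>. \<Union>z\<in>(\<lambda>t. - (t *\<^sub>R h)) ` {0..1}. {y + z})"
      by (intro UN_I[of "x + t *\<^sub>R h"] UN_I[of "- (t *\<^sub>R h)"]) auto
  qed (force simp: segment_set_def)
  finally show ?thesis by (simp add: closed_def)
qed

text \<open>The upper bounds below see a BV function only through this predicate. \<open>V\<close>
  is any bound for the variation, not the variation itself, so that it may be enlarged.\<close>

definition difference_bounded :: "'a::euclidean_space set \<Rightarrow> ('a \<Rightarrow> real) \<Rightarrow> real \<Rightarrow> bool"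
  where "difference_bounded \<Omega> f V \<longleftrightarrow> integrable lborel f \<and> 0 \<le> V \<and>
    (\<forall>h. (\<integral>\<^sup>+x\<in>segment_set \<Omega> h. ennreal \<bar>f (x + h) - f x\<bar> \<partial>lborel) \<le> ennreal (norm h * V))"

text \<open>The open set of admissible base points is an increasing union of compact sets. The
  integrals over these, read as values of the measure with the given density, increase to the
  integral over the whole set.\<close>

lemma variation_le_imp_difference_bounded:
  fixes f :: "'a::euclidean_space \<Rightarrow> real"
  assumes f: "integrable lborel f" and V: "variation_le \<Omega> f V" "0 \<le> V" and "open \<Omega>"
  shows "difference_bounded \<Omega> f V"
proof -
  have "(\<integral>\<^sup>+x\<in>segment_set \<Omega> h. ennreal \<bar>f (x + h) - f x\<bar> \<partial>lborel) \<le> ennreal (norm h * V)" for h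
  proof -
    have "open (segment_set \<Omega> h)" by (rule open_segment_set[OF \<open>open \<Omega>\<close>])
    then obtain C where C: "\<And>n. compact (C n)" "\<And>n. C n \<subseteq> segment_set \<Omega> h"
      "\<And>n. C n \<subseteq> interior (C (Suc n))" "\<Union>(range C) = segment_set \<Omega> h"
      by (rule open_Union_compact_subsets) blast
    have [measurable]: "f \<in> borel_measurable borel" using f by auto
    have C_meas: "C n \<in> sets borel" for n using C(1) by (auto intro: borel_compact)
    let ?M = "density lborel (\<lambda>x. ennreal \<bar>f (x + h) - f x\<bar>)"
    have em: "emeasure ?M B = (\<integral>\<^sup>+x\<in>B. ennreal \<bar>f (x + h) - f x\<bar> \<partial>lborel)" if "B \<in> sets borel" for B
      using that by (intro emeasure_density) auto
    have "emeasure ?M (segment_set \<Omega> h) = (SUP n. emeasure ?M (C n))"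
      unfolding C(4)[symmetric]
    proof (rule SUP_emeasure_incseq[symmetric])
      show "incseq C" using C(3) interior_subset by (intro incseq_SucI) blast
    qed (use C_meas in auto)
    also have "\<dots> \<le> ennreal (norm h * V)"
    proof (rule SUP_least)
      fix n
      have "(\<integral>\<^sup>+x\<in>C n. ennreal \<bar>f (x + h) - f x\<bar> \<partial>lborel) \<le> ennreal (norm h * V)"
        using C(1,2) C_meas \<open>open (segment_set \<Omega> h)\<close>
        by (intro nn_integral_difference_compact_le[OF f V(1), of _ "C n" "segment_set \<Omega> h"])
          (auto simp: segment_set_def)
      then show "emeasure ?M (C n) \<le> ennreal (norm h * V)" by (simp only: em C_meas)
    qed
    finally show ?thesis using \<open>open (segment_set \<Omega> h)\<close> by (simp add: em)
  qed
  then show ?thesis using f V(2) by (simp add: difference_bounded_def)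
qed

section \<open>Poincare inequality in the interior\<close>

lemma ball_in_sets_borel [measurable]: "ball (x::'a::euclidean_space) r \<in> sets borel"
  by simp

lemma emeasure_lborel_ball_eq:
  fixes x :: "'a::euclidean_space"
  shows "emeasure lborel (ball x r) = ennreal (measure lborel (ball x r))"
  using emeasure_bounded_finite[OF bounded_ball, of x r] by (intro emeasure_eq_ennreal_measure) auto

lemma measure_lborel_ball_pos:
  fixes x :: "'a::euclidean_space"
  assumes "0 < r" shows "0 < measure lborel (ball x r)"
  using content_ball_pos[OF assms, of x] by simp

lemma difference_boundedD:
  assumes "difference_bounded \<Omega> f V"
  shows "integrable lborel f" "0 \<le> V" "f \<in> borel_measurable borel"
    "(\<integral>\<^sup>+x\<in>segment_set \<Omega> h. ennreal \<bar>f (x + h) - f x\<bar> \<partial>lborel) \<le> ennreal (norm h * V)"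
  using assms by (auto simp: difference_bounded_def)

text \<open>With \<open>z = y + h\<close> and the order of integration exchanged, the inner integral
  runs over those \<open>y\<close> for which both ends are in the ball. By convexity the segment
  stays there too, so the translation bound gives at most \<open>norm h * V\<close>, and
  \<open>h\<close> ranges over the ball of radius \<open>2 * r\<close> around 0.\<close>

lemma ball_pairs_le:
  fixes f :: "'a::euclidean_space \<Rightarrow> real"
  assumes f: "difference_bounded \<Omega> f V" and B: "ball x0 r \<subseteq> \<Omega>" and "0 < r"
  shows "(\<integral>\<^sup>+y\<in>ball x0 r. (\<integral>\<^sup>+z\<in>ball x0 r. ennreal \<bar>f z - f y\<bar> \<partial>lborel) \<partial>lborel)
    \<le> ennreal (measure lborel (ball (0::'a) (2 * r)) * (2 * r) * V)"
proof -
  note [measurable] = difference_boundedD(3)[OF f]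
  let ?B = "ball x0 r"
  have pair: "(\<lambda>(y, h). ennreal \<bar>f (y + h) - f y\<bar> * indicator ?B (y + h) * indicator ?B y)
      \<in> borel_measurable (lborel \<Otimes>\<^sub>M lborel)"
    by measurable
  have "(\<integral>\<^sup>+y\<in>?B. (\<integral>\<^sup>+z\<in>?B. ennreal \<bar>f z - f y\<bar> \<partial>lborel) \<partial>lborel)
     = (\<integral>\<^sup>+y. (\<integral>\<^sup>+h. ennreal \<bar>f (y + h) - f y\<bar> * indicator ?B (y + h) * indicator ?B y \<partial>lborel) \<partial>lborel)"
  proof (intro nn_integral_cong)
    fix y
    have "(\<integral>\<^sup>+z\<in>?B. ennreal \<bar>f z - f y\<bar> \<partial>lborel) = (\<integral>\<^sup>+h. ennreal \<bar>f (y + h) - f y\<bar> * indicator ?B (y + h) \<partial>lborel)"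
      using nn_integral_lborel_translate[of "\<lambda>z. ennreal \<bar>f z - f y\<bar> * indicator ?B z" y] by simp
    then show "(\<integral>\<^sup>+z\<in>?B. ennreal \<bar>f z - f y\<bar> \<partial>lborel) * indicator ?B y
        = (\<integral>\<^sup>+h. ennreal \<bar>f (y + h) - f y\<bar> * indicator ?B (y + h) * indicator ?B y \<partial>lborel)"
      by (simp add: nn_integral_multc)
  qed
  also have "\<dots> = (\<integral>\<^sup>+h. (\<integral>\<^sup>+y. ennreal \<bar>f (y + h) - f y\<bar> * indicator ?B (y + h) * indicator ?B y \<partial>lborel) \<partial>lborel)"
    using lborel_pair.Fubini'[OF pair] by simp
  also have "\<dots> \<le> (\<integral>\<^sup>+h. ennreal (2 * r * V) * indicator (ball (0::'a) (2 * r)) h \<partial>lborel)"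
  proof (intro nn_integral_mono)
    fix h :: 'a
    show "(\<integral>\<^sup>+y. ennreal \<bar>f (y + h) - f y\<bar> * indicator ?B (y + h) * indicator ?B y \<partial>lborel)
        \<le> ennreal (2 * r * V) * indicator (ball 0 (2 * r)) h"
    proof (cases "norm h < 2 * r")
      case True
      have "(\<integral>\<^sup>+y. ennreal \<bar>f (y + h) - f y\<bar> * indicator ?B (y + h) * indicator ?B y \<partial>lborel)
          \<le> (\<integral>\<^sup>+y\<in>segment_set \<Omega> h. ennreal \<bar>f (y + h) - f y\<bar> \<partial>lborel)"
      proof (intro nn_integral_mono)
        fix y
        have "y \<in> segment_set \<Omega> h" if y: "y \<in> ?B" "y + h \<in> ?B"
        proof -
          have "y + t *\<^sub>R h \<in> ?B" if "t \<in> {0..1}" for t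
          proof -
            have "(1 - t) *\<^sub>R y + t *\<^sub>R (y + h) \<in> ?B"
              using y that by (intro convexD convex_ball) auto
            then show ?thesis by (simp add: algebra_simps)
          qed
          then show ?thesis using B by (auto simp: segment_set_def)
        qed
        then show "ennreal \<bar>f (y + h) - f y\<bar> * indicator ?B (y + h) * indicator ?B y
            \<le> ennreal \<bar>f (y + h) - f y\<bar> * indicator (segment_set \<Omega> h) y"
          by (auto simp: indicator_def)
      qed
      also have "\<dots> \<le> ennreal (norm h * V)" by (rule difference_boundedD(4)[OF f])
      also have "\<dots> \<le> ennreal (2 * r * V)"
        using True difference_boundedD(2)[OF f] by (intro ennreal_leI mult_right_mono) auto
      finally show ?thesis using True by simp
    next
      case False
      have "\<not> (y \<in> ?B \<and> y + h \<in> ?B)" for y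
      proof
        assume "y \<in> ?B \<and> y + h \<in> ?B"
        then have "dist y (y + h) < 2 * r"
          using dist_triangle_half_r[of x0 y "2 * r" "y + h"] by (auto simp: dist_commute)
        then show False using False by (simp add: dist_norm)
      qed
      then have eq: "ennreal \<bar>f (y + h) - f y\<bar> * indicator ?B (y + h) * indicator ?B y = 0" for y
        by (auto simp: indicator_def)
      show ?thesis unfolding eq by simp
    qed
  qed
  also have "\<dots> = ennreal (2 * r * V) * emeasure lborel (ball (0::'a) (2 * r))"
    by (rule nn_integral_cmult_indicator) auto
  also have "\<dots> = ennreal (measure lborel (ball (0::'a) (2 * r)) * (2 * r) * V)"
    using \<open>0 < r\<close> difference_boundedD(2)[OF f] unfolding emeasure_lborel_ball_eq
    by (subst ennreal_mult[symmetric]) (auto simp: mult_ac)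
  finally show ?thesis .
qed

lemma ennreal_le_divideI:
  assumes "ennreal m * a \<le> ennreal W" "0 < m" "0 \<le> W"
  shows "a \<le> ennreal (W / m)"
proof -
  have "a = ennreal (1 / m) * (ennreal m * a)"
    using \<open>0 < m\<close> by (simp add: mult.assoc[symmetric] ennreal_mult[symmetric])
  also have "\<dots> \<le> ennreal (1 / m) * ennreal W" by (intro mult_left_mono assms) auto
  also have "\<dots> = ennreal (W / m)" using assms by (simp add: ennreal_mult[symmetric])
  finally show ?thesis .
qed

text \<open>The mean over the ball serves as \<open>c\<close>: then
  \<open>\<bar>f z - c\<bar>\<close> is at most the mean of \<open>\<bar>f z - f y\<bar>\<close>
  over \<open>y\<close>, and integrating in \<open>z\<close> gives the double integral of
  \<open>ball_pairs_le\<close>.\<close>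

lemma poincare_ball:
  fixes f :: "'a::euclidean_space \<Rightarrow> real"
  assumes f: "difference_bounded \<Omega> f V" and B: "ball x0 r \<subseteq> \<Omega>" and "0 < r"
  shows "\<exists>c. (\<integral>\<^sup>+z\<in>ball x0 r. ennreal \<bar>f z - c\<bar> \<partial>lborel)
    \<le> ennreal (measure lborel (ball (0::'a) (2 * r)) * (2 * r) * V / measure lborel (ball x0 r))"
proof -
  let ?B = "ball x0 r"
  note [measurable] = difference_boundedD(3)[OF f]
  define m where "m = measure lborel ?B"
  have m: "m > 0" using measure_lborel_ball_pos[OF \<open>0 < r\<close>, of x0] by (simp add: m_def)
  define c where "c = (LINT y|lborel. indicator ?B y * f y) / m"
  have fB: "integrable lborel (\<lambda>y. indicator ?B y * f y)"
    by (rule Bochner_Integration.integrable_bound[OF difference_boundedD(1)[OF f]]) (auto simp: indicator_def)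
  have "ennreal m * ennreal \<bar>f z - c\<bar> \<le> (\<integral>\<^sup>+y\<in>?B. ennreal \<bar>f z - f y\<bar> \<partial>lborel)" for z
  proof -
    have iB: "integrable lborel (indicator ?B :: 'a \<Rightarrow> real)"
      using emeasure_bounded_finite[OF bounded_ball, of x0 r]
      by (intro integrable_real_indicator) auto
    have "(LINT y|lborel. indicator ?B y * f z - indicator ?B y * f y) = m * f z - m * c"
      using m fB iB by (subst Bochner_Integration.integral_diff) (auto simp: m_def c_def)
    then have "ennreal m * ennreal \<bar>f z - c\<bar> = ennreal (norm (LINT y|lborel. indicator ?B y * f z - indicator ?B y * f y))"
      using m by (simp add: ennreal_mult[symmetric] abs_mult flip: right_diff_distrib)
    also have "\<dots> \<le> (\<integral>\<^sup>+y. norm (indicator ?B y * f z - indicator ?B y * f y) \<partial>lborel)"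
      using fB iB by (intro integral_norm_bound_ennreal) auto
    also have "\<dots> = (\<integral>\<^sup>+y\<in>?B. ennreal \<bar>f z - f y\<bar> \<partial>lborel)"
      by (intro nn_integral_cong) (auto simp: indicator_def)
    finally show ?thesis .
  qed
  then have "(\<integral>\<^sup>+z\<in>?B. ennreal m * ennreal \<bar>f z - c\<bar> \<partial>lborel)
      \<le> (\<integral>\<^sup>+z\<in>?B. (\<integral>\<^sup>+y\<in>?B. ennreal \<bar>f z - f y\<bar> \<partial>lborel) \<partial>lborel)"
    by (intro nn_integral_mono mult_right_mono) auto
  also have "\<dots> = (\<integral>\<^sup>+z\<in>?B. (\<integral>\<^sup>+y\<in>?B. ennreal \<bar>f y - f z\<bar> \<partial>lborel) \<partial>lborel)"
    by (simp only: abs_minus_commute)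
  also note ball_pairs_le[OF f B \<open>0 < r\<close>]
  finally have "ennreal m * (\<integral>\<^sup>+z\<in>?B. ennreal \<bar>f z - c\<bar> \<partial>lborel)
      \<le> ennreal (measure lborel (ball (0::'a) (2 * r)) * (2 * r) * V)"
    by (simp add: nn_integral_cmult[symmetric] mult.assoc)
  then show ?thesis
    using m \<open>0 < r\<close> difference_boundedD(2)[OF f] unfolding m_def by (intro exI[of _ c] ennreal_le_divideI) auto
qed

text \<open>The triangle inequality through \<open>f w\<close>, averaged over \<open>w\<close> in
  the small ball, leaves a pair integral and the given estimate. The point is that \<open>c\<close>
  does not change, so that steps can be iterated.\<close>

lemma poincare_step:
  fixes f :: "'a::euclidean_space \<Rightarrow> real"
  assumes f: "difference_bounded \<Omega> f V" and B: "ball x r \<subseteq> \<Omega>" and "0 < r"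
    and B': "ball y s \<subseteq> ball x r" "0 < s"
    and small: "(\<integral>\<^sup>+z\<in>ball y s. ennreal \<bar>f z - c\<bar> \<partial>lborel) \<le> ennreal W" "0 \<le> W"
  shows "(\<integral>\<^sup>+z\<in>ball x r. ennreal \<bar>f z - c\<bar> \<partial>lborel)
    \<le> ennreal ((measure lborel (ball (0::'a) (2 * r)) * (2 * r) * V + measure lborel (ball x r) * W)
        / measure lborel (ball y s))"
proof -
  note [measurable] = difference_boundedD(3)[OF f]
  define I where "I = (\<integral>\<^sup>+z\<in>ball x r. ennreal \<bar>f z - c\<bar> \<partial>lborel)"
  have "I \<le> (\<integral>\<^sup>+z\<in>ball x r. ennreal \<bar>f z - f w\<bar> \<partial>lborel) + emeasure lborel (ball x r) * ennreal \<bar>f w - c\<bar>" for w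
  proof -
    have "I \<le> (\<integral>\<^sup>+z. ennreal \<bar>f z - f w\<bar> * indicator (ball x r) z + ennreal \<bar>f w - c\<bar> * indicator (ball x r) z \<partial>lborel)"
      unfolding I_def
    proof (intro nn_integral_mono)
      fix z
      have "ennreal \<bar>f z - c\<bar> \<le> ennreal \<bar>f z - f w\<bar> + ennreal \<bar>f w - c\<bar>"
        by (simp add: ennreal_plus[symmetric] del: ennreal_plus)
      then show "ennreal \<bar>f z - c\<bar> * indicator (ball x r) z
        \<le> ennreal \<bar>f z - f w\<bar> * indicator (ball x r) z + ennreal \<bar>f w - c\<bar> * indicator (ball x r) z"
        by (auto simp: indicator_def)
    qed
    also have "\<dots> = (\<integral>\<^sup>+z\<in>ball x r. ennreal \<bar>f z - f w\<bar> \<partial>lborel) + emeasure lborel (ball x r) * ennreal \<bar>f w - c\<bar>"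
      by (subst nn_integral_add) (auto simp: nn_integral_cmult_indicator mult.commute[of "ennreal _" "emeasure _ _"])
    finally show ?thesis .
  qed
  then have "(\<integral>\<^sup>+w\<in>ball y s. I \<partial>lborel)
      \<le> (\<integral>\<^sup>+w\<in>ball y s. ((\<integral>\<^sup>+z\<in>ball x r. ennreal \<bar>f z - f w\<bar> \<partial>lborel) + emeasure lborel (ball x r) * ennreal \<bar>f w - c\<bar>) \<partial>lborel)"
    by (intro nn_integral_mono mult_right_mono) auto
  also have "\<dots> = (\<integral>\<^sup>+w\<in>ball y s. (\<integral>\<^sup>+z\<in>ball x r. ennreal \<bar>f z - f w\<bar> \<partial>lborel) \<partial>lborel)
      + emeasure lborel (ball x r) * (\<integral>\<^sup>+w\<in>ball y s. ennreal \<bar>f w - c\<bar> \<partial>lborel)"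
    by (subst nn_integral_cmult[symmetric], measurable)
      (subst nn_integral_add[symmetric], auto simp: distrib_right mult.assoc)
  also have "\<dots> \<le> (\<integral>\<^sup>+w\<in>ball x r. (\<integral>\<^sup>+z\<in>ball x r. ennreal \<bar>f z - f w\<bar> \<partial>lborel) \<partial>lborel)
      + emeasure lborel (ball x r) * ennreal W"
    using B' small by (intro add_mono mult_left_mono nn_integral_mono) (auto simp: indicator_def)
  also have "\<dots> \<le> ennreal (measure lborel (ball (0::'a) (2 * r)) * (2 * r) * V) + emeasure lborel (ball x r) * ennreal W"
    by (intro add_mono ball_pairs_le[OF f B \<open>0 < r\<close>]) auto
  also have "\<dots> = ennreal (measure lborel (ball (0::'a) (2 * r)) * (2 * r) * V + measure lborel (ball x r) * W)"
    using \<open>0 < r\<close> difference_boundedD(2)[OF f] small(2) unfolding emeasure_lborel_ball_eq[of x]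
    by (subst ennreal_plus) (auto simp: ennreal_mult)
  finally have "ennreal (measure lborel (ball y s)) * I
    \<le> ennreal (measure lborel (ball (0::'a) (2 * r)) * (2 * r) * V + measure lborel (ball x r) * W)"
    by (simp add: nn_integral_cmult_indicator emeasure_lborel_ball_eq mult.commute)
  then show ?thesis unfolding I_def
    using \<open>0 < r\<close> difference_boundedD(2)[OF f] small(2) measure_lborel_ball_pos[OF B'(2), of y]
    by (intro ennreal_le_divideI) auto
qed

lemma nn_integral_cover_le:
  fixes g :: "'a::euclidean_space \<Rightarrow> ennreal"
  assumes [measurable]: "g \<in> borel_measurable borel" and "\<And>i. i \<in> D \<Longrightarrow> B i \<in> sets borel"
    and "finite D" "A \<subseteq> (\<Union>i\<in>D. B i)"
  shows "(\<integral>\<^sup>+z\<in>A. g z \<partial>lborel) \<le> (\<Sum>i\<in>D. \<integral>\<^sup>+z\<in>B i. g z \<partial>lborel)"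
proof -
  have "(\<integral>\<^sup>+z\<in>A. g z \<partial>lborel) \<le> (\<integral>\<^sup>+z. (\<Sum>i\<in>D. g z * indicator (B i) z) \<partial>lborel)"
  proof (intro nn_integral_mono)
    fix z
    show "g z * indicator A z \<le> (\<Sum>i\<in>D. g z * indicator (B i) z)"
    proof (cases "z \<in> A")
      case True
      then obtain i where "i \<in> D" "z \<in> B i" using assms(4) by blast
      then show ?thesis
        using member_le_sum[of i D "\<lambda>i. g z * indicator (B i) z"] \<open>finite D\<close> by (auto simp: indicator_def)
    qed simp
  qed
  also have "\<dots> = (\<Sum>i\<in>D. \<integral>\<^sup>+z\<in>B i. g z \<partial>lborel)"
    using assms(2) by (intro nn_integral_sum) auto
  finally show ?thesis .
qed

text \<open>The constant \<open>C\<close> is fixed before \<open>f\<close>, \<open>V\<close> and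
  \<open>c\<close>, so it serves all functions at once. The same \<open>V\<close> bounds the
  variation and the deviation on \<open>B0\<close>; both bounds can be met together by enlarging
  \<open>V\<close>.\<close>

definition poincare_at :: "'a::euclidean_space set \<Rightarrow> 'a set \<Rightarrow> 'a \<Rightarrow> real \<Rightarrow> real \<Rightarrow> bool"
  where "poincare_at \<Omega> B0 x r C \<longleftrightarrow> 0 < r \<and> ball x r \<subseteq> \<Omega> \<and> 0 \<le> C \<and>
    (\<forall>f V c. difference_bounded \<Omega> f V \<longrightarrow> (\<integral>\<^sup>+z\<in>B0. ennreal \<bar>f z - c\<bar> \<partial>lborel) \<le> ennreal V \<longrightarrow>
      (\<integral>\<^sup>+z\<in>ball x r. ennreal \<bar>f z - c\<bar> \<partial>lborel) \<le> ennreal (C * V))"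

lemma poincare_at_step:
  assumes y: "poincare_at \<Omega> B0 y s C" and x: "ball x r \<subseteq> \<Omega>" "y \<in> ball x r"
  shows "\<exists>C'. poincare_at \<Omega> B0 x r C'"
proof -
  have "0 < r" using x(2) by (auto intro: le_less_trans[OF zero_le_dist])
  obtain s' where s': "0 < s'" "s' \<le> s" "ball y s' \<subseteq> ball x r"
  proof -
    obtain e where e: "0 < e" "ball y e \<subseteq> ball x r"
      using x(2) open_ball open_contains_ball by metis
    moreover have "ball y (min e s) \<subseteq> ball y e" by (intro subset_ball) simp
    ultimately show ?thesis using y by (intro that[of "min e s"]) (auto simp: poincare_at_def)
  qed
  define C' where "C' = (measure lborel (ball (0::'a) (2 * r)) * (2 * r) + measure lborel (ball x r) * C)
    / measure lborel (ball y s')"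
  have "0 \<le> C'"
    using \<open>0 < r\<close> y unfolding C'_def poincare_at_def by (auto intro!: divide_nonneg_nonneg add_nonneg_nonneg)
  have "(\<integral>\<^sup>+z\<in>ball x r. ennreal \<bar>f z - c\<bar> \<partial>lborel) \<le> ennreal (C' * V)"
    if f: "difference_bounded \<Omega> f V" and c: "(\<integral>\<^sup>+z\<in>B0. ennreal \<bar>f z - c\<bar> \<partial>lborel) \<le> ennreal V" for f V c
  proof -
    have "(\<integral>\<^sup>+z\<in>ball y s'. ennreal \<bar>f z - c\<bar> \<partial>lborel) \<le> (\<integral>\<^sup>+z\<in>ball y s. ennreal \<bar>f z - c\<bar> \<partial>lborel)"
      using s'(2) by (intro nn_integral_mono) (auto simp: indicator_def)
    also have "\<dots> \<le> ennreal (C * V)" using y f c by (auto simp: poincare_at_def)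
    finally have "(\<integral>\<^sup>+z\<in>ball x r. ennreal \<bar>f z - c\<bar> \<partial>lborel)
    \<le> ennreal ((measure lborel (ball (0::'a) (2 * r)) * (2 * r) * V + measure lborel (ball x r) * (C * V))
        / measure lborel (ball y s'))"
      using y difference_boundedD(2)[OF f]
      by (intro poincare_step[OF f x(1) \<open>0 < r\<close> s'(3,1)]) (auto simp: poincare_at_def)
    also have "(measure lborel (ball (0::'a) (2 * r)) * (2 * r) * V + measure lborel (ball x r) * (C * V))
        / measure lborel (ball y s') = C' * V"
      by (simp add: C'_def algebra_simps add_divide_distrib)
    finally show ?thesis .
  qed
  then show ?thesis using \<open>0 < r\<close> x(1) \<open>0 \<le> C'\<close> unfolding poincare_at_def by blast
qed

text \<open>Chains of balls are handled by connectedness: having an admissible ball is a locally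
  constant property of the centre, and it holds at \<open>x0\<close>.\<close>

lemma poincare_at_all:
  assumes "open \<Omega>" "connected \<Omega>" and x0: "0 < r0" "ball x0 r0 \<subseteq> \<Omega>" and "x \<in> \<Omega>"
  shows "\<exists>r C. poincare_at \<Omega> (ball x0 r0) x r C"
proof -
  define P where "P x \<longleftrightarrow> (\<exists>r C. poincare_at \<Omega> (ball x0 r0) x r C)" for x
  have ball: "\<exists>r>0. ball x r \<subseteq> \<Omega> \<and> (\<forall>y\<in>ball x r. P y \<longleftrightarrow> P x)" if x: "x \<in> \<Omega>" for x
  proof -
    obtain r where r: "0 < r" "ball x r \<subseteq> \<Omega>"
      using x \<open>open \<Omega>\<close> by (meson open_contains_ball)
    have *: "P x" if y: "y \<in> ball x r" "P y" for y
    proof -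
      obtain s C where "poincare_at \<Omega> (ball x0 r0) y s C" using y(2) unfolding P_def by blast
      from poincare_at_step[OF this r(2) y(1)] show ?thesis unfolding P_def by blast
    qed
    \<comment> \<open>The radius is halved so that the ball of radius \<open>r / 2\<close> around
      \<open>y\<close> contains \<open>x\<close> and still lies in \<open>ball x r\<close>.\<close>
    have **: "P y" if y: "y \<in> ball x (r / 2)" "P x" for y
    proof -
      obtain s C where xs: "poincare_at \<Omega> (ball x0 r0) x s C" using y(2) unfolding P_def by blast
      have "ball y (r / 2) \<subseteq> ball x r"
      proof
        fix z assume "z \<in> ball y (r / 2)"
        then show "z \<in> ball x r" using y(1) dist_triangle_half_r[of y x r z] by (auto simp: dist_commute)
      qed
      then have sub: "ball y (r / 2) \<subseteq> \<Omega>" using r by blast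
      have "x \<in> ball y (r / 2)" using y(1) by (simp add: dist_commute)
      from poincare_at_step[OF xs sub this] show ?thesis unfolding P_def by blast
    qed
    have "ball x (r / 2) \<subseteq> ball x r" using r by (intro subset_ball) auto
    then have "ball x (r / 2) \<subseteq> \<Omega> \<and> (\<forall>y\<in>ball x (r / 2). P y \<longleftrightarrow> P x)"
      using * ** r(2) by blast
    moreover have "0 < r / 2" using r(1) by simp
    ultimately show ?thesis by blast
  qed
  have "poincare_at \<Omega> (ball x0 r0) x0 r0 1"
    unfolding poincare_at_def mult_1 using x0 by (intro conjI allI impI zero_le_one) assumption+
  have "x0 \<in> \<Omega>" using x0 by (meson centre_in_ball subsetD)
  from \<open>poincare_at \<Omega> (ball x0 r0) x0 r0 1\<close> have "P x0" using P_def by metis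
  show ?thesis
  proof (rule ccontr)
    assume "\<nexists>r C. poincare_at \<Omega> (ball x0 r0) x r C"
    then have "\<not> P x" unfolding P_def .
    have "open {x\<in>\<Omega>. P x}" unfolding open_contains_ball
    proof
      fix x assume "x \<in> {x\<in>\<Omega>. P x}"
      then show "\<exists>e>0. ball x e \<subseteq> {x\<in>\<Omega>. P x}" using ball[of x] by blast
    qed
    moreover have "open {x\<in>\<Omega>. \<not> P x}" unfolding open_contains_ball
    proof
      fix x assume "x \<in> {x\<in>\<Omega>. \<not> P x}"
      then show "\<exists>e>0. ball x e \<subseteq> {x\<in>\<Omega>. \<not> P x}" using ball[of x] by blast
    qed
    moreover have "{x\<in>\<Omega>. P x} \<inter> {x\<in>\<Omega>. \<not> P x} \<inter> \<Omega> = {}" "\<Omega> \<subseteq> {x\<in>\<Omega>. P x} \<union> {x\<in>\<Omega>. \<not> P x}"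
      by auto
    ultimately have "{x\<in>\<Omega>. P x} \<inter> \<Omega> = {} \<or> {x\<in>\<Omega>. \<not> P x} \<inter> \<Omega> = {}"
      by (intro connectedD[OF \<open>connected \<Omega>\<close>])
    then show False using \<open>P x0\<close> \<open>\<not> P x\<close> \<open>x \<in> \<Omega>\<close> \<open>x0 \<in> \<Omega>\<close> by auto
  qed
qed

lemma difference_bounded_mono:
  assumes "difference_bounded \<Omega> f V" "V \<le> W" shows "difference_bounded \<Omega> f W"
proof -
  have "ennreal (norm h * V) \<le> ennreal (norm h * W)" for h :: 'a
    using assms(2) by (intro ennreal_leI mult_left_mono) auto
  then show ?thesis using assms unfolding difference_bounded_def by (meson order_trans)
qed

lemma poincare_compact:
  fixes \<Omega> :: "'a::euclidean_space set"
  assumes "open \<Omega>" "connected \<Omega>" "\<Omega> \<noteq> {}" "compact K" "K \<subseteq> \<Omega>"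
  shows "\<exists>C\<ge>0. \<forall>f V. difference_bounded \<Omega> f V \<longrightarrow>
    (\<exists>c. (\<integral>\<^sup>+z\<in>K. ennreal \<bar>f z - c\<bar> \<partial>lborel) \<le> ennreal (C * V))"
proof -
  obtain x0 r0 where x0: "0 < r0" "ball x0 r0 \<subseteq> \<Omega>"
    using \<open>open \<Omega>\<close> \<open>\<Omega> \<noteq> {}\<close> open_contains_ball by (metis ex_in_conv)
  let ?B0 = "ball x0 r0"
  \<comment> \<open>The second argument is the constant of \<open>poincare_ball\<close>; the maximum
    with 1 makes \<open>C0 * V\<close> at least \<open>V\<close>, so that \<open>f\<close> remains
    \<open>difference_bounded\<close> for \<open>C0 * V\<close>, as \<open>poincare_at\<close>
    demands.\<close>
  define C0 where "C0 = max 1 (measure lborel (ball (0::'a) (2 * r0)) * (2 * r0) / measure lborel ?B0)"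
  have "C0 \<ge> 1" by (simp add: C0_def)
  obtain r C where P: "\<And>x. x \<in> \<Omega> \<Longrightarrow> poincare_at \<Omega> ?B0 x (r x) (C x)"
    using poincare_at_all[OF assms(1,2) x0] by metis
  obtain D where D: "D \<subseteq> K" "finite D" "K \<subseteq> (\<Union>x\<in>D. ball x (r x))"
  proof (rule compactE_image[OF \<open>compact K\<close>, of K "\<lambda>x. ball x (r x)"])
    show "K \<subseteq> (\<Union>x\<in>K. ball x (r x))"
      using P \<open>K \<subseteq> \<Omega>\<close> by (force simp: poincare_at_def)
  qed auto
  have Cx: "0 \<le> C x" if "x \<in> D" for x using P D \<open>K \<subseteq> \<Omega>\<close> that
    by (force simp: poincare_at_def)
  define C' where "C' = (\<Sum>x\<in>D. C x) * C0"
  have "\<exists>c. (\<integral>\<^sup>+z\<in>K. ennreal \<bar>f z - c\<bar> \<partial>lborel) \<le> ennreal (C' * V)" if f: "difference_bounded \<Omega> f V" for f V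
  proof -
    note [measurable] = difference_boundedD(3)[OF f] and V = difference_boundedD(2)[OF f]
    obtain c where c: "(\<integral>\<^sup>+z\<in>?B0. ennreal \<bar>f z - c\<bar> \<partial>lborel)
        \<le> ennreal (measure lborel (ball (0::'a) (2 * r0)) * (2 * r0) * V / measure lborel ?B0)"
      using poincare_ball[OF f x0(2,1)] by blast
    also have "\<dots> \<le> ennreal (C0 * V)"
      using V unfolding times_divide_eq_left[symmetric] C0_def
      by (intro ennreal_leI) (auto intro!: mult_right_mono simp flip: times_divide_eq_left)
    finally have c: "(\<integral>\<^sup>+z\<in>?B0. ennreal \<bar>f z - c\<bar> \<partial>lborel) \<le> ennreal (C0 * V)" .
    have "V \<le> C0 * V" using V \<open>C0 \<ge> 1\<close> by (simp add: mult_le_cancel_right1)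
    note f' = difference_bounded_mono[OF f this]
    have "(\<integral>\<^sup>+z\<in>K. ennreal \<bar>f z - c\<bar> \<partial>lborel)
        \<le> (\<Sum>x\<in>D. \<integral>\<^sup>+z\<in>ball x (r x). ennreal \<bar>f z - c\<bar> \<partial>lborel)"
      by (rule nn_integral_cover_le[OF _ _ D(2,3)]) auto
    also have "\<dots> \<le> (\<Sum>x\<in>D. ennreal (C x * (C0 * V)))"
    proof (rule sum_mono)
      fix x assume "x \<in> D"
      then have "x \<in> \<Omega>" using D(1) \<open>K \<subseteq> \<Omega>\<close> by auto
      from P[OF this] show "(\<integral>\<^sup>+z\<in>ball x (r x). ennreal \<bar>f z - c\<bar> \<partial>lborel) \<le> ennreal (C x * (C0 * V))"
        using f' c unfolding poincare_at_def by blast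
    qed
    also have "\<dots> = ennreal (\<Sum>x\<in>D. C x * (C0 * V))"
      using Cx V \<open>C0 \<ge> 1\<close> by (intro sum_ennreal) auto
    also have "(\<Sum>x\<in>D. C x * (C0 * V)) = C' * V"
      by (simp add: C'_def sum_distrib_right mult.assoc)
    finally show ?thesis by blast
  qed
  moreover have "0 \<le> C'"
    using Cx \<open>C0 \<ge> 1\<close> by (auto simp: C'_def intro!: mult_nonneg_nonneg sum_nonneg)
  ultimately show ?thesis by blast
qed

section \<open>Boundary layers\<close>

text \<open>The function \<open>s\<close> is the height above the boundary graph in the direction \<open>e\<close>.\<close>

definition boundary_chart :: "'a::euclidean_space set \<Rightarrow> 'a \<Rightarrow> real \<Rightarrow> 'a \<Rightarrow> ('a \<Rightarrow> real) \<Rightarrow> real \<Rightarrow> bool"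
  where "boundary_chart \<Omega> p r e s M \<longleftrightarrow> 0 < r \<and> norm e = 1 \<and> 0 < M \<and>
    (\<forall>x t. s (x + t *\<^sub>R e) = s x + t) \<and> (\<forall>x y. \<bar>s x - s y\<bar> \<le> M * norm (x - y)) \<and>
    (\<forall>x\<in>ball p r. x \<in> \<Omega> \<longleftrightarrow> 0 < s x)"

lemma boundary_chartD:
  assumes "boundary_chart \<Omega> p r e s M"
  shows "0 < r" "norm e = 1" "0 < M" "s (x + t *\<^sub>R e) = s x + t"
    "\<bar>s x - s y\<bar> \<le> M * norm (x - y)" "x \<in> ball p r \<Longrightarrow> x \<in> \<Omega> \<longleftrightarrow> 0 < s x"
    "continuous_on UNIV s"
proof -
  show "0 < r" "norm e = 1" "0 < M" "s (x + t *\<^sub>R e) = s x + t"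
    "\<bar>s x - s y\<bar> \<le> M * norm (x - y)" "x \<in> ball p r \<Longrightarrow> x \<in> \<Omega> \<longleftrightarrow> 0 < s x"
    using assms by (auto simp: boundary_chart_def)
  have "M-lipschitz_on UNIV s"
    using assms by (intro lipschitz_onI) (auto simp: boundary_chart_def dist_norm)
  then show "continuous_on UNIV s" by (rule lipschitz_on_continuous_on)
qed

lemma ex_boundary_chart:
  fixes \<Omega> :: "'a::euclidean_space set"
  assumes "bounded_Lipschitz_domain \<Omega>" "p \<in> frontier \<Omega>"
  shows "\<exists>r e s M. boundary_chart \<Omega> p r e s M"
proof -
  obtain r e \<gamma> K where r: "0 < r" and e: "norm (e::'a) = 1" and \<gamma>: "K-lipschitz_on {y. y \<bullet> e = 0} \<gamma>"
    and \<Omega>: "\<Omega> \<inter> ball p r = {x \<in> ball p r. x \<bullet> e > \<gamma> (x - (x \<bullet> e) *\<^sub>R e)}"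
    using assms unfolding bounded_Lipschitz_domain_def by blast
  have ee: "e \<bullet> e = 1" using e by (simp add: dot_square_norm)
  have "0 \<le> K" using \<gamma> by (rule lipschitz_on_nonneg)
  define s where "s x = x \<bullet> e - \<gamma> (x - (x \<bullet> e) *\<^sub>R e)" for x
  have "s (x + t *\<^sub>R e) = s x + t" for x t
  proof -
    have "x + t *\<^sub>R e - ((x + t *\<^sub>R e) \<bullet> e) *\<^sub>R e = x - (x \<bullet> e) *\<^sub>R e"
      by (simp add: inner_add_left ee algebra_simps)
    then have "s (x + t *\<^sub>R e) = (x + t *\<^sub>R e) \<bullet> e - \<gamma> (x - (x \<bullet> e) *\<^sub>R e)"
      by (simp only: s_def)
    then show ?thesis by (simp add: s_def inner_add_left ee)
  qed
  \<comment> \<open>The projection along \<open>e\<close> is bounded crudely by 2, and the summand 1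
    from the height coordinate keeps the constant positive when \<open>K = 0\<close>.\<close>
  moreover have "\<bar>s x - s y\<bar> \<le> (1 + 2 * K) * norm (x - y)" for x y
  proof -
    have 1: "\<bar>(x - y) \<bullet> e\<bar> \<le> norm (x - y)"
      using Cauchy_Schwarz_ineq2[of "x - y" e] e by simp
    let ?P = "\<lambda>x. x - (x \<bullet> e) *\<^sub>R e"
    have "\<bar>\<gamma> (?P x) - \<gamma> (?P y)\<bar> \<le> K * dist (?P x) (?P y)"
      using lipschitz_onD[OF \<gamma>, of "?P x" "?P y"] by (simp add: dist_real_def inner_diff_left ee)
    also have "dist (?P x) (?P y) \<le> 2 * norm (x - y)"
    proof -
      have eq: "?P x - ?P y = (x - y) - ((x - y) \<bullet> e) *\<^sub>R e"
        by (simp add: inner_diff_left algebra_simps)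
      have "dist (?P x) (?P y) \<le> norm (x - y) + \<bar>(x - y) \<bullet> e\<bar>"
        using norm_triangle_ineq4[of "x - y" "((x - y) \<bullet> e) *\<^sub>R e"] e unfolding dist_norm eq by simp
      then show ?thesis using 1 by simp
    qed
    finally have 2: "\<bar>\<gamma> (?P x) - \<gamma> (?P y)\<bar> \<le> K * (2 * norm (x - y))"
      using \<open>0 \<le> K\<close> by (simp add: mult_left_mono)
    have "s x - s y = (x - y) \<bullet> e - (\<gamma> (?P x) - \<gamma> (?P y))"
      by (simp add: s_def inner_diff_left)
    then have "\<bar>s x - s y\<bar> \<le> norm (x - y) + K * (2 * norm (x - y))" using 1 2 by linarith
    then show ?thesis by (simp add: algebra_simps)
  qed
  moreover have "x \<in> \<Omega> \<longleftrightarrow> 0 < s x" if "x \<in> ball p r" for x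
    using \<Omega> that unfolding s_def by (auto simp: set_eq_iff)
  ultimately have "boundary_chart \<Omega> p r e s (1 + 2 * K)"
    using r e \<open>0 \<le> K\<close> unfolding boundary_chart_def by auto
  then show ?thesis by blast
qed

text \<open>A positive height would put \<open>y\<close> into \<Omega>, which is open and thus
  disjoint from its frontier; a negative one would persist near \<open>y\<close>, where there are
  points of \<Omega>.\<close>

lemma chart_frontier_zero:
  assumes ch: "boundary_chart \<Omega> p r e s M" and "open \<Omega>" "y \<in> frontier \<Omega>" "y \<in> ball p r"
  shows "s y = 0"
proof (rule ccontr)
  assume "s y \<noteq> 0"
  have "y \<notin> \<Omega>" using assms by (auto simp: frontier_def interior_open)
  then have "s y < 0" using boundary_chartD(6)[OF ch \<open>y \<in> ball p r\<close>] \<open>s y \<noteq> 0\<close> by linarith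
  have "open ({x. s x < 0} \<inter> ball p r)"
    by (intro open_Int open_ball open_Collect_less boundary_chartD(7)[OF ch] continuous_on_const)
  moreover have "y \<in> closure \<Omega>" using assms by (simp add: frontier_def)
  ultimately have "({x. s x < 0} \<inter> ball p r) \<inter> \<Omega> \<noteq> {}"
    using \<open>s y < 0\<close> \<open>y \<in> ball p r\<close> open_Int_closure_eq_empty[of "{x. s x < 0} \<inter> ball p r" \<Omega>] by blast
  then show False using boundary_chartD(6)[OF ch] by force
qed

text \<open>The frontier point nearest to \<open>x\<close> has height 0, and the Lipschitz bound
  does the rest. Halving the radius guarantees that this point, no farther from \<open>x\<close>
  than \<open>p\<close> is, still lies in the chart.\<close>

lemma chart_le_bdist:
  assumes ch: "boundary_chart \<Omega> p r e s M" and "open \<Omega>" "p \<in> frontier \<Omega>" "x \<in> ball p (r / 2)"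
  shows "s x \<le> M * bdist \<Omega> x"
proof -
  obtain y where y: "y \<in> frontier \<Omega>" "infdist x (frontier \<Omega>) = dist x y"
    using infdist_attains_inf[of "frontier \<Omega>" x] \<open>p \<in> frontier \<Omega>\<close> by auto
  have "dist x y \<le> dist x p" using infdist_le[OF \<open>p \<in> frontier \<Omega>\<close>, of x] y by simp
  then have "y \<in> ball p r"
    using assms(4) dist_triangle_half_r[of x p r y] by (auto simp: dist_commute)
  then have "s y = 0" using chart_frontier_zero[OF ch \<open>open \<Omega>\<close> y(1)] by simp
  then show ?thesis using boundary_chartD(5)[OF ch, of x y] y(2) by (simp add: bdist_def dist_norm)
qed

text \<open>Descending from \<open>x\<close> by its own height along \<open>e\<close> leads out of
  \<Omega>, so the segment meets the frontier. The bound on the height keeps the end point inside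
  the chart.\<close>

lemma bdist_le_chart:
  assumes ch: "boundary_chart \<Omega> p r e s M" and x: "x \<in> \<Omega>" "x \<in> ball p (r / 2)" "s x < r / 2"
  shows "bdist \<Omega> x \<le> s x"
proof -
  define z where "z = x + (- s x) *\<^sub>R e"
  have "0 < r" "norm e = 1" using boundary_chartD[OF ch] by auto
  have "x \<in> ball p r" using x(2) \<open>0 < r\<close> by auto
  then have "0 < s x" using boundary_chartD(6)[OF ch] x(1) by blast
  have dz: "dist x z = s x"
    using \<open>norm e = 1\<close> \<open>0 < s x\<close> by (simp add: z_def dist_norm)
  have "z \<in> ball p r" using dist_triangle[of p z x] x(2,3) dz by simp
  moreover have "s z = 0" unfolding z_def by (simp add: boundary_chartD(4)[OF ch] del: scaleR_minus_left)
  ultimately have "z \<notin> \<Omega>" using boundary_chartD(6)[OF ch, of z] by simp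
  have "closed_segment x z \<inter> frontier \<Omega> \<noteq> {}"
    by (rule connected_Int_frontier) (use \<open>z \<notin> \<Omega>\<close> x(1) in auto)
  then obtain w where w: "w \<in> closed_segment x z" "w \<in> frontier \<Omega>" by blast
  have "bdist \<Omega> x \<le> dist x w" unfolding bdist_def by (rule infdist_le[OF w(2)])
  also have "\<dots> \<le> dist x z" using dist_in_closed_segment[OF w(1)] by (simp add: dist_commute)
  finally show ?thesis using dz by simp
qed

text \<open>The translate of \<open>S\<close> by \<open>i * \<sigma>\<close> has heights strictly
  between \<open>i * \<sigma>\<close> and \<open>(i + 1) * \<sigma>\<close>, so the translates are
  disjoint and the sum counts each point of \<open>A\<close> at most once.\<close>

lemma nn_integral_shifts_le:
  fixes g :: "'a::euclidean_space \<Rightarrow> ennreal" and s :: "'a \<Rightarrow> real"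
  assumes [measurable]: "g \<in> borel_measurable borel" "S \<in> sets borel"
    and shift: "\<And>x t. s (x + t *\<^sub>R e) = s x + t" and S: "\<And>x. x \<in> S \<Longrightarrow> 0 < s x \<and> s x < \<sigma>"
    and A: "\<And>x i. x \<in> S \<Longrightarrow> i < N \<Longrightarrow> x + (real i * \<sigma>) *\<^sub>R e \<in> A"
  shows "(\<Sum>i<N. \<integral>\<^sup>+x\<in>S. g (x + (real i * \<sigma>) *\<^sub>R e) \<partial>lborel) \<le> (\<integral>\<^sup>+x\<in>A. g x \<partial>lborel)"
proof -
  have "(\<integral>\<^sup>+x\<in>S. g (x + (real i * \<sigma>) *\<^sub>R e) \<partial>lborel) = (\<integral>\<^sup>+y. g y * indicator S (y - (real i * \<sigma>) *\<^sub>R e) \<partial>lborel)" for i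
    using nn_integral_lborel_translate[of "\<lambda>y. g y * indicator S (y - (real i * \<sigma>) *\<^sub>R e)" "(real i * \<sigma>) *\<^sub>R e"]
    by (simp add: add.commute)
  then have "(\<Sum>i<N. \<integral>\<^sup>+x\<in>S. g (x + (real i * \<sigma>) *\<^sub>R e) \<partial>lborel)
      = (\<Sum>i<N. \<integral>\<^sup>+y. g y * indicator S (y - (real i * \<sigma>) *\<^sub>R e) \<partial>lborel)"
    by (simp only:)
  also have "\<dots> = (\<integral>\<^sup>+y. (\<Sum>i<N. g y * indicator S (y - (real i * \<sigma>) *\<^sub>R e)) \<partial>lborel)"
    by (rule nn_integral_sum[symmetric]) measurable
  also have "\<dots> \<le> (\<integral>\<^sup>+x\<in>A. g x \<partial>lborel)"
  proof (intro nn_integral_mono)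
    fix y
    show "(\<Sum>i<N. g y * indicator S (y - (real i * \<sigma>) *\<^sub>R e)) \<le> g y * indicator A y"
    proof (cases "\<exists>i<N. y - (real i * \<sigma>) *\<^sub>R e \<in> S")
      case True
      then obtain i where i: "i < N" "y - (real i * \<sigma>) *\<^sub>R e \<in> S" by blast
      have sy: "s (y - t *\<^sub>R e) = s y - t" for t using shift[of y "- t"] by simp
      have uniq: "j = i" if "y - (real j * \<sigma>) *\<^sub>R e \<in> S" for j
      proof -
        have b: "0 < s y - real i * \<sigma>" "s y - real i * \<sigma> < \<sigma>" "0 < s y - real j * \<sigma>" "s y - real j * \<sigma> < \<sigma>"
          using S[OF i(2)] S[OF that] sy by auto
        then have "(real i - real j) * \<sigma> < 1 * \<sigma>" "(real j - real i) * \<sigma> < 1 * \<sigma>" "0 < \<sigma>"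
          by (simp_all add: algebra_simps)
        then have "real i - real j < 1" "real j - real i < 1" by (simp_all add: mult_less_cancel_right)
        then show ?thesis by linarith
      qed
      have "(\<Sum>j<N. g y * indicator S (y - (real j * \<sigma>) *\<^sub>R e)) = (\<Sum>j<N. if j = i then g y else 0)"
      proof (intro sum.cong refl)
        fix j
        show "g y * indicator S (y - (real j * \<sigma>) *\<^sub>R e) = (if j = i then g y else 0)"
          using i(2) uniq[of j] by (cases "j = i") (simp_all add: indicator_def, blast)
      qed
      also have "\<dots> = g y" using i(1) by simp
      finally show ?thesis using A[OF i(2,1)] by simp
    next
      case False
      then have "(\<Sum>i<N. g y * indicator S (y - (real i * \<sigma>) *\<^sub>R e)) = 0"
        by (intro sum.neutral) (auto simp: indicator_def)
      then show ?thesis by (simp only: zero_le)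
    qed
  qed
  finally show ?thesis .
qed

text \<open>With \<open>N\<close> about \<open>r / (2 \<sigma>)\<close>, the layer has \<open>N\<close> disjoint translates in \<open>\<Omega>\<close>. Comparing \<open>f\<close> on
  the layer with \<open>f\<close> on each translate, the telescoping differences live on disjoint sets and
  thus cost \<open>\<sigma> V\<close> only once; averaging over the translates gives the factor \<open>1 / N\<close>.\<close>

lemma chart_layer_le:
  fixes f :: "'a::euclidean_space \<Rightarrow> real"
  assumes ch: "boundary_chart \<Omega> p r e s M" and "open \<Omega>" and f: "difference_bounded \<Omega> f V" and "0 < \<sigma>"
  shows "(\<integral>\<^sup>+x\<in>{x\<in>\<Omega> \<inter> ball p (r / 2). s x < \<sigma>}. ennreal \<bar>f x - c\<bar> \<partial>lborel)
    \<le> ennreal (4 * \<sigma> / r) * (\<integral>\<^sup>+x\<in>\<Omega>. ennreal \<bar>f x - c\<bar> \<partial>lborel) + ennreal (\<sigma> * V)"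
proof -
  note [measurable] = difference_boundedD(3)[OF f]
  have r: "0 < r" and e: "norm e = 1" using boundary_chartD[OF ch] by auto
  define S where "S = {x\<in>\<Omega> \<inter> ball p (r / 2). s x < \<sigma>}"
  have "S = \<Omega> \<inter> ball p (r / 2) \<inter> {x. s x < \<sigma>}" by (auto simp: S_def)
  then have "open S"
    using \<open>open \<Omega>\<close> by (auto intro!: open_Int open_Collect_less boundary_chartD(7)[OF ch] continuous_on_const)
  then have [measurable]: "S \<in> sets borel" by simp
  define v where "v x = ennreal \<bar>f x - c\<bar>" for x
  have [measurable]: "v \<in> borel_measurable borel" unfolding v_def[abs_def] by measurable
  define N where "N = nat \<lfloor>r / (2 * \<sigma>)\<rfloor>"
  show ?thesis unfolding S_def[symmetric] v_def[symmetric]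
  proof (cases "N = 0")
    \<comment> \<open>The layer is too thick for even one step; then \<open>4 * \<sigma> / r\<close>
      is at least 1 and the bound is trivial.\<close>
    case True
    then have "r / (2 * \<sigma>) < 1" unfolding N_def by linarith
    then have "1 \<le> 4 * \<sigma> / r" using r \<open>0 < \<sigma>\<close> by (simp add: field_simps)
    then have "1 * (\<integral>\<^sup>+x\<in>\<Omega>. v x \<partial>lborel) \<le> ennreal (4 * \<sigma> / r) * (\<integral>\<^sup>+x\<in>\<Omega>. v x \<partial>lborel)"
      by (intro mult_right_mono) (simp_all add: ennreal_1[symmetric] ennreal_leI del: ennreal_1)
    moreover have "(\<integral>\<^sup>+x\<in>S. v x \<partial>lborel) \<le> (\<integral>\<^sup>+x\<in>\<Omega>. v x \<partial>lborel)"
      by (intro nn_integral_mono) (auto simp: S_def indicator_def)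
    ultimately show "(\<integral>\<^sup>+x\<in>S. v x \<partial>lborel) \<le> ennreal (4 * \<sigma> / r) * (\<integral>\<^sup>+x\<in>\<Omega>. v x \<partial>lborel) + ennreal (\<sigma> * V)"
      by (simp add: add_increasing2 order_trans)
  next
    case False
    then have N: "1 \<le> N" "real N \<le> r / (2 * \<sigma>)" "r / (2 * \<sigma>) < real N + 1"
      using r \<open>0 < \<sigma>\<close> unfolding N_def by (simp_all, linarith+)
    have N\<sigma>: "real N * \<sigma> \<le> r / 2"
      using N(2) \<open>0 < \<sigma>\<close> by (simp add: field_simps)
    \<comment> \<open>Since \<open>N\<close> is at least 1, \<open>r / (2 * \<sigma>)\<close> is
      below \<open>N + 1\<close> and hence below \<open>2 * N\<close>; this rounding is the origin
      of the 4.\<close>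
    have inN: "1 / real N \<le> 4 * \<sigma> / r"
    proof -
      have "r / (2 * \<sigma>) < 2 * real N" using N by linarith
      then show ?thesis using r \<open>0 < \<sigma>\<close> N(1) by (simp add: field_simps)
    qed
    have in\<Omega>: "x + a *\<^sub>R e \<in> \<Omega>" if "x \<in> S" "0 \<le> a" "a \<le> real N * \<sigma>" for x a
    proof -
      have "dist p (x + a *\<^sub>R e) \<le> dist p x + a"
        using dist_triangle[of p "x + a *\<^sub>R e" x] e that by (simp add: dist_norm)
      then have "x + a *\<^sub>R e \<in> ball p r" using that N\<sigma> by (simp add: S_def)
      moreover have "x \<in> ball p r" using that r by (auto simp: S_def)
      then have "0 < s x" using boundary_chartD(6)[OF ch, of x] that by (auto simp: S_def)
      then have "0 < s (x + a *\<^sub>R e)" using boundary_chartD(4)[OF ch, of x a] that by simp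
      ultimately show ?thesis using boundary_chartD(6)[OF ch] by blast
    qed
    have s_pos: "0 < s x \<and> s x < \<sigma>" if "x \<in> S" for x
      using that boundary_chartD(6)[OF ch, of x] r by (auto simp: S_def)
    define d where "d x = ennreal \<bar>f (x + \<sigma> *\<^sub>R e) - f x\<bar>" for x
    have [measurable]: "d \<in> borel_measurable borel" unfolding d_def[abs_def] by measurable
    let ?h = "\<lambda>i::nat. (real i * \<sigma>) *\<^sub>R e"
    have tel: "v x \<le> v (x + ?h j) + (\<Sum>i<j. d (x + ?h i))" for x j
    proof (induction j)
      case (Suc j)
      have "v (x + ?h j) \<le> v (x + ?h (Suc j)) + d (x + ?h j)"
      proof -
        have eq: "x + ?h (Suc j) = x + ?h j + \<sigma> *\<^sub>R e" by (simp add: algebra_simps)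
        show ?thesis unfolding v_def d_def eq
          by (simp add: ennreal_plus[symmetric] del: ennreal_plus)
      qed
      then have "v x \<le> v (x + ?h (Suc j)) + d (x + ?h j) + (\<Sum>i<j. d (x + ?h i))"
        using Suc.IH by (meson add_right_mono order_trans)
      then show ?case by (simp add: add_ac)
    qed simp
    \<comment> \<open>Each of the \<open>N\<close> comparisons is charged with all \<open>N\<close>
      differences; the resulting factor \<open>N\<close> disappears in the average.\<close>
    have "of_nat N * v x \<le> (\<Sum>j<N. v (x + ?h j)) + of_nat N * (\<Sum>i<N. d (x + ?h i))" for x
    proof -
      have "of_nat N * v x = (\<Sum>j<N. v x)" by simp
      also have "\<dots> \<le> (\<Sum>j<N. v (x + ?h j) + (\<Sum>i<N. d (x + ?h i)))"
      proof (intro sum_mono)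
        fix j assume "j \<in> {..<N}"
        then have "(\<Sum>i<j. d (x + ?h i)) \<le> (\<Sum>i<N. d (x + ?h i))" by (intro sum_mono2) auto
        then show "v x \<le> v (x + ?h j) + (\<Sum>i<N. d (x + ?h i))"
          using tel[of x j] by (meson add_left_mono order_trans)
      qed
      also have "\<dots> = (\<Sum>j<N. v (x + ?h j)) + of_nat N * (\<Sum>i<N. d (x + ?h i))"
        by (simp add: sum.distrib)
      finally show ?thesis .
    qed
    then have "(\<integral>\<^sup>+x\<in>S. of_nat N * v x \<partial>lborel)
        \<le> (\<integral>\<^sup>+x\<in>S. ((\<Sum>j<N. v (x + ?h j)) + of_nat N * (\<Sum>i<N. d (x + ?h i))) \<partial>lborel)"
      by (intro nn_integral_mono mult_right_mono) auto
    also have "\<dots> = (\<integral>\<^sup>+x\<in>S. (\<Sum>j<N. v (x + ?h j)) \<partial>lborel) + (\<integral>\<^sup>+x\<in>S. of_nat N * (\<Sum>i<N. d (x + ?h i)) \<partial>lborel)"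
      unfolding distrib_right by (rule nn_integral_add) measurable
    also have "(\<integral>\<^sup>+x\<in>S. (\<Sum>j<N. v (x + ?h j)) \<partial>lborel) = (\<Sum>j<N. \<integral>\<^sup>+x\<in>S. v (x + ?h j) \<partial>lborel)"
      unfolding sum_distrib_right by (rule nn_integral_sum) measurable
    also have "(\<integral>\<^sup>+x\<in>S. of_nat N * (\<Sum>i<N. d (x + ?h i)) \<partial>lborel) = of_nat N * (\<Sum>i<N. \<integral>\<^sup>+x\<in>S. d (x + ?h i) \<partial>lborel)"
    proof -
      have "(\<integral>\<^sup>+x\<in>S. (\<Sum>i<N. d (x + ?h i)) \<partial>lborel) = (\<Sum>i<N. \<integral>\<^sup>+x\<in>S. d (x + ?h i) \<partial>lborel)"
        unfolding sum_distrib_right by (rule nn_integral_sum) measurable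
      then show ?thesis unfolding mult.assoc by (subst nn_integral_cmult) simp_all
    qed
    also have "(\<Sum>j<N. \<integral>\<^sup>+x\<in>S. v (x + ?h j) \<partial>lborel) \<le> (\<integral>\<^sup>+x\<in>\<Omega>. v x \<partial>lborel)"
    proof (rule nn_integral_shifts_le[OF _ _ boundary_chartD(4)[OF ch] s_pos])
      fix x i assume "x \<in> S" "i < N"
      then show "x + ?h i \<in> \<Omega>" using \<open>0 < \<sigma>\<close> by (intro in\<Omega>) auto
    qed auto
    also have "(\<Sum>i<N. \<integral>\<^sup>+x\<in>S. d (x + ?h i) \<partial>lborel) \<le> (\<integral>\<^sup>+x\<in>segment_set \<Omega> (\<sigma> *\<^sub>R e). d x \<partial>lborel)"
    proof (rule nn_integral_shifts_le[OF _ _ boundary_chartD(4)[OF ch] s_pos])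
      fix x i assume x: "x \<in> S" "i < N"
      have "x + ?h i + t *\<^sub>R \<sigma> *\<^sub>R e \<in> \<Omega>" if "t \<in> {0..1}" for t
      proof -
        have eq: "x + ?h i + t *\<^sub>R \<sigma> *\<^sub>R e = x + ((real i + t) * \<sigma>) *\<^sub>R e"
          by (simp add: algebra_simps)
        have "real i + t \<le> real N" using x(2) that by simp
        then show ?thesis unfolding eq using \<open>0 < \<sigma>\<close> that in\<Omega>[OF x(1), of "(real i + t) * \<sigma>"] by simp
      qed
      then show "x + ?h i \<in> segment_set \<Omega> (\<sigma> *\<^sub>R e)" by (simp add: segment_set_def)
    qed auto
    also have "(\<integral>\<^sup>+x\<in>segment_set \<Omega> (\<sigma> *\<^sub>R e). d x \<partial>lborel) \<le> ennreal (\<sigma> * V)"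
      using difference_boundedD(4)[OF f, of "\<sigma> *\<^sub>R e"] e \<open>0 < \<sigma>\<close> by (simp add: d_def)
    finally have main: "of_nat N * (\<integral>\<^sup>+x\<in>S. v x \<partial>lborel) \<le> (\<integral>\<^sup>+x\<in>\<Omega>. v x \<partial>lborel) + of_nat N * ennreal (\<sigma> * V)"
      by (simp add: mult.assoc nn_integral_cmult mult_left_mono add_mono)
    have unit: "ennreal (1 / real N) * of_nat N = 1"
      using N(1) by (simp add: ennreal_of_nat_eq_real_of_nat ennreal_mult[symmetric])
    have "(\<integral>\<^sup>+x\<in>S. v x \<partial>lborel) = ennreal (1 / real N) * (of_nat N * (\<integral>\<^sup>+x\<in>S. v x \<partial>lborel))"
      by (simp add: mult.assoc[symmetric] unit)
    also have "\<dots> \<le> ennreal (1 / real N) * ((\<integral>\<^sup>+x\<in>\<Omega>. v x \<partial>lborel) + of_nat N * ennreal (\<sigma> * V))"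
      by (intro mult_left_mono main) auto
    also have "\<dots> = ennreal (1 / real N) * (\<integral>\<^sup>+x\<in>\<Omega>. v x \<partial>lborel) + ennreal (\<sigma> * V)"
      unfolding distrib_left mult.assoc[symmetric] unit mult_1 ..
    also have "\<dots> \<le> ennreal (4 * \<sigma> / r) * (\<integral>\<^sup>+x\<in>\<Omega>. v x \<partial>lborel) + ennreal (\<sigma> * V)"
      by (intro add_right_mono mult_right_mono ennreal_leI inN) auto
    finally show "(\<integral>\<^sup>+x\<in>S. v x \<partial>lborel) \<le> ennreal (4 * \<sigma> / r) * (\<integral>\<^sup>+x\<in>\<Omega>. v x \<partial>lborel) + ennreal (\<sigma> * V)" .
  qed
qed

section \<open>The inequality\<close>

lemma bounded_Lipschitz_domainD:
  assumes "bounded_Lipschitz_domain \<Omega>"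
  shows "open \<Omega>" "connected \<Omega>" "\<Omega> \<noteq> {}" "bounded \<Omega>" "frontier \<Omega> \<noteq> {}" "compact (frontier \<Omega>)"
proof -
  show 1: "open \<Omega>" "connected \<Omega>" "\<Omega> \<noteq> {}" "bounded \<Omega>"
    using assms by (auto simp: bounded_Lipschitz_domain_def)
  show "frontier \<Omega> \<noteq> {}"
    using frontier_not_empty[of \<Omega>] 1 not_bounded_UNIV by blast
  show "compact (frontier \<Omega>)" using 1 by (simp add: compact_frontier_bounded)
qed

lemma continuous_on_bdist: "continuous_on A (bdist \<Omega>)"
  unfolding bdist_def[abs_def] by (intro continuous_intros)

lemma bdist_pos:
  assumes "bounded_Lipschitz_domain \<Omega>" "x \<in> \<Omega>" shows "0 < bdist \<Omega> x"
proof -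
  note \<Omega> = bounded_Lipschitz_domainD[OF assms(1)]
  have "x \<notin> frontier \<Omega>" using \<Omega>(1) assms(2) by (simp add: frontier_def interior_open)
  then show ?thesis unfolding bdist_def
    using in_closed_iff_infdist_zero[OF frontier_closed \<Omega>(5), of x] infdist_nonneg[of x "frontier \<Omega>"] by linarith
qed

text \<open>Finitely many charts cover the frontier, and every point of a thin layer lies below
  height \<open>M p * \<tau>\<close> in one of them, where \<open>chart_layer_le\<close> applies.
  Widths of at least \<open>\<epsilon>\<close> are covered by the summand
  \<open>1 / \<epsilon>\<close> of \<open>C\<close>.\<close>

lemma thin_layer_le:
  fixes \<Omega> :: "'a::euclidean_space set"
  assumes L: "bounded_Lipschitz_domain \<Omega>"
  shows "\<exists>C>0. \<forall>f V c \<tau>. difference_bounded \<Omega> f V \<longrightarrow> 0 < \<tau> \<longrightarrow>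
    (\<integral>\<^sup>+x\<in>{x\<in>\<Omega>. bdist \<Omega> x < \<tau>}. ennreal \<bar>f x - c\<bar> \<partial>lborel)
      \<le> ennreal (C * \<tau>) * (ennreal V + (\<integral>\<^sup>+x\<in>\<Omega>. ennreal \<bar>f x - c\<bar> \<partial>lborel))"
proof -
  note \<Omega> = bounded_Lipschitz_domainD[OF L]
  obtain r e s M where ch: "\<And>p. p \<in> frontier \<Omega> \<Longrightarrow> boundary_chart \<Omega> p (r p) (e p) (s p) (M p)"
    using ex_boundary_chart[OF L] by metis
  have r: "0 < r p" "0 < M p" if "p \<in> frontier \<Omega>" for p using boundary_chartD[OF ch[OF that]] by auto
  obtain D where D: "D \<subseteq> frontier \<Omega>" "finite D" "frontier \<Omega> \<subseteq> (\<Union>p\<in>D. ball p (r p / 4))"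
  proof (rule compactE_image[OF \<Omega>(6), of "frontier \<Omega>" "\<lambda>p. ball p (r p / 4)"])
    show "frontier \<Omega> \<subseteq> (\<Union>p\<in>frontier \<Omega>. ball p (r p / 4))" using r by force
  qed auto
  then have "D \<noteq> {}" using \<Omega>(5) by auto
  \<comment> \<open>A point closer than \<open>\<epsilon>\<close> to a frontier point in
    \<open>ball p (r p / 4)\<close> lies in \<open>ball p (r p / 2)\<close>, where
    \<open>chart_le_bdist\<close> bounds its height.\<close>
  define \<epsilon> where "\<epsilon> = Min ((\<lambda>p. r p / 4) ` D)"
  have \<epsilon>: "0 < \<epsilon>"
    using D(1,2) \<open>D \<noteq> {}\<close> r by (auto simp: \<epsilon>_def subset_iff)
  have \<epsilon>_le: "\<epsilon> \<le> r p / 4" if "p \<in> D" for p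
    unfolding \<epsilon>_def using D(2) that by (intro Min_le) auto
  \<comment> \<open>With layer height \<open>M p * \<tau>\<close>, the first summand covers the
    coefficient of the deviation in \<open>chart_layer_le\<close> and the second that of
    \<open>V\<close>.\<close>
  define C1 where "C1 p = 4 * M p / r p + M p" for p
  have C1: "0 < C1 p" if "p \<in> D" for p using r that D(1)
    by (auto simp: C1_def intro!: add_pos_pos divide_pos_pos)
  define C where "C = 1 / \<epsilon> + (\<Sum>p\<in>D. C1 p)"
  have sum_pos: "0 \<le> (\<Sum>p\<in>D. C1 p)" using C1 by (intro sum_nonneg) (auto intro: less_imp_le)
  have "0 < C" unfolding C_def using \<epsilon> sum_pos by (intro add_pos_nonneg) auto
  moreover have "(\<integral>\<^sup>+x\<in>{x\<in>\<Omega>. bdist \<Omega> x < \<tau>}. ennreal \<bar>f x - c\<bar> \<partial>lborel)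
      \<le> ennreal (C * \<tau>) * (ennreal V + (\<integral>\<^sup>+x\<in>\<Omega>. ennreal \<bar>f x - c\<bar> \<partial>lborel))"
    if f: "difference_bounded \<Omega> f V" and "0 < \<tau>" for f V c \<tau>
  proof -
    note [measurable] = difference_boundedD(3)[OF f]
    let ?I = "\<integral>\<^sup>+x\<in>\<Omega>. ennreal \<bar>f x - c\<bar> \<partial>lborel"
    show ?thesis
    proof (cases "\<tau> < \<epsilon>")
      case True
      define S where "S p = {x \<in> \<Omega> \<inter> ball p (r p / 2). s p x < M p * \<tau>}" for p
      have "{x\<in>\<Omega>. bdist \<Omega> x < \<tau>} \<subseteq> (\<Union>p\<in>D. S p)"
      proof
        fix x assume "x \<in> {x\<in>\<Omega>. bdist \<Omega> x < \<tau>}"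
        then have x: "x \<in> \<Omega>" "bdist \<Omega> x < \<tau>" by auto
        obtain y where y: "y \<in> frontier \<Omega>" "infdist x (frontier \<Omega>) = dist x y"
          using infdist_attains_inf[OF frontier_closed \<Omega>(5), of x] by metis
        obtain p where p: "p \<in> D" "y \<in> ball p (r p / 4)" using D(3) y(1) by blast
        have "dist p x < r p / 2"
          using dist_triangle[of p x y] p(2) y(2) x(2) True \<epsilon>_le[OF p(1)] by (simp add: bdist_def dist_commute)
        then have "x \<in> ball p (r p / 2)" by simp
        moreover have pf: "p \<in> frontier \<Omega>" using p D(1) by blast
        ultimately have "s p x \<le> M p * bdist \<Omega> x" by (intro chart_le_bdist[OF ch \<Omega>(1)])
        also have "\<dots> < M p * \<tau>" using x(2) r[OF pf] by simp
        finally show "x \<in> (\<Union>p\<in>D. S p)"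
          using p(1) x(1) \<open>x \<in> ball p (r p / 2)\<close> by (auto simp: S_def)
      qed
      then have "(\<integral>\<^sup>+x\<in>{x\<in>\<Omega>. bdist \<Omega> x < \<tau>}. ennreal \<bar>f x - c\<bar> \<partial>lborel)
          \<le> (\<Sum>p\<in>D. \<integral>\<^sup>+x\<in>S p. ennreal \<bar>f x - c\<bar> \<partial>lborel)"
      proof (intro nn_integral_cover_le D(2))
        fix p assume "p \<in> D"
        then have pf: "p \<in> frontier \<Omega>" using D(1) by blast
        have "S p = \<Omega> \<inter> ball p (r p / 2) \<inter> {x. s p x < M p * \<tau>}"
          by (auto simp: S_def)
        moreover have "open \<dots>"
          by (intro open_Int open_Collect_less \<Omega>(1) open_ball boundary_chartD(7)[OF ch[OF pf]] continuous_on_const)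
        ultimately show "S p \<in> sets borel" by simp
      qed auto
      also have "\<dots> \<le> (\<Sum>p\<in>D. ennreal (C1 p * \<tau>) * (ennreal V + ?I))"
      proof (rule sum_mono)
        fix p assume "p \<in> D"
        then have pf: "p \<in> frontier \<Omega>" using D(1) by blast
        note rp = r[OF pf]
        have "(\<integral>\<^sup>+x\<in>S p. ennreal \<bar>f x - c\<bar> \<partial>lborel) \<le> ennreal (4 * (M p * \<tau>) / r p) * ?I + ennreal (M p * \<tau> * V)"
          unfolding S_def using rp \<open>0 < \<tau>\<close> by (intro chart_layer_le[OF ch[OF pf] \<Omega>(1) f]) simp
        also have "\<dots> \<le> ennreal (C1 p * \<tau>) * ?I + ennreal (C1 p * \<tau> * V)"
          using rp \<open>0 < \<tau>\<close> difference_boundedD(2)[OF f]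
          by (intro add_mono mult_right_mono ennreal_leI) (auto simp: C1_def field_simps)
        also have "\<dots> = ennreal (C1 p * \<tau>) * (ennreal V + ?I)"
          using C1[OF \<open>p \<in> D\<close>] \<open>0 < \<tau>\<close> difference_boundedD(2)[OF f]
          by (simp add: distrib_left ennreal_mult[of "_ * _" V] add.commute)
        finally show "(\<integral>\<^sup>+x\<in>S p. ennreal \<bar>f x - c\<bar> \<partial>lborel) \<le> ennreal (C1 p * \<tau>) * (ennreal V + ?I)" .
      qed
      also have "\<dots> = (\<Sum>p\<in>D. ennreal (C1 p * \<tau>)) * (ennreal V + ?I)"
        by (rule sum_distrib_right[symmetric])
      also have "(\<Sum>p\<in>D. ennreal (C1 p * \<tau>)) = ennreal (\<Sum>p\<in>D. C1 p * \<tau>)"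
        using C1 \<open>0 < \<tau>\<close> by (intro sum_ennreal) (auto intro: less_imp_le)
      also have "\<dots> \<le> ennreal (C * \<tau>)"
        using \<epsilon> \<open>0 < \<tau>\<close> by (intro ennreal_leI) (simp add: C_def distrib_right sum_distrib_right)
      finally show ?thesis by (meson mult_right_mono order_trans zero_le)
    next
      case False
      have "(\<integral>\<^sup>+x\<in>{x\<in>\<Omega>. bdist \<Omega> x < \<tau>}. ennreal \<bar>f x - c\<bar> \<partial>lborel) \<le> ?I"
        by (intro nn_integral_mono) (auto simp: indicator_def)
      also have "\<dots> \<le> 1 * (ennreal V + ?I)" by simp
      also have "\<dots> \<le> ennreal (C * \<tau>) * (ennreal V + ?I)"
      proof (intro mult_right_mono)
        have "1 \<le> (1 / \<epsilon>) * \<tau>" using False \<epsilon> by (simp add: field_simps)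
        also have "\<dots> \<le> C * \<tau>"
          using \<open>0 < \<tau>\<close> sum_pos by (intro mult_right_mono) (auto simp: C_def)
        finally show "1 \<le> ennreal (C * \<tau>)" using ennreal_leI by fastforce
      qed simp
      finally show ?thesis .
    qed
  qed
  ultimately show ?thesis by blast
qed

lemma nn_integral_abs_diff_finite:
  fixes f :: "'a::euclidean_space \<Rightarrow> real"
  assumes "integrable lborel f" "bounded \<Omega>" "\<Omega> \<in> sets borel"
  shows "(\<integral>\<^sup>+x\<in>\<Omega>. ennreal \<bar>f x - c\<bar> \<partial>lborel) < \<infinity>"
proof -
  have i: "integrable lborel (\<lambda>x. indicator \<Omega> x * f x)"
    using assms by (intro Bochner_Integration.integrable_bound[OF assms(1)]) (auto simp: indicator_def)
  have "integrable lborel (indicator \<Omega> :: 'a \<Rightarrow> real)"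
    using emeasure_bounded_finite[OF assms(2)] assms(3) by (intro integrable_real_indicator) auto
  then have "integrable lborel (\<lambda>x. indicator \<Omega> x * f x - c * indicator \<Omega> x)"
    using i by (intro Bochner_Integration.integrable_diff integrable_mult_right)
  then have "(\<integral>\<^sup>+x. ennreal (norm (indicator \<Omega> x * f x - c * indicator \<Omega> x)) \<partial>lborel) < \<infinity>"
    by (simp add: integrable_iff_bounded)
  also have "(\<integral>\<^sup>+x. ennreal (norm (indicator \<Omega> x * f x - c * indicator \<Omega> x)) \<partial>lborel)
      = (\<integral>\<^sup>+x\<in>\<Omega>. ennreal \<bar>f x - c\<bar> \<partial>lborel)"
    by (intro nn_integral_cong) (auto simp: indicator_def)
  finally show ?thesis .
qed

text \<open>Finiteness of \<open>a\<close> is what permits subtracting half of it; \<open>b\<close>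
  may be infinite.\<close>

lemma ennreal_absorb_half:
  fixes a :: ennreal
  assumes "a \<le> b + ennreal (1 / 2) * a" "a < \<infinity>" shows "a \<le> 2 * b"
proof (cases "b = \<infinity>")
  case False
  obtain x y where xy: "a = ennreal x" "0 \<le> x" "b = ennreal y" "0 \<le> y"
    using assms(2) False by (cases a; cases b) auto
  have "ennreal (1 / 2 * x) = ennreal (1 / 2) * ennreal x" by (rule ennreal_mult) (use xy in auto)
  moreover have "ennreal (y + 1 / 2 * x) = ennreal y + ennreal (1 / 2 * x)"
    by (rule ennreal_plus) (use xy in auto)
  ultimately have "ennreal x \<le> ennreal (y + 1 / 2 * x)"
    using assms(1) xy by (simp only:)
  then have "x \<le> y + 1 / 2 * x" using xy by (subst (asm) ennreal_le_iff) auto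
  then have "x \<le> 2 * y" by simp
  then have "ennreal x \<le> ennreal (2 * y)" by (rule ennreal_leI)
  then show ?thesis using xy by (simp add: ennreal_mult)
qed simp

text \<open>The constant \<open>c\<close> found on a compact part of \<Omega> is kept on the
  remaining boundary layer, whose estimate holds for every \<open>c\<close>. With
  \<open>C1 * \<tau> = 1 / 2\<close> the layer costs half of \<open>V\<close> and half of the total
  deviation; the latter is finite and is absorbed on the left, which doubles
  \<open>C2 + 1 / 2\<close>.\<close>

lemma poincare_domain:
  fixes \<Omega> :: "'a::euclidean_space set"
  assumes L: "bounded_Lipschitz_domain \<Omega>"
  shows "\<exists>C\<ge>0. \<forall>f V. difference_bounded \<Omega> f V \<longrightarrow>
    (\<exists>c. (\<integral>\<^sup>+x\<in>\<Omega>. ennreal \<bar>f x - c\<bar> \<partial>lborel) \<le> ennreal (C * V))"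
proof -
  note \<Omega> = bounded_Lipschitz_domainD[OF L]
  obtain C1 where C1: "0 < C1" "\<And>f V c \<tau>. difference_bounded \<Omega> f V \<Longrightarrow> 0 < \<tau> \<Longrightarrow>
    (\<integral>\<^sup>+x\<in>{x\<in>\<Omega>. bdist \<Omega> x < \<tau>}. ennreal \<bar>f x - c\<bar> \<partial>lborel)
      \<le> ennreal (C1 * \<tau>) * (ennreal V + (\<integral>\<^sup>+x\<in>\<Omega>. ennreal \<bar>f x - c\<bar> \<partial>lborel))"
    using thin_layer_le[OF L] by blast
  define \<tau> where "\<tau> = 1 / (2 * C1)"
  have \<tau>: "0 < \<tau>" "C1 * \<tau> = 1 / 2" using C1(1) by (simp_all add: \<tau>_def)
  define K where "K = {x\<in>closure \<Omega>. \<tau> \<le> bdist \<Omega> x}"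
  have "K = closure \<Omega> \<inter> {x. \<tau> \<le> bdist \<Omega> x}" by (auto simp: K_def)
  moreover have "closed {x. \<tau> \<le> bdist \<Omega> x}"
    by (intro closed_Collect_le continuous_on_bdist continuous_on_const)
  ultimately have "compact K" using \<Omega>(4) by (simp add: compact_Int_closed compact_closure)
  have "K \<subseteq> \<Omega>"
  proof
    fix x assume x: "x \<in> K"
    show "x \<in> \<Omega>"
    proof (rule ccontr)
      assume "x \<notin> \<Omega>"
      then have "x \<in> frontier \<Omega>"
        using x \<Omega>(1) by (simp add: frontier_def K_def interior_open)
      then have "bdist \<Omega> x = 0" by (simp add: bdist_def)
      then show False using x \<tau>(1) by (simp add: K_def)
    qed
  qed
  obtain C2 where C2: "0 \<le> C2" "\<And>f V. difference_bounded \<Omega> f V \<Longrightarrow>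
    \<exists>c. (\<integral>\<^sup>+z\<in>K. ennreal \<bar>f z - c\<bar> \<partial>lborel) \<le> ennreal (C2 * V)"
    using poincare_compact[OF \<Omega>(1-3) \<open>compact K\<close> \<open>K \<subseteq> \<Omega>\<close>] by blast
  have "\<exists>c. (\<integral>\<^sup>+x\<in>\<Omega>. ennreal \<bar>f x - c\<bar> \<partial>lborel) \<le> ennreal ((2 * C2 + 1) * V)"
    if f: "difference_bounded \<Omega> f V" for f V
  proof -
    note [measurable] = difference_boundedD(3)[OF f] and V = difference_boundedD(2)[OF f]
    obtain c where c: "(\<integral>\<^sup>+z\<in>K. ennreal \<bar>f z - c\<bar> \<partial>lborel) \<le> ennreal (C2 * V)" using C2(2)[OF f] by blast
    define I where "I = (\<integral>\<^sup>+x\<in>\<Omega>. ennreal \<bar>f x - c\<bar> \<partial>lborel)"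
    have "I < \<infinity>" unfolding I_def
      using \<Omega> by (intro nn_integral_abs_diff_finite difference_boundedD(1)[OF f]) auto
    have layer: "open {x\<in>\<Omega>. bdist \<Omega> x < \<tau>}"
    proof -
      have "{x\<in>\<Omega>. bdist \<Omega> x < \<tau>} = \<Omega> \<inter> {x. bdist \<Omega> x < \<tau>}" by auto
      then show ?thesis using \<Omega>(1) by (simp add: open_Int open_Collect_less continuous_on_bdist)
    qed
    have "I \<le> (\<integral>\<^sup>+x. ennreal \<bar>f x - c\<bar> * indicator K x
        + ennreal \<bar>f x - c\<bar> * indicator {x\<in>\<Omega>. bdist \<Omega> x < \<tau>} x \<partial>lborel)"
      unfolding I_def
    proof (intro nn_integral_mono)
      fix x
      have "x \<in> K \<or> x \<in> {x\<in>\<Omega>. bdist \<Omega> x < \<tau>}" if "x \<in> \<Omega>"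
        using that closure_subset[of \<Omega>] by (auto simp: K_def)
      then show "ennreal \<bar>f x - c\<bar> * indicator \<Omega> x
          \<le> ennreal \<bar>f x - c\<bar> * indicator K x + ennreal \<bar>f x - c\<bar> * indicator {x\<in>\<Omega>. bdist \<Omega> x < \<tau>} x"
        by (auto simp: indicator_def)
    qed
    also have "\<dots> = (\<integral>\<^sup>+x\<in>K. ennreal \<bar>f x - c\<bar> \<partial>lborel)
        + (\<integral>\<^sup>+x\<in>{x\<in>\<Omega>. bdist \<Omega> x < \<tau>}. ennreal \<bar>f x - c\<bar> \<partial>lborel)"
      using borel_compact[OF \<open>compact K\<close>] borel_open[OF layer] by (intro nn_integral_add) auto
    also have "\<dots> \<le> ennreal (C2 * V) + ennreal (1 / 2) * (ennreal V + I)"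
      using C1(2)[OF f \<tau>(1), of c] c unfolding \<tau>(2) I_def by (intro add_mono)
    also have "\<dots> = ennreal (C2 * V + 1 / 2 * V) + ennreal (1 / 2) * I"
    proof -
      have "ennreal (1 / 2 * V) = ennreal (1 / 2) * ennreal V" by (rule ennreal_mult) (use V in auto)
      moreover have "ennreal (C2 * V + 1 / 2 * V) = ennreal (C2 * V) + ennreal (1 / 2 * V)"
        by (rule ennreal_plus) (use V C2(1) in auto)
      ultimately show ?thesis by (simp only: distrib_left add.assoc)
    qed
    finally have "I \<le> 2 * ennreal (C2 * V + 1 / 2 * V)"
      using \<open>I < \<infinity>\<close> by (rule ennreal_absorb_half)
    also have "\<dots> = ennreal (2 * (C2 * V + 1 / 2 * V))"
      using C2(1) V by (subst ennreal_mult) auto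
    also have "2 * (C2 * V + 1 / 2 * V) = (2 * C2 + 1) * V" by (simp add: algebra_simps)
    finally show ?thesis unfolding I_def by blast
  qed
  then show ?thesis using C2(1) by (intro exI[of _ "2 * C2 + 1"]) auto
qed

text \<open>Where the distance \<open>d\<close> is between \<open>a / 2 ^ Suc k\<close> and
  \<open>a / 2 ^ k\<close>, the weight divided by \<open>d\<close> is at most \<open>q k\<close>.
  The deviation on \<open>B k\<close> is of order \<open>a / 2 ^ k\<close>, so this layer
  contributes a multiple of the weight at \<open>a / 2 ^ k\<close>, and
  \<open>log_weight_sum_le\<close> sums these. The sets \<open>B k\<close> are nested, not disjoint,
  which is the form that \<open>thin_layer_le\<close> estimates.\<close>

lemma hardy_le:
  fixes \<Omega> :: "'a::euclidean_space set"
  assumes L: "bounded_Lipschitz_domain \<Omega>" and "\<beta> > 1"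
  shows "\<exists>C\<ge>0. \<forall>R>0. (\<forall>x\<in>\<Omega>. bdist \<Omega> x < R) \<longrightarrow> (\<forall>m f V c. difference_bounded \<Omega> f V \<longrightarrow>
    (\<integral>\<^sup>+x\<in>\<Omega>. ennreal (\<bar>f x - c\<bar> / bdist \<Omega> x * log_weight \<beta> m (bdist \<Omega> x / R)) \<partial>lborel)
      \<le> ennreal C * (ennreal V + (\<integral>\<^sup>+x\<in>\<Omega>. ennreal \<bar>f x - c\<bar> \<partial>lborel)))"
proof -
  note \<Omega> = bounded_Lipschitz_domainD[OF L]
  obtain C1 where C1: "0 < C1" "\<And>f V c \<tau>. difference_bounded \<Omega> f V \<Longrightarrow> 0 < \<tau> \<Longrightarrow>
    (\<integral>\<^sup>+x\<in>{x\<in>\<Omega>. bdist \<Omega> x < \<tau>}. ennreal \<bar>f x - c\<bar> \<partial>lborel)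
      \<le> ennreal (C1 * \<tau>) * (ennreal V + (\<integral>\<^sup>+x\<in>\<Omega>. ennreal \<bar>f x - c\<bar> \<partial>lborel))"
    using thin_layer_le[OF L] by blast
  obtain x1 where "x1 \<in> \<Omega>" using \<Omega>(3) by blast
  \<comment> \<open>The dyadic scale starts at a distance attained in \<Omega>: then
    \<open>a < R\<close> for every admissible \<open>R\<close>, while \<open>a\<close> itself
    depends on \<Omega> only.\<close>
  define a where "a = bdist \<Omega> x1"
  have "0 < a" using bdist_pos[OF L \<open>x1 \<in> \<Omega>\<close>] by (simp add: a_def)
  define C where "C = 1 / a + 2 * C1 * (1 + 2 / (\<beta> - 1))"
  have "0 \<le> C" using \<open>0 < a\<close> C1(1) \<open>\<beta> > 1\<close> by (auto simp: C_def)
  moreover have "(\<integral>\<^sup>+x\<in>\<Omega>. ennreal (\<bar>f x - c\<bar> / bdist \<Omega> x * log_weight \<beta> m (bdist \<Omega> x / R)) \<partial>lborel)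
      \<le> ennreal C * (ennreal V + (\<integral>\<^sup>+x\<in>\<Omega>. ennreal \<bar>f x - c\<bar> \<partial>lborel))"
    if "0 < R" and R: "\<forall>x\<in>\<Omega>. bdist \<Omega> x < R" and f: "difference_bounded \<Omega> f V" for R m f V c
  proof -
    note [measurable] = difference_boundedD(3)[OF f]
    let ?I = "\<integral>\<^sup>+x\<in>\<Omega>. ennreal \<bar>f x - c\<bar> \<partial>lborel"
    have "a < R" using R \<open>x1 \<in> \<Omega>\<close> by (simp add: a_def)
    define G where "G t = log_weight \<beta> m (t / R)" for t
    have aR: "0 < a / R" "a / R < 1" using \<open>0 < a\<close> \<open>a < R\<close> by auto
    have ak: "0 < a / 2 ^ k / R" "a / 2 ^ k / R < 1" for k
    proof -
      have "a / R / 2 ^ k \<le> a / R / 1" using aR by (intro divide_left_mono) auto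
      moreover have eq: "a / 2 ^ k / R = a / R / 2 ^ k" by simp
      ultimately show "a / 2 ^ k / R < 1" unfolding eq using aR by linarith
      show "0 < a / 2 ^ k / R" using \<open>0 < a\<close> \<open>0 < R\<close> by simp
    qed
    have G0: "0 \<le> G (a / 2 ^ k)" for k unfolding G_def using ak by (intro log_weight_nonneg) auto
    define B where "B k = {x\<in>\<Omega>. bdist \<Omega> x < a / 2 ^ k}" for k :: nat
    have B_borel: "B k \<in> sets borel" for k
    proof -
      have "B k = \<Omega> \<inter> {x. bdist \<Omega> x < a / 2 ^ k}" by (auto simp: B_def)
      moreover have "open \<dots>"
        by (intro open_Int \<Omega>(1) open_Collect_less continuous_on_bdist continuous_on_const)
      ultimately show ?thesis by simp
    qed
    define q where "q k = 2 ^ Suc k / a * G (a / 2 ^ k)" for k :: nat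
    have q0: "0 \<le> q k" for k using G0[of k] \<open>0 < a\<close> by (simp add: q_def)
    have point: "ennreal (\<bar>f x - c\<bar> / bdist \<Omega> x * G (bdist \<Omega> x)) * indicator \<Omega> x
        \<le> ennreal (1 / a) * (ennreal \<bar>f x - c\<bar> * indicator \<Omega> x)
          + (\<Sum>k. ennreal (q k) * (ennreal \<bar>f x - c\<bar> * indicator (B k) x))" for x
    proof (cases "x \<in> \<Omega>")
      case True
      define d where "d = bdist \<Omega> x"
      have d: "0 < d" "d < R" using bdist_pos[OF L True] R True by (auto simp: d_def)
      then have dR: "0 < d / R" "d / R < 1" by auto
      show ?thesis
      proof (cases "d < a")
        \<comment> \<open>At distance at least \<open>a\<close> the weight is at most 1 and the
          division costs at most \<open>1 / a\<close>.\<close>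
        case False
        have "G d \<le> 1" unfolding G_def using dR \<open>\<beta> > 1\<close>
          by (intro log_weight_le_one) auto
        moreover have "0 \<le> G d" unfolding G_def using dR by (intro log_weight_nonneg)
        ultimately have "\<bar>f x - c\<bar> / d * G d \<le> \<bar>f x - c\<bar> / a * 1"
          using False \<open>0 < a\<close> by (intro mult_mono divide_left_mono) auto
        then have "ennreal (\<bar>f x - c\<bar> / d * G d) \<le> ennreal (1 / a) * ennreal \<bar>f x - c\<bar>"
          using \<open>0 < a\<close> by (subst ennreal_mult[symmetric]) (auto intro: ennreal_leI)
        then show ?thesis using True by (simp add: d_def add_increasing2)
      next
        case True
        have "\<exists>k. a / 2 ^ Suc k \<le> d"
        proof -
          obtain n where "a / d < 2 ^ n" using real_arch_pow[of 2 "a / d"] by auto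
          then have "a / 2 ^ Suc n \<le> d" using d \<open>0 < a\<close> by (simp add: field_simps)
          then show ?thesis by blast
        qed
        \<comment> \<open>Minimality of \<open>k\<close> yields the upper bound
          \<open>a / 2 ^ k\<close> for \<open>d\<close>; for \<open>k = 0\<close> that bound is the
          case assumption.\<close>
        define k where "k = (LEAST k. a / 2 ^ Suc k \<le> d)"
        have k: "a / 2 ^ Suc k \<le> d" unfolding k_def by (rule LeastI_ex) fact
        have k': "d < a / 2 ^ k"
        proof (cases k)
          case (Suc j)
          then have "\<not> a / 2 ^ Suc j \<le> d"
            using not_less_Least[of j "\<lambda>k. a / 2 ^ Suc k \<le> d"] by (simp add: k_def)
          then show ?thesis using Suc by simp
        qed (use True in simp)
        have "G d \<le> G (a / 2 ^ k)" unfolding G_def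
          using k' \<open>0 < R\<close> dR ak \<open>\<beta> > 1\<close> by (intro log_weight_mono divide_right_mono) auto
        moreover have "0 \<le> G d" unfolding G_def using dR by (intro log_weight_nonneg)
        ultimately have "\<bar>f x - c\<bar> / d * G d \<le> \<bar>f x - c\<bar> / (a / 2 ^ Suc k) * G (a / 2 ^ k)"
          using k d \<open>0 < a\<close> by (intro mult_mono divide_left_mono) auto
        also have "\<dots> = q k * \<bar>f x - c\<bar>" by (simp add: q_def)
        finally have "ennreal (\<bar>f x - c\<bar> / d * G d) \<le> ennreal (q k) * ennreal \<bar>f x - c\<bar>"
          using q0 by (subst ennreal_mult[symmetric]) (auto intro: ennreal_leI)
        also have "\<dots> = ennreal (q k) * (ennreal \<bar>f x - c\<bar> * indicator (B k) x)"
          using k' \<open>x \<in> \<Omega>\<close> by (simp add: B_def d_def)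
        also have "\<dots> \<le> (\<Sum>k. ennreal (q k) * (ennreal \<bar>f x - c\<bar> * indicator (B k) x))"
          using sum_le_suminf[of "\<lambda>k. ennreal (q k) * (ennreal \<bar>f x - c\<bar> * indicator (B k) x)" "{k}"] by simp
        finally show ?thesis using \<open>x \<in> \<Omega>\<close> by (simp add: d_def add_increasing)
      qed
    qed simp
    have "(\<integral>\<^sup>+x\<in>\<Omega>. ennreal (\<bar>f x - c\<bar> / bdist \<Omega> x * G (bdist \<Omega> x)) \<partial>lborel)
        \<le> (\<integral>\<^sup>+x. ennreal (1 / a) * (ennreal \<bar>f x - c\<bar> * indicator \<Omega> x)
          + (\<Sum>k. ennreal (q k) * (ennreal \<bar>f x - c\<bar> * indicator (B k) x)) \<partial>lborel)"
      by (intro nn_integral_mono point)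
    also have "\<dots> = ennreal (1 / a) * ?I
        + (\<Sum>k. ennreal (q k) * (\<integral>\<^sup>+x\<in>B k. ennreal \<bar>f x - c\<bar> \<partial>lborel))"
    proof -
      note [measurable] = B_borel borel_open[OF \<Omega>(1)]
      show ?thesis
        by (subst nn_integral_add, measurable)
          (subst nn_integral_suminf, measurable, simp add: nn_integral_cmult)
    qed
    also have "\<dots> \<le> ennreal (1 / a) * (ennreal V + ?I) + ennreal (2 * C1 * (1 + 2 / (\<beta> - 1))) * (ennreal V + ?I)"
    proof (intro add_mono mult_left_mono)
      have summand: "ennreal (q k) * (\<integral>\<^sup>+x\<in>B k. ennreal \<bar>f x - c\<bar> \<partial>lborel)
          \<le> ennreal (2 * C1 * G (a / 2 ^ k)) * (ennreal V + ?I)" for k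
      proof -
        have "(\<integral>\<^sup>+x\<in>B k. ennreal \<bar>f x - c\<bar> \<partial>lborel) \<le> ennreal (C1 * (a / 2 ^ k)) * (ennreal V + ?I)"
          unfolding B_def using \<open>0 < a\<close> by (intro C1(2)[OF f]) simp
        then have "ennreal (q k) * (\<integral>\<^sup>+x\<in>B k. ennreal \<bar>f x - c\<bar> \<partial>lborel)
            \<le> ennreal (q k) * (ennreal (C1 * (a / 2 ^ k)) * (ennreal V + ?I))"
          by (intro mult_left_mono) auto
        also have "\<dots> = ennreal (q k * (C1 * (a / 2 ^ k))) * (ennreal V + ?I)"
        proof -
          have "ennreal (q k * (C1 * (a / 2 ^ k))) = ennreal (q k) * ennreal (C1 * (a / 2 ^ k))"
            using q0[of k] C1(1) \<open>0 < a\<close> by (intro ennreal_mult) auto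
          then show ?thesis by (simp only: mult.assoc)
        qed
        also have "q k * (C1 * (a / 2 ^ k)) = 2 * C1 * G (a / 2 ^ k)"
          using \<open>0 < a\<close> by (simp add: q_def)
        finally show ?thesis .
      qed
      show "(\<Sum>k. ennreal (q k) * (\<integral>\<^sup>+x\<in>B k. ennreal \<bar>f x - c\<bar> \<partial>lborel))
          \<le> ennreal (2 * C1 * (1 + 2 / (\<beta> - 1))) * (ennreal V + ?I)"
        unfolding suminf_eq_SUP
      proof (rule SUP_least)
        fix n
        have "(\<Sum>k<n. ennreal (q k) * (\<integral>\<^sup>+x\<in>B k. ennreal \<bar>f x - c\<bar> \<partial>lborel))
            \<le> (\<Sum>k<n. ennreal (2 * C1 * G (a / 2 ^ k)) * (ennreal V + ?I))"
          by (intro sum_mono summand)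
        also have "\<dots> = (\<Sum>k<n. ennreal (2 * C1 * G (a / 2 ^ k))) * (ennreal V + ?I)"
          by (rule sum_distrib_right[symmetric])
        also have "(\<Sum>k<n. ennreal (2 * C1 * G (a / 2 ^ k))) = ennreal (\<Sum>k<n. 2 * C1 * G (a / 2 ^ k))"
          using C1(1) G0 by (intro sum_ennreal) auto
        also have "\<dots> \<le> ennreal (2 * C1 * (1 + 2 / (\<beta> - 1)))"
        proof (intro ennreal_leI)
          have "(\<Sum>k<n. G (a / 2 ^ k)) = (\<Sum>k<n. log_weight \<beta> m (a / R / 2 ^ k))"
            by (simp add: G_def divide_divide_eq_left mult.commute)
          also have "\<dots> \<le> 1 + 2 / (\<beta> - 1)"
            by (rule log_weight_sum_le[OF \<open>\<beta> > 1\<close> aR])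
          finally show "(\<Sum>k<n. 2 * C1 * G (a / 2 ^ k)) \<le> 2 * C1 * (1 + 2 / (\<beta> - 1))"
            using C1(1) unfolding sum_distrib_left[symmetric] by (intro mult_left_mono) auto
        qed
        finally show "(\<Sum>k<n. ennreal (q k) * (\<integral>\<^sup>+x\<in>B k. ennreal \<bar>f x - c\<bar> \<partial>lborel))
            \<le> ennreal (2 * C1 * (1 + 2 / (\<beta> - 1))) * (ennreal V + ?I)"
          by (meson mult_right_mono order_trans zero_le)
      qed
    qed auto
    also have "\<dots> = ennreal C * (ennreal V + ?I)"
    proof -
      have "ennreal C = ennreal (1 / a) + ennreal (2 * C1 * (1 + 2 / (\<beta> - 1)))"
        unfolding C_def using \<open>0 < a\<close> C1(1) \<open>\<beta> > 1\<close> by (intro ennreal_plus) auto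
      then show ?thesis by (simp only: distrib_right)
    qed
    finally show ?thesis unfolding G_def .
  qed
  ultimately show ?thesis by blast
qed

section \<open>Borel representatives and averages of BV functions\<close>

lemma C1_compact_supportD:
  assumes "\<phi> \<in> C1_compact_support \<Omega>"
  shows "continuous_on UNIV \<phi>" "continuous_on UNIV (divergence \<phi>)"
    "b \<in> Basis \<Longrightarrow> continuous_on UNIV (\<lambda>x. frechet_derivative \<phi> (at x) b)"
    "x \<notin> \<Omega> \<Longrightarrow> \<phi> x = 0"
proof -
  have c: "continuous_on UNIV (\<lambda>x. frechet_derivative \<phi> (at x) b)" if "b \<in> Basis" for b
    using assms that by (simp add: C1_compact_support_def)
  then show "b \<in> Basis \<Longrightarrow> continuous_on UNIV (\<lambda>x. frechet_derivative \<phi> (at x) b)" .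
  show "continuous_on UNIV (divergence \<phi>)"
    unfolding divergence_def[abs_def] by (intro continuous_intros c)
  show "continuous_on UNIV \<phi>"
    using assms by (simp add: C1_compact_support_def differentiable_imp_continuous_on)
  have "closure {x. \<phi> x \<noteq> 0} \<subseteq> \<Omega>"
    using assms by (simp add: C1_compact_support_def)
  then show "x \<notin> \<Omega> \<Longrightarrow> \<phi> x = 0" using closure_subset[of "{x. \<phi> x \<noteq> 0}"] by blast
qed

lemma BV_seminorm_nonneg: "0 \<le> BV_seminorm \<Omega> u"
proof -
  have z: "(\<lambda>_. 0) \<in> {\<phi> \<in> C1_compact_support \<Omega>. \<forall>x\<in>\<Omega>. norm (\<phi> x) \<le> 1}"
    by (simp add: C1_compact_support_def)
  have "ereal (LINT x:\<Omega>|lebesgue. u x * divergence (\<lambda>_. 0) x) \<le> BV_seminorm \<Omega> u"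
    unfolding BV_seminorm_def by (rule SUP_upper[OF z])
  moreover have "divergence (\<lambda>_. 0) x = 0" for x :: 'a by (simp add: divergence_def)
  ultimately show ?thesis by (simp add: set_lebesgue_integral_def zero_ereal_def)
qed

text \<open>An element of BV is only Lebesgue measurable, whereas translations and Fubini are used
  over \<open>lborel\<close>. A Borel function equal almost everywhere to the extension by zero has
  the same integrals, so the variation bound and the average both pass to it.\<close>

lemma BV_representative:
  fixes \<Omega> :: "'a::euclidean_space set"
  assumes L: "bounded_Lipschitz_domain \<Omega>" and u: "u \<in> BV \<Omega>"
  obtains f V where "difference_bounded \<Omega> f V" "BV_seminorm \<Omega> u = ereal V"
    "AE x in lborel. f x = indicator \<Omega> x * u x"
    "average \<Omega> u = (1 / measure lborel \<Omega>) * (LINT x|lborel. f x)"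
proof -
  note \<Omega> = bounded_Lipschitz_domainD[OF L]
  obtain V where V: "BV_seminorm \<Omega> u = ereal V" "0 \<le> V"
    using u BV_seminorm_nonneg[of \<Omega> u] by (cases "BV_seminorm \<Omega> u") (auto simp: BV_def)
  have int: "integrable lebesgue (\<lambda>x. indicator \<Omega> x * u x)"
    using u by (simp add: BV_def set_integrable_def)
  then obtain f where f: "f \<in> borel_measurable lborel" "AE x in lborel. indicator \<Omega> x * u x = f x"
    using completion_ex_borel_measurable_real[OF borel_measurable_integrable[OF int]] by blast
  have ae: "AE x in lebesgue. indicator \<Omega> x * u x = f x" using f(2) by (rule AE_completion)
  have fl: "f \<in> borel_measurable lebesgue" using f(1) by (rule measurable_completion)
  have "integrable lebesgue f"
    using integrable_cong_AE_imp[OF int fl] ae by (simp add: eq_commute)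
  then have fi: "integrable lborel f" using integrable_completion[OF f(1)] by simp
  have "variation_le \<Omega> f V"
    unfolding variation_le_def
  proof (intro ballI impI)
    fix \<phi> assume \<phi>: "\<phi> \<in> C1_compact_support \<Omega>" "\<forall>x\<in>\<Omega>. norm (\<phi> x) \<le> 1"
    have [measurable]: "divergence \<phi> \<in> borel_measurable borel"
      by (intro borel_measurable_continuous_onI C1_compact_supportD(2)[OF \<phi>(1)])
    have dm: "divergence \<phi> \<in> borel_measurable lebesgue" by (intro measurable_completion) simp
    have "(LINT x:\<Omega>|lebesgue. u x * divergence \<phi> x) = (LINT x|lebesgue. (indicator \<Omega> x * u x) * divergence \<phi> x)"
      by (simp add: set_lebesgue_integral_def mult.assoc)
    also have "\<dots> = (LINT x|lebesgue. f x * divergence \<phi> x)"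
      using borel_measurable_times[OF borel_measurable_integrable[OF int] dm] borel_measurable_times[OF fl dm] ae
      by (intro integral_cong_AE) auto
    also have "\<dots> = (LINT x|lborel. f x * divergence \<phi> x)"
    proof (rule integral_completion)
      have [measurable]: "f \<in> borel_measurable borel" using f(1) by simp
      show "(\<lambda>x. f x * divergence \<phi> x) \<in> borel_measurable lborel" by measurable
    qed
    finally have "ereal (LINT x|lborel. f x * divergence \<phi> x) \<le> BV_seminorm \<Omega> u"
      unfolding BV_seminorm_def using \<phi> by (intro SUP_upper2[of \<phi>]) auto
    then show "(LINT x|lborel. f x * divergence \<phi> x) \<le> V" using V by simp
  qed
  then have "difference_bounded \<Omega> f V"
    by (intro variation_le_imp_difference_bounded fi V(2) \<Omega>(1))
  moreover have "average \<Omega> u = (1 / measure lborel \<Omega>) * (LINT x|lborel. f x)"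
  proof -
    have "(LINT y:\<Omega>|lebesgue. u y) = (LINT x|lebesgue. f x)"
      unfolding set_lebesgue_integral_def
      using ae borel_measurable_integrable[OF int] fl by (intro integral_cong_AE) auto
    also have "\<dots> = (LINT x|lborel. f x)" using f(1) by (rule integral_completion)
    finally show ?thesis using \<Omega>(1) by (simp add: average_def measure_completion)
  qed
  ultimately show thesis using V(1) f(2) by (intro that[of f V]) (auto simp: eq_commute)
qed

text \<open>The nonnegative integral is the same for a measure and its completion, which replaces
  \<open>lebesgue\<close> by \<open>lborel\<close> for arbitrary \<open>u\<close>. Inside \<Omega>
  the quotient \<open>bdist \<Omega> x / R\<close> lies strictly between 0 and 1, so the weight can
  be rewritten pointwise.\<close>

lemma log_Hardy_integral_eq:
  fixes \<Omega> :: "'a::euclidean_space set"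
  assumes L: "bounded_Lipschitz_domain \<Omega>" and "0 < R" "\<forall>x\<in>\<Omega>. bdist \<Omega> x < R" "1 \<le> m"
  shows "log_Hardy_integral \<Omega> R \<beta> m u
    = (\<integral>\<^sup>+x\<in>\<Omega>. ennreal (\<bar>u x - average \<Omega> u\<bar> / bdist \<Omega> x * log_weight \<beta> m (bdist \<Omega> x / R)) \<partial>lborel)"
  unfolding log_Hardy_integral_def nn_integral_completion
proof (intro nn_integral_cong)
  fix x
  show "ennreal (\<bar>u x - average \<Omega> u\<bar> / bdist \<Omega> x
        * (\<Prod>i\<in>{1..<m}. Llog i (bdist \<Omega> x / R))
        * Llog m (bdist \<Omega> x / R) powr (1 + rho_star \<beta> m (bdist \<Omega> x / R))) * indicator \<Omega> x
      = ennreal (\<bar>u x - average \<Omega> u\<bar> / bdist \<Omega> x * log_weight \<beta> m (bdist \<Omega> x / R)) * indicator \<Omega> x"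
  proof (cases "x \<in> \<Omega>")
    case True
    then have "0 < bdist \<Omega> x / R" "bdist \<Omega> x / R < 1" using assms bdist_pos[OF L True] by auto
    from Llog_powr_rho_star[OF this \<open>1 \<le> m\<close>, of \<beta>] show ?thesis by (simp only: mult.assoc)
  qed simp
qed

lemma measure_lborel_open_pos:
  fixes \<Omega> :: "'a::euclidean_space set"
  assumes "open \<Omega>" "bounded \<Omega>" "\<Omega> \<noteq> {}" shows "0 < measure lborel \<Omega>"
proof -
  obtain x r where "0 < r" "ball x r \<subseteq> \<Omega>"
    using assms(1,3) open_contains_ball by (metis ex_in_conv)
  then have "0 < measure lborel (ball x r)" "measure lborel (ball x r) \<le> measure lborel \<Omega>"
    using measure_lborel_ball_pos[of r x] emeasure_bounded_finite[OF assms(2)] assms(1)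
    by (auto intro!: measure_mono_fmeasurable simp: fmeasurable_def)
  then show ?thesis by linarith
qed

text \<open>The mean differs from \<open>c\<close> by at most the mean deviation from
  \<open>c\<close>, so replacing \<open>c\<close> by the mean at most doubles the deviation. As
  \<open>f\<close> vanishes off \<Omega>, its integral over the whole space is the one over
  \<Omega>.\<close>

lemma nn_integral_diff_average_le:
  fixes f :: "'a::euclidean_space \<Rightarrow> real"
  assumes f: "integrable lborel f" and \<Omega>: "open \<Omega>" "bounded \<Omega>" "\<Omega> \<noteq> {}"
    and zero: "AE x in lborel. x \<notin> \<Omega> \<longrightarrow> f x = 0"
  shows "(\<integral>\<^sup>+x\<in>\<Omega>. ennreal \<bar>f x - (1 / measure lborel \<Omega>) * (LINT x|lborel. f x)\<bar> \<partial>lborel)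
    \<le> 2 * (\<integral>\<^sup>+x\<in>\<Omega>. ennreal \<bar>f x - c\<bar> \<partial>lborel)"
proof -
  have [measurable]: "f \<in> borel_measurable borel" "\<Omega> \<in> sets borel" using f \<Omega> by auto
  define m where "m = measure lborel \<Omega>"
  have em: "emeasure lborel \<Omega> = ennreal m"
    unfolding m_def using emeasure_bounded_finite[OF \<Omega>(2)] by (intro emeasure_eq_ennreal_measure) auto
  have "m > 0" unfolding m_def using \<Omega> by (rule measure_lborel_open_pos)
  define A where "A = (1 / m) * (LINT x|lborel. f x)"
  have iB: "integrable lborel (indicator \<Omega> :: 'a \<Rightarrow> real)"
    using emeasure_bounded_finite[OF \<Omega>(2)] by (intro integrable_real_indicator) auto
  have fB: "integrable lborel (\<lambda>y. indicator \<Omega> y * f y)"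
    by (rule Bochner_Integration.integrable_bound[OF f]) (auto simp: indicator_def)
  have "(LINT y|lborel. indicator \<Omega> y * f y) = (LINT x|lborel. f x)"
    using zero by (intro integral_cong_AE) (auto elim!: eventually_mono simp: indicator_def)
  then have "(LINT y|lborel. indicator \<Omega> y * f y - c * indicator \<Omega> y) = m * (A - c)"
    using fB iB \<open>m > 0\<close> by (subst Bochner_Integration.integral_diff) (auto simp: A_def m_def right_diff_distrib)
  then have "ennreal (m * \<bar>A - c\<bar>) = ennreal (norm (LINT y|lborel. indicator \<Omega> y * f y - c * indicator \<Omega> y))"
    using \<open>m > 0\<close> by (simp add: abs_mult)
  also have "\<dots> \<le> (\<integral>\<^sup>+y. norm (indicator \<Omega> y * f y - c * indicator \<Omega> y) \<partial>lborel)"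
    using fB iB by (intro integral_norm_bound_ennreal) auto
  also have "\<dots> = (\<integral>\<^sup>+x\<in>\<Omega>. ennreal \<bar>f x - c\<bar> \<partial>lborel)"
    by (intro nn_integral_cong) (auto simp: indicator_def)
  finally have *: "ennreal (m * \<bar>A - c\<bar>) \<le> (\<integral>\<^sup>+x\<in>\<Omega>. ennreal \<bar>f x - c\<bar> \<partial>lborel)" .
  have "(\<integral>\<^sup>+x\<in>\<Omega>. ennreal \<bar>f x - A\<bar> \<partial>lborel)
      \<le> (\<integral>\<^sup>+x. ennreal \<bar>f x - c\<bar> * indicator \<Omega> x + ennreal \<bar>A - c\<bar> * indicator \<Omega> x \<partial>lborel)"
  proof (intro nn_integral_mono)
    fix x
    have "ennreal \<bar>f x - A\<bar> \<le> ennreal \<bar>f x - c\<bar> + ennreal \<bar>A - c\<bar>"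
      by (simp add: ennreal_plus[symmetric] del: ennreal_plus)
    then show "ennreal \<bar>f x - A\<bar> * indicator \<Omega> x
        \<le> ennreal \<bar>f x - c\<bar> * indicator \<Omega> x + ennreal \<bar>A - c\<bar> * indicator \<Omega> x"
      by (auto simp: indicator_def)
  qed
  also have "\<dots> = (\<integral>\<^sup>+x\<in>\<Omega>. ennreal \<bar>f x - c\<bar> \<partial>lborel) + ennreal \<bar>A - c\<bar> * emeasure lborel \<Omega>"
    by (subst nn_integral_add) (auto simp: nn_integral_cmult_indicator)
  also have "ennreal \<bar>A - c\<bar> * emeasure lborel \<Omega> = ennreal (m * \<bar>A - c\<bar>)"
    unfolding em using \<open>m > 0\<close> by (subst ennreal_mult[symmetric]) (auto simp: mult.commute)
  also note *
  finally show ?thesis unfolding A_def m_def by (simp add: mult_2 add_left_mono)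
qed

lemma log_Hardy_inequality:
  fixes \<Omega> :: "'a::euclidean_space set"
  assumes L: "bounded_Lipschitz_domain \<Omega>" and "\<beta> > 1"
  shows "\<exists>C>0. \<forall>R>0. (\<forall>x\<in>\<Omega>. bdist \<Omega> x < R) \<longrightarrow>
    (\<forall>m\<ge>1. \<forall>u\<in>BV \<Omega>. enn2ereal (log_Hardy_integral \<Omega> R \<beta> m u) \<le> ereal C * BV_seminorm \<Omega> u)"
proof -
  note \<Omega> = bounded_Lipschitz_domainD[OF L]
  obtain C1 where C1: "0 \<le> C1" "\<And>R m f V c. 0 < R \<Longrightarrow> \<forall>x\<in>\<Omega>. bdist \<Omega> x < R \<Longrightarrow> difference_bounded \<Omega> f V \<Longrightarrow>
    (\<integral>\<^sup>+x\<in>\<Omega>. ennreal (\<bar>f x - c\<bar> / bdist \<Omega> x * log_weight \<beta> m (bdist \<Omega> x / R)) \<partial>lborel)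
      \<le> ennreal C1 * (ennreal V + (\<integral>\<^sup>+x\<in>\<Omega>. ennreal \<bar>f x - c\<bar> \<partial>lborel))"
    using hardy_le[OF L \<open>\<beta> > 1\<close>] by blast
  obtain C2 where C2: "0 \<le> C2" "\<And>f V. difference_bounded \<Omega> f V \<Longrightarrow>
    \<exists>c. (\<integral>\<^sup>+x\<in>\<Omega>. ennreal \<bar>f x - c\<bar> \<partial>lborel) \<le> ennreal (C2 * V)"
    using poincare_domain[OF L] by blast
  \<comment> \<open>\<open>C1\<close> comes from the weighted estimate, \<open>C2\<close> from the
    Poincare inequality and the 2 from passing to the average; the last summand makes
    \<open>C\<close> positive.\<close>
  define C where "C = C1 * (1 + 2 * C2) + 1"
  have "0 < C" using C1(1) C2(1) by (simp add: C_def add_nonneg_pos)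
  moreover have "enn2ereal (log_Hardy_integral \<Omega> R \<beta> m u) \<le> ereal C * BV_seminorm \<Omega> u"
    if R: "0 < R" "\<forall>x\<in>\<Omega>. bdist \<Omega> x < R" and "1 \<le> m" and u: "u \<in> BV \<Omega>" for R m u
  proof -
    obtain f V where f: "difference_bounded \<Omega> f V" and V: "BV_seminorm \<Omega> u = ereal V"
      and ae: "AE x in lborel. f x = indicator \<Omega> x * u x"
      and av: "average \<Omega> u = (1 / measure lborel \<Omega>) * (LINT x|lborel. f x)"
      using BV_representative[OF L u] by blast
    note V0 = difference_boundedD(2)[OF f]
    obtain c where c: "(\<integral>\<^sup>+x\<in>\<Omega>. ennreal \<bar>f x - c\<bar> \<partial>lborel) \<le> ennreal (C2 * V)"
      using C2(2)[OF f] by blast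
    have "AE x in lborel. x \<notin> \<Omega> \<longrightarrow> f x = 0" using ae by eventually_elim simp
    from nn_integral_diff_average_le[OF difference_boundedD(1)[OF f] \<Omega>(1,4,3) this, of c]
    have "(\<integral>\<^sup>+x\<in>\<Omega>. ennreal \<bar>f x - average \<Omega> u\<bar> \<partial>lborel) \<le> 2 * (\<integral>\<^sup>+x\<in>\<Omega>. ennreal \<bar>f x - c\<bar> \<partial>lborel)"
      by (simp only: av)
    also have "\<dots> \<le> 2 * ennreal (C2 * V)" by (intro mult_left_mono c) simp
    also have "\<dots> = ennreal (2 * (C2 * V))" using C2(1) V0 by (subst ennreal_mult) auto
    finally have mean: "(\<integral>\<^sup>+x\<in>\<Omega>. ennreal \<bar>f x - average \<Omega> u\<bar> \<partial>lborel) \<le> ennreal (2 * (C2 * V))" .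
    have "log_Hardy_integral \<Omega> R \<beta> m u
        = (\<integral>\<^sup>+x\<in>\<Omega>. ennreal (\<bar>u x - average \<Omega> u\<bar> / bdist \<Omega> x * log_weight \<beta> m (bdist \<Omega> x / R)) \<partial>lborel)"
      using R \<open>1 \<le> m\<close> by (intro log_Hardy_integral_eq[OF L]) auto
    also have "\<dots> = (\<integral>\<^sup>+x\<in>\<Omega>. ennreal (\<bar>f x - average \<Omega> u\<bar> / bdist \<Omega> x * log_weight \<beta> m (bdist \<Omega> x / R)) \<partial>lborel)"
    proof (intro nn_integral_cong_AE)
      show "AE x in lborel. ennreal (\<bar>u x - average \<Omega> u\<bar> / bdist \<Omega> x * log_weight \<beta> m (bdist \<Omega> x / R)) * indicator \<Omega> x
        = ennreal (\<bar>f x - average \<Omega> u\<bar> / bdist \<Omega> x * log_weight \<beta> m (bdist \<Omega> x / R)) * indicator \<Omega> x"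
        using ae by eventually_elim (simp add: indicator_def)
    qed
    also have "\<dots> \<le> ennreal C1 * (ennreal V + (\<integral>\<^sup>+x\<in>\<Omega>. ennreal \<bar>f x - average \<Omega> u\<bar> \<partial>lborel))"
      by (rule C1(2)[OF R f])
    also have "\<dots> \<le> ennreal C1 * (ennreal V + ennreal (2 * (C2 * V)))"
      by (intro mult_left_mono add_left_mono mean) simp
    also have "\<dots> = ennreal (C1 * (V + 2 * (C2 * V)))"
      using C1(1) C2(1) V0 by (subst ennreal_mult) auto
    also have "\<dots> \<le> ennreal (C * V)"
      using V0 by (intro ennreal_leI) (simp add: C_def algebra_simps)
    finally have "enn2ereal (log_Hardy_integral \<Omega> R \<beta> m u) \<le> enn2ereal (ennreal (C * V))"
      by (simp add: less_eq_ennreal.rep_eq)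
    also have "\<dots> = ereal C * BV_seminorm \<Omega> u"
      using \<open>0 < C\<close> V0 by (simp add: V enn2ereal_ennreal)
    finally show ?thesis .
  qed
  ultimately show ?thesis by blast
qed

section \<open>Failure for small exponents\<close>

lemma integrable_lborel_compact_support:
  fixes u :: "'a::euclidean_space \<Rightarrow> real"
  assumes uc: "continuous_on UNIV u" and supp: "\<And>x. x \<notin> ball x0 \<rho> \<Longrightarrow> u x = 0"
  shows "integrable lborel u"
proof -
  have [measurable]: "u \<in> borel_measurable borel" by (rule borel_measurable_continuous_onI[OF uc])
  have "emeasure lborel (ball x0 \<rho>) < \<infinity>" by (intro emeasure_bounded_finite) simp
  then have iK: "integrable lborel (indicator (ball x0 \<rho>) :: 'a \<Rightarrow> real)"
    by (intro integrable_real_indicator) auto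
  have "bounded (u ` cball x0 \<rho>)"
    using uc by (intro compact_imp_bounded compact_continuous_image) (auto intro: continuous_on_subset)
  then obtain U where "\<forall>y\<in>u ` cball x0 \<rho>. norm y \<le> U" unfolding bounded_iff ..
  then have U: "\<bar>u x\<bar> \<le> U" if "x \<in> cball x0 \<rho>" for x using that by auto
  show ?thesis
  proof (rule Bochner_Integration.integrable_bound)
    show "integrable lborel (\<lambda>x. U * indicator (ball x0 \<rho>) x)"
      using iK by (rule integrable_mult_right)
    have "norm (u x) \<le> norm (U * indicator (ball x0 \<rho>) x)" for x
    proof (cases "x \<in> ball x0 \<rho>")
      case False
      then show ?thesis by (simp add: supp)
    qed (use U[of x] in auto)
    then show "AE x in lborel. norm (u x) \<le> norm (U * indicator (ball x0 \<rho>) x)" by simp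
  qed measurable
qed

text \<open>Integration by parts for a function that is merely Lipschitz: the derivative of the test
  field is a limit of difference quotients, translation invariance moves each quotient onto
  \<open>u\<close>, and there its product with the bounded field component is at most 1 on a fixed
  ball and 0 outside it.\<close>

lemma integral_directional_derivative_le:
  fixes u :: "'a::euclidean_space \<Rightarrow> real"
  assumes lip: "\<And>x y. \<bar>u x - u y\<bar> \<le> norm (x - y)" and supp: "\<And>x. x \<notin> ball x0 \<rho> \<Longrightarrow> u x = 0"
    and "0 < \<rho>"
    and \<phi>: "\<phi> \<in> C1_compact_support \<Omega>" "\<forall>x\<in>\<Omega>. norm (\<phi> x) \<le> 1" and b: "b \<in> Basis"
  shows "integrable lborel (\<lambda>x. u x * (frechet_derivative \<phi> (at x) b \<bullet> b))"
    "(LINT x|lborel. u x * (frechet_derivative \<phi> (at x) b \<bullet> b)) \<le> measure lborel (cball x0 (\<rho> + 1))"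
proof -
  \<comment> \<open>The steps \<open>h n\<close> are at most 1, so a radius larger by 1 contains the
    supports of all translates involved.\<close>
  define K where "K = cball x0 (\<rho> + 1)"
  have [measurable]: "K \<in> sets borel" by (simp add: K_def)
  have K: "compact K" "ball x0 \<rho> \<subseteq> K" by (auto simp: K_def)
  have "emeasure lborel K < \<infinity>" using emeasure_bounded_finite[of K] by (simp add: K_def)
  then have iK: "integrable lborel (indicator K :: 'a \<Rightarrow> real)"
    by (intro integrable_real_indicator) (auto simp: K_def)
  have "1-lipschitz_on UNIV u" by (intro lipschitz_onI) (auto simp: lip dist_norm)
  then have uc: "continuous_on UNIV u" by (rule lipschitz_on_continuous_on)
  have [measurable]: "u \<in> borel_measurable borel" by (rule borel_measurable_continuous_onI[OF uc])
  define \<psi> where "\<psi> x = \<phi> x \<bullet> b" for x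
  define D where "D x = frechet_derivative \<phi> (at x) b \<bullet> b" for x
  have Dc: "continuous_on UNIV D"
    unfolding D_def[abs_def] by (intro continuous_intros C1_compact_supportD(3)[OF \<phi>(1) b])
  have \<psi>c: "continuous_on UNIV \<psi>"
    unfolding \<psi>_def[abs_def] by (intro continuous_intros C1_compact_supportD(1)[OF \<phi>(1)])
  have [measurable]: "D \<in> borel_measurable borel" "\<psi> \<in> borel_measurable borel"
    by (intro borel_measurable_continuous_onI Dc \<psi>c)+
  have \<psi>_le: "\<bar>\<psi> x\<bar> \<le> 1" for x
  proof -
    have "norm (\<phi> x) \<le> 1"
      using \<phi>(2) C1_compact_supportD(4)[OF \<phi>(1), of x] by (cases "x \<in> \<Omega>") auto
    then show ?thesis using Basis_le_norm[OF b, of "\<phi> x"] by (simp add: \<psi>_def)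
  qed
  have \<psi>_deriv: "((\<lambda>t. \<psi> (x + t *\<^sub>R b)) has_real_derivative D (x + t *\<^sub>R b)) (at t)" for x t
  proof -
    let ?F = "frechet_derivative \<phi> (at (x + t *\<^sub>R b))"
    have "(\<phi> has_derivative ?F) (at (x + t *\<^sub>R b))"
      by (rule C1_compact_support_frechet[OF \<phi>(1)])
    moreover from this have lin: "linear ?F" by (rule has_derivative_linear)
    moreover have "((\<lambda>t. x + t *\<^sub>R b) has_derivative (\<lambda>s. s *\<^sub>R b)) (at t)"
      by (auto intro!: derivative_eq_intros)
    ultimately have "((\<lambda>t. \<phi> (x + t *\<^sub>R b)) has_derivative (\<lambda>s. ?F (s *\<^sub>R b))) (at t)"
      by (auto intro: has_derivative_compose)
    then have "((\<lambda>t. \<psi> (x + t *\<^sub>R b)) has_derivative (\<lambda>s. ?F (s *\<^sub>R b) \<bullet> b)) (at t)"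
      unfolding \<psi>_def by (rule has_derivative_inner_left)
    then show ?thesis unfolding has_field_derivative_def D_def
      by (rule has_derivative_eq_rhs) (auto simp: linear_scale[OF lin])
  qed
  obtain B where B: "\<And>x. x \<in> K \<Longrightarrow> \<bar>D x\<bar> \<le> B"
  proof -
    have "bounded (D ` K)"
      using K(1) Dc by (intro compact_imp_bounded compact_continuous_image) (auto intro: continuous_on_subset)
    then obtain B where "\<forall>y\<in>D ` K. norm y \<le> B" unfolding bounded_iff ..
    then show ?thesis by (intro that[of B]) auto
  qed
  have iu: "integrable lborel u" by (rule integrable_lborel_compact_support[OF uc supp])
  have uB: "integrable lborel (\<lambda>x. B * \<bar>u x\<bar>)"
    using iu by (intro integrable_mult_right integrable_abs)
  have uD_le: "\<bar>u x * d\<bar> \<le> B * \<bar>u x\<bar>" if "x \<in> ball x0 \<rho> \<Longrightarrow> \<bar>d\<bar> \<le> B" for x d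
    using that supp[of x] by (cases "x \<in> ball x0 \<rho>") (auto simp: abs_mult mult.commute[of "\<bar>u x\<bar>"] intro: mult_right_mono)
  show "integrable lborel (\<lambda>x. u x * (frechet_derivative \<phi> (at x) b \<bullet> b))"
    unfolding D_def[symmetric]
  proof (rule Bochner_Integration.integrable_bound[OF uB])
    have "norm (u x * D x) \<le> norm (B * \<bar>u x\<bar>)" for x
    proof -
      have "\<bar>u x * D x\<bar> \<le> B * \<bar>u x\<bar>" using B[of x] K(2) by (intro uD_le) blast
      also have "\<dots> \<le> \<bar>B * \<bar>u x\<bar>\<bar>" by (rule abs_ge_self)
      finally show ?thesis by (simp only: real_norm_def)
    qed
    then show "AE x in lborel. norm (u x * D x) \<le> norm (B * \<bar>u x\<bar>)" by simp
  qed measurable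
  define h where "h n = 1 / (real n + 1)" for n
  have h: "0 < h n" "h n \<le> 1" for n by (simp_all add: h_def field_simps)
  have h_lim: "h \<longlonglongrightarrow> 0"
    using LIMSEQ_inverse_real_of_nat by (simp add: h_def[abs_def] inverse_eq_divide add.commute)
  define q where "q n x = (\<psi> (x + h n *\<^sub>R b) - \<psi> x) / h n" for n x
  have [measurable]: "q n \<in> borel_measurable borel" for n unfolding q_def[abs_def] by measurable
  have q_lim: "(\<lambda>n. q n x) \<longlonglongrightarrow> D x" for x
  proof -
    have "((\<lambda>s. (\<psi> (x + (0 + s) *\<^sub>R b) - \<psi> (x + 0 *\<^sub>R b)) / s) \<longlongrightarrow> D (x + 0 *\<^sub>R b)) (at 0)"
      using \<psi>_deriv[of x 0] by (simp only: DERIV_def)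
    moreover have "filterlim h (at 0) sequentially"
      using h_lim h by (auto simp: filterlim_at less_imp_neq[symmetric] intro: always_eventually)
    ultimately have "(\<lambda>n. (\<psi> (x + (0 + h n) *\<^sub>R b) - \<psi> (x + 0 *\<^sub>R b)) / h n) \<longlonglongrightarrow> D (x + 0 *\<^sub>R b)"
      by (rule filterlim_compose)
    then show ?thesis by (simp add: q_def)
  qed
  \<comment> \<open>The mean value theorem bounds the quotients uniformly in \<open>n\<close> on the
    support of \<open>u\<close>, which makes \<open>B * \<bar>u x\<bar>\<close> a dominating
    function.\<close>
  have q_le: "\<bar>q n x\<bar> \<le> B" if x: "x \<in> ball x0 \<rho>" for n x
  proof -
    obtain z where z: "0 < z" "z < h n" "\<psi> (x + h n *\<^sub>R b) - \<psi> (x + 0 *\<^sub>R b) = (h n - 0) * D (x + z *\<^sub>R b)"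
      using MVT2[OF h(1)[of n], of "\<lambda>t. \<psi> (x + t *\<^sub>R b)" "\<lambda>t. D (x + t *\<^sub>R b)"] \<psi>_deriv by blast
    have "dist x0 (x + z *\<^sub>R b) \<le> dist x0 x + dist x (x + z *\<^sub>R b)" by (rule dist_triangle)
    also have "dist x (x + z *\<^sub>R b) = z" using z(1) b by (simp add: dist_norm)
    finally have "x + z *\<^sub>R b \<in> K" using x z(2) h(2)[of n] by (simp add: K_def)
    from B[OF this] show ?thesis using z(3) h(1)[of n] by (simp add: q_def)
  qed
  have "(\<lambda>n. LINT x|lborel. u x * q n x) \<longlonglongrightarrow> (LINT x|lborel. u x * D x)"
  proof (rule integral_dominated_convergence[OF _ _ uB])
    show "AE x in lborel. (\<lambda>n. u x * q n x) \<longlonglongrightarrow> u x * D x"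
      by (intro always_eventually allI tendsto_intros q_lim)
    show "AE x in lborel. norm (u x * q n x) \<le> B * \<bar>u x\<bar>" for n
      using uD_le q_le by simp
  qed measurable
  moreover have "(LINT x|lborel. u x * q n x) \<le> measure lborel K" for n
  proof -
    have i1: "integrable lborel (\<lambda>x. u x * \<psi> (x + a))" for a
      by (rule Bochner_Integration.integrable_bound[OF iu]) (auto simp: abs_mult intro!: mult_left_le \<psi>_le)
    have i2: "integrable lborel (\<lambda>x. u (x - h n *\<^sub>R b) * \<psi> x)"
      using integrable_lborel_translate[OF i1[of "h n *\<^sub>R b"], of "- (h n *\<^sub>R b)"] by simp
    have "(LINT x|lborel. u x * q n x) = (LINT x|lborel. (u x * \<psi> (x + h n *\<^sub>R b) - u x * \<psi> x) / h n)"
      by (simp add: q_def right_diff_distrib)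
    also have "\<dots> = ((LINT x|lborel. u x * \<psi> (x + h n *\<^sub>R b)) - (LINT x|lborel. u x * \<psi> x)) / h n"
      using i1[of "h n *\<^sub>R b"] i1[of 0] by simp
    also have "(LINT x|lborel. u x * \<psi> (x + h n *\<^sub>R b)) = (LINT x|lborel. u (x - h n *\<^sub>R b) * \<psi> x)"
      using integral_lborel_translate[of "\<lambda>x. u x * \<psi> (x + h n *\<^sub>R b)" "- (h n *\<^sub>R b)"] by simp
    also have "(\<dots> - (LINT x|lborel. u x * \<psi> x)) / h n
        = (LINT x|lborel. (u (x - h n *\<^sub>R b) * \<psi> x - u x * \<psi> x) / h n)"
      using i2 i1[of 0] by simp
    also have "\<dots> \<le> (LINT x|lborel. indicator K x)"
    proof (rule integral_mono)
      show "integrable lborel (\<lambda>x. (u (x - h n *\<^sub>R b) * \<psi> x - u x * \<psi> x) / h n)"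
        using i2 i1[of 0] by simp
      fix x
      show "(u (x - h n *\<^sub>R b) * \<psi> x - u x * \<psi> x) / h n \<le> indicator K x"
      proof (cases "x \<in> K")
        case True
        have "\<bar>u (x - h n *\<^sub>R b) - u x\<bar> \<le> h n" using lip[of "x - h n *\<^sub>R b" x] b h(1)[of n] by simp
        then have "\<bar>u (x - h n *\<^sub>R b) - u x\<bar> * \<bar>\<psi> x\<bar> \<le> h n * 1"
          using \<psi>_le h(1)[of n] by (intro mult_mono) auto
        then have "u (x - h n *\<^sub>R b) * \<psi> x - u x * \<psi> x \<le> h n"
          unfolding left_diff_distrib[symmetric] abs_mult[symmetric] by linarith
        then show ?thesis using True h(1)[of n] by (simp add: field_simps)
      next
        case False
        have "dist x0 x \<le> dist x0 (x - h n *\<^sub>R b) + h n"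
          using dist_triangle[of x0 x "x - h n *\<^sub>R b"] b h(1)[of n] by (simp add: dist_norm)
        then have "u (x - h n *\<^sub>R b) = 0" "u x = 0"
          using False h(2)[of n] by (auto intro!: supp simp: K_def)
        then show ?thesis by simp
      qed
    qed (rule iK)
    finally show ?thesis by simp
  qed
  ultimately show "(LINT x|lborel. u x * (frechet_derivative \<phi> (at x) b \<bullet> b)) \<le> measure lborel (cball x0 (\<rho> + 1))"
    unfolding D_def[symmetric] K_def[symmetric] by (intro LIMSEQ_le_const2) auto
qed

lemma BV_seminorm_Lipschitz_less_top:
  fixes u :: "'a::euclidean_space \<Rightarrow> real"
  assumes lip: "\<And>x y. \<bar>u x - u y\<bar> \<le> norm (x - y)" and supp: "\<And>x. x \<notin> ball x0 \<rho> \<Longrightarrow> u x = 0"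
    and sub: "ball x0 \<rho> \<subseteq> \<Omega>" and "0 < \<rho>"
  shows "BV_seminorm \<Omega> u < \<infinity>"
proof -
  let ?m = "measure lborel (cball x0 (\<rho> + 1))"
  have "1-lipschitz_on UNIV u" by (intro lipschitz_onI) (auto simp: lip dist_norm)
  then have uc: "continuous_on UNIV u" by (rule lipschitz_on_continuous_on)
  have "BV_seminorm \<Omega> u \<le> ereal (real DIM('a) * ?m)"
    unfolding BV_seminorm_def
  proof (rule SUP_least)
    fix \<phi> assume "\<phi> \<in> {\<phi> \<in> C1_compact_support \<Omega>. \<forall>x\<in>\<Omega>. norm (\<phi> x) \<le> 1}"
    then have \<phi>: "\<phi> \<in> C1_compact_support \<Omega>" "\<forall>x\<in>\<Omega>. norm (\<phi> x) \<le> 1" by auto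
    have eq: "indicator \<Omega> x *\<^sub>R (u x * divergence \<phi> x) = u x * divergence \<phi> x" for x
    proof (cases "x \<in> \<Omega>")
      case False
      then have "x \<notin> ball x0 \<rho>" using sub by blast
      then show ?thesis by (simp add: supp)
    qed simp
    have "(LINT x:\<Omega>|lebesgue. u x * divergence \<phi> x) = (LINT x|lebesgue. u x * divergence \<phi> x)"
      unfolding set_lebesgue_integral_def eq ..
    also have "\<dots> = (LINT x|lborel. u x * divergence \<phi> x)"
    proof (rule integral_completion)
      have "(\<lambda>x. u x * divergence \<phi> x) \<in> borel_measurable borel"
        by (intro borel_measurable_continuous_onI continuous_intros uc C1_compact_supportD(2)[OF \<phi>(1)])
      then show "(\<lambda>x. u x * divergence \<phi> x) \<in> borel_measurable lborel" by simp
    qed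
    also have "\<dots> = (\<Sum>b\<in>Basis. LINT x|lborel. u x * (frechet_derivative \<phi> (at x) b \<bullet> b))"
      unfolding divergence_def sum_distrib_left
      by (intro Bochner_Integration.integral_sum integral_directional_derivative_le(1)[OF lip supp \<open>0 < \<rho>\<close> \<phi>])
    also have "\<dots> \<le> (\<Sum>b\<in>(Basis::'a set). ?m)"
      by (intro sum_mono integral_directional_derivative_le(2)[OF lip supp \<open>0 < \<rho>\<close> \<phi>])
    finally show "ereal (LINT x:\<Omega>|lebesgue. u x * divergence \<phi> x) \<le> ereal (real DIM('a) * ?m)" by simp
  qed
  also have "\<dots> < \<infinity>" by simp
  finally show ?thesis .
qed
text \<open>A fixed open piece \<open>U\<close> of heights between \<open>a / 2\<close> and
  \<open>a\<close> is covered by \<open>2 ^ Suc k\<close> translates along \<open>e\<close> of the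
  layer at scale \<open>k\<close>, so that layer has at least the corresponding fraction of the
  measure of \<open>U\<close>. The spare factor 2 goes into \<mu>.\<close>

lemma chart_layer_measure_ge:
  fixes \<Omega> :: "'a::euclidean_space set"
  assumes ch: "boundary_chart \<Omega> p r e s M" and "s p = 0" and a: "0 < a" "a \<le> r / 4"
  shows "\<exists>\<mu>>0. \<forall>k. ennreal (\<mu> / 2 ^ k)
    \<le> emeasure lborel {x \<in> ball p (r / 2). a / 2 ^ Suc k < s x \<and> s x \<le> a / 2 ^ k}"
proof -
  have r: "0 < r" and e: "norm e = 1" using boundary_chartD[OF ch] by auto
  note sc = boundary_chartD(7)[OF ch]
  define U where "U = ball p (r / 4) \<inter> ({x. a / 2 < s x} \<inter> {x. s x < a})"
  have "open U" unfolding U_def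
    by (intro open_Int open_ball open_Collect_less sc continuous_on_const)
  \<comment> \<open>As \<open>s p = 0\<close>, this point has height \<open>3 * a / 4\<close>, so
    \<open>U\<close> is nonempty.\<close>
  moreover have "p + (3 * a / 4) *\<^sub>R e \<in> U"
    using a e boundary_chartD(4)[OF ch, of p "3 * a / 4"] \<open>s p = 0\<close> by (simp add: U_def dist_norm)
  ultimately obtain \<delta> where \<delta>: "0 < \<delta>" "ball (p + (3 * a / 4) *\<^sub>R e) \<delta> \<subseteq> U"
    by (meson open_contains_ball)
  define \<mu> where "\<mu> = measure lborel (ball (p + (3 * a / 4) *\<^sub>R e) \<delta>)"
  have "0 < \<mu>" unfolding \<mu>_def using \<delta>(1) by (rule measure_lborel_ball_pos)
  have U_ge: "ennreal \<mu> \<le> emeasure lborel U"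
    unfolding \<mu>_def emeasure_lborel_ball_eq[symmetric] using \<delta>(2) \<open>open U\<close> by (intro emeasure_mono) auto
  have "ennreal (\<mu> / 2 / 2 ^ k) \<le> emeasure lborel {x \<in> ball p (r / 2). a / 2 ^ Suc k < s x \<and> s x \<le> a / 2 ^ k}" for k
  proof -
    define h where "h = a / 2 ^ Suc k"
    have h: "0 < h" "a / 2 ^ k = 2 * h" "a = 2 ^ Suc k * h" using a by (simp_all add: h_def)
    define E where "E = {x \<in> ball p (r / 2). h < s x \<and> s x \<le> 2 * h}"
    have "E = ball p (r / 2) \<inter> ({x. h < s x} \<inter> {x. s x \<le> 2 * h})" by (auto simp: E_def)
    moreover have "open {x. h < s x}" "closed {x. s x \<le> 2 * h}"
      by (intro open_Collect_less closed_Collect_le sc continuous_on_const)+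
    ultimately have [measurable]: "E \<in> sets borel" by auto
    have shift: "(\<integral>\<^sup>+z\<in>{x. x - v \<in> E}. 1 \<partial>lborel) = emeasure lborel E" for v :: 'a
    proof -
      have "(\<integral>\<^sup>+z. indicator E (- v + z) \<partial>lborel) = (\<integral>\<^sup>+z. indicator E z \<partial>lborel)"
        by (rule nn_integral_lborel_translate) measurable
      moreover have "indicator E (- v + z) = (1 * indicator {x. x - v \<in> E} z :: ennreal)" for z
        by (simp add: indicator_def)
      ultimately show ?thesis by simp
    qed
    have "U \<subseteq> (\<Union>j\<in>{..<2 ^ Suc k::nat}. {x. x - (real j * h) *\<^sub>R e \<in> E})"
    proof
      fix x assume x: "x \<in> U"
      \<comment> \<open>Chosen so that \<open>s x / h - j\<close> is above 1 and at most 2, matching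
        the half-open heights of \<open>E\<close>. The ceiling is at least 2, so the conversion to a
        natural number loses nothing.\<close>
      define j where "j = nat (\<lceil>s x / h\<rceil> - 2)"
      have s: "a / 2 < s x" "s x < a" using x by (auto simp: U_def)
      have "1 \<le> (2::real) ^ k" by simp
      moreover have "2 ^ k < s x / h" "s x / h < 2 ^ Suc k" using s h by (auto simp: field_simps)
      ultimately have "2 \<le> \<lceil>s x / h\<rceil>" by linarith
      then have j: "real j = of_int \<lceil>s x / h\<rceil> - 2" by (simp add: j_def)
      then have j': "1 < s x / h - real j" "s x / h - real j \<le> 2" by linarith+
      have "real j < 2 ^ Suc k" using j' \<open>s x / h < 2 ^ Suc k\<close> by linarith
      then have "real j < real (2 ^ Suc k)" by simp
      then have "j < 2 ^ Suc k" by (simp only: of_nat_less_iff)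
      have "h < s x - real j * h" "s x - real j * h \<le> 2 * h" using j' h(1) by (auto simp: field_simps)
      moreover have "s (x - (real j * h) *\<^sub>R e) = s x - real j * h"
        using boundary_chartD(4)[OF ch, of x "- (real j * h)"] by simp
      \<comment> \<open>The shift is shorter than \<open>a\<close>, hence than \<open>r / 4\<close>,
        and leads from the quarter ball at most into the half ball.\<close>
      moreover have "x - (real j * h) *\<^sub>R e \<in> ball p (r / 2)"
      proof -
        have "dist p (x - (real j * h) *\<^sub>R e) \<le> dist p x + real j * h"
          using dist_triangle[of p "x - (real j * h) *\<^sub>R e" x] e h(1) by (simp add: dist_norm)
        also have "\<dots> < r / 4 + a"
          using x s \<open>h < s x - real j * h\<close> h(1) by (auto simp: U_def)
        finally show ?thesis using a by simp
      qed
      ultimately have "x - (real j * h) *\<^sub>R e \<in> E" by (simp add: E_def)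
      then show "x \<in> (\<Union>j\<in>{..<2 ^ Suc k::nat}. {x. x - (real j * h) *\<^sub>R e \<in> E})" using \<open>j < 2 ^ Suc k\<close> by blast
    qed
    then have "(\<integral>\<^sup>+z\<in>U. 1 \<partial>lborel) \<le> (\<Sum>j\<in>{..<2 ^ Suc k::nat}. \<integral>\<^sup>+z\<in>{x. x - (real j * h) *\<^sub>R e \<in> E}. 1 \<partial>lborel)"
      by (intro nn_integral_cover_le) measurable
    then have "emeasure lborel U \<le> (\<Sum>j\<in>{..<2 ^ Suc k::nat}. emeasure lborel E)"
      using \<open>open U\<close> unfolding shift by (simp only: mult_1 nn_integral_indicator sets_lborel borel_open)
    also have "\<dots> = of_nat (2 ^ Suc k) * emeasure lborel E" by (simp only: sum_constant card_lessThan)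
    also have "of_nat (2 ^ Suc k) = ennreal (2 ^ Suc k)"
      unfolding ennreal_of_nat_eq_real_of_nat by simp
    finally have "ennreal \<mu> \<le> ennreal (2 ^ Suc k) * emeasure lborel E"
      by (rule order_trans[OF U_ge])
    then have "ennreal (1 / 2 ^ Suc k) * ennreal \<mu> \<le> ennreal (1 / 2 ^ Suc k) * (ennreal (2 ^ Suc k) * emeasure lborel E)"
      by (rule mult_left_mono) simp
    also have "\<dots> = emeasure lborel E"
    proof -
      have "ennreal (1 / 2 ^ Suc k) * ennreal (2 ^ Suc k) = ennreal (1 / 2 ^ Suc k * 2 ^ Suc k)"
        by (rule ennreal_mult[symmetric]) simp_all
      also have "\<dots> = 1" by simp
      finally show ?thesis by (simp only: mult.assoc[symmetric] mult_1)
    qed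
    finally have "ennreal (1 / 2 ^ Suc k) * ennreal \<mu> \<le> emeasure lborel E" .
    moreover have "ennreal (1 / 2 ^ Suc k) * ennreal \<mu> = ennreal (\<mu> / 2 / 2 ^ k)"
      using \<open>0 < \<mu>\<close> by (subst ennreal_mult[symmetric]) auto
    ultimately show ?thesis unfolding E_def h(2) h_def[symmetric] by simp
  qed
  then show ?thesis using \<open>0 < \<mu>\<close> by (intro exI[of _ "\<mu> / 2"]) auto
qed

text \<open>On the layer \<open>E k\<close> the distance is at most \<open>a / 2 ^ k\<close> and at
  least a fixed multiple of it, so the integrand is at least \<open>q k\<close>. Against the measure
  bound the powers of 2 cancel, and the partial sums become a multiple of those in
  \<open>log_weight_sum_unbounded\<close>.\<close>

lemma chart_log_weight_diverges:
  fixes \<Omega> :: "'a::euclidean_space set"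
  assumes L: "bounded_Lipschitz_domain \<Omega>" and p: "p \<in> frontier \<Omega>"
    and ch: "boundary_chart \<Omega> p r e s M" and a: "0 < a" "a \<le> r / 4"
    and R: "0 < R" "\<forall>x\<in>\<Omega>. bdist \<Omega> x < R" and \<beta>: "0 < \<beta>" "\<beta> \<le> 1" and "0 < A"
  shows "(\<integral>\<^sup>+x\<in>{x\<in>\<Omega>. bdist \<Omega> x \<le> a}. ennreal (A / bdist \<Omega> x * log_weight \<beta> m (bdist \<Omega> x / R)) \<partial>lborel) = \<infinity>"
    (is "?I = \<infinity>")
proof -
  note \<Omega> = bounded_Lipschitz_domainD[OF L]
  have r: "0 < r" and e: "norm e = 1" and M: "0 < M" using boundary_chartD[OF ch] by auto
  have "s p = 0" using r by (intro chart_frontier_zero[OF ch \<Omega>(1) p]) simp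
  obtain \<mu> where \<mu>: "0 < \<mu>" "\<And>k. ennreal (\<mu> / 2 ^ k)
    \<le> emeasure lborel {x \<in> ball p (r / 2). a / 2 ^ Suc k < s x \<and> s x \<le> a / 2 ^ k}"
    using chart_layer_measure_ge[OF ch \<open>s p = 0\<close> a] by blast
  define E where "E k = {x \<in> ball p (r / 2). a / 2 ^ Suc k < s x \<and> s x \<le> a / 2 ^ k}" for k
  have [measurable]: "E k \<in> sets borel" for k
  proof -
    have "E k = ball p (r / 2) \<inter> ({x. a / 2 ^ Suc k < s x} \<inter> {x. s x \<le> a / 2 ^ k})"
      by (auto simp: E_def)
    moreover have "open {x. a / 2 ^ Suc k < s x}" "closed {x. s x \<le> a / 2 ^ k}"
      by (intro open_Collect_less closed_Collect_le boundary_chartD(7)[OF ch] continuous_on_const)+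
    ultimately show ?thesis by auto
  qed
  have ak: "a / 2 ^ k \<le> a" for k using a by (simp add: field_simps)
  have E: "x \<in> \<Omega>" "0 < bdist \<Omega> x" "bdist \<Omega> x \<le> a / 2 ^ k" "a / 2 ^ Suc k \<le> M * bdist \<Omega> x" if "x \<in> E k" for x k
  proof -
    have x: "x \<in> ball p (r / 2)" "a / 2 ^ Suc k < s x" "s x \<le> a / 2 ^ k"
      using that by (auto simp: E_def)
    have "0 < s x" using x(2) a by (meson divide_pos_pos less_trans zero_less_numeral zero_less_power)
    then show x\<Omega>: "x \<in> \<Omega>" using boundary_chartD(6)[OF ch, of x] x(1) r by auto
    then show "0 < bdist \<Omega> x" by (rule bdist_pos[OF L])
    have "s x < r / 2" using x(3) ak[of k] a r by linarith
    then have "bdist \<Omega> x \<le> s x" by (intro bdist_le_chart[OF ch x\<Omega> x(1)])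
    then show "bdist \<Omega> x \<le> a / 2 ^ k" using x(3) by linarith
    show "a / 2 ^ Suc k \<le> M * bdist \<Omega> x" using chart_le_bdist[OF ch \<Omega>(1) p x(1)] x(2) by linarith
  qed
  \<comment> \<open>Height is at most \<open>M\<close> times distance, so on \<open>E k\<close> the
    distance divided by \<open>R\<close> is at least \<open>b / 2 ^ k\<close>; the 2 comes from the
    lower end \<open>a / 2 ^ Suc k\<close> of the heights.\<close>
  define b where "b = a / (2 * M * R)"
  have b0: "0 < b" using a M R by (simp add: b_def)
  have bE: "b / 2 ^ k \<le> bdist \<Omega> x / R" if "x \<in> E k" for x k
    using E(4)[OF that] M R by (simp add: b_def field_simps)
  \<comment> \<open>\<open>b\<close> is bounded by the distance divided by \<open>R\<close> at a
    point of \<open>E 0\<close>, which exists because \<open>E 0\<close> has positive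
    measure.\<close>
  have "b < 1"
  proof -
    have "E 0 \<noteq> {}" using \<mu>(2)[of 0] \<mu>(1) unfolding E_def[symmetric] by auto
    then obtain x where x: "x \<in> E 0" by blast
    then have "b \<le> bdist \<Omega> x / R" using bE[OF x] by simp
    also have "\<dots> < 1" using E(1)[OF x] R by simp
    finally show ?thesis .
  qed
  have bk: "0 < b / 2 ^ k" "b / 2 ^ k < 1" for k
  proof -
    have "b / 2 ^ k \<le> b" using b0 by (simp add: field_simps)
    then show "b / 2 ^ k < 1" using \<open>b < 1\<close> by linarith
    show "0 < b / 2 ^ k" using b0 by simp
  qed
  define G where "G k = log_weight \<beta> m (b / 2 ^ k)" for k
  have G0: "0 \<le> G k" for k unfolding G_def by (intro log_weight_nonneg bk)
  define q where "q k = A / (a / 2 ^ k) * G k" for k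
  have q0: "0 \<le> q k" for k using G0[of k] a \<open>0 < A\<close> by (simp add: q_def)
  have w: "q k \<le> A / bdist \<Omega> x * log_weight \<beta> m (bdist \<Omega> x / R)" if x: "x \<in> E k" for x k
    unfolding q_def
  proof (intro mult_mono)
    show "A / (a / 2 ^ k) \<le> A / bdist \<Omega> x"
      using E(2,3)[OF x] \<open>0 < A\<close> a by (intro divide_left_mono) auto
    show "G k \<le> log_weight \<beta> m (bdist \<Omega> x / R)"
      unfolding G_def using bk bE[OF x] E(1)[OF x] R \<beta> by (intro log_weight_mono) auto
  qed (use G0 E(2)[OF x] \<open>0 < A\<close> in auto)
  have sum_le: "ennreal (A * \<mu> / a * (\<Sum>k<n. G k)) \<le> ?I" for n
  proof -
    have "ennreal (A * \<mu> / a * (\<Sum>k<n. G k)) = (\<Sum>k<n. ennreal (q k * (\<mu> / 2 ^ k)))"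
    proof -
      have "A * \<mu> / a * (\<Sum>k<n. G k) = (\<Sum>k<n. q k * (\<mu> / 2 ^ k))"
        unfolding sum_distrib_left using a by (intro sum.cong) (auto simp: q_def)
      then show ?thesis using q0 \<mu>(1) by (simp only:) (intro sum_ennreal[symmetric], auto)
    qed
    also have "\<dots> \<le> (\<Sum>k<n. ennreal (q k) * emeasure lborel (E k))"
    proof (rule sum_mono)
      fix k
      have "ennreal (q k * (\<mu> / 2 ^ k)) = ennreal (q k) * ennreal (\<mu> / 2 ^ k)"
        using q0 \<mu>(1) by (intro ennreal_mult) auto
      also have "\<dots> \<le> ennreal (q k) * emeasure lborel (E k)"
        unfolding E_def by (intro mult_left_mono \<mu>(2)) simp
      finally show "ennreal (q k * (\<mu> / 2 ^ k)) \<le> ennreal (q k) * emeasure lborel (E k)" .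
    qed
    also have "\<dots> = (\<Sum>k<n. \<integral>\<^sup>+x\<in>E k. ennreal (q k) \<partial>lborel)"
      by (simp add: nn_integral_cmult_indicator)
    also have "\<dots> = (\<integral>\<^sup>+x. (\<Sum>k<n. ennreal (q k) * indicator (E k) x) \<partial>lborel)"
      by (rule nn_integral_sum[symmetric]) measurable
    also have "\<dots> \<le> ?I"
    proof (intro nn_integral_mono)
      fix x
      let ?w = "ennreal (A / bdist \<Omega> x * log_weight \<beta> m (bdist \<Omega> x / R)) * indicator {x\<in>\<Omega>. bdist \<Omega> x \<le> a} x"
      show "(\<Sum>k<n. ennreal (q k) * indicator (E k) x) \<le> ?w"
      proof (cases "\<exists>k<n. x \<in> E k")
        case True
        then obtain i where i: "i < n" "x \<in> E i" by blast
        have mono: "\<not> j < k" if "x \<in> E j" "x \<in> E k" for j k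
        proof
          assume "j < k"
          then have "(2::real) ^ Suc j \<le> 2 ^ k" by (intro power_increasing) auto
          then have "a / 2 ^ k \<le> a / 2 ^ Suc j" using a by (intro divide_left_mono) auto
          then show False using that by (simp add: E_def)
        qed
        have "(\<Sum>k<n. ennreal (q k) * indicator (E k) x) = (\<Sum>k<n. if k = i then ennreal (q i) else 0)"
        proof (intro sum.cong refl)
          fix k
          have "k = i" if "x \<in> E k" using mono[OF that i(2)] mono[OF i(2) that] by linarith
          then show "ennreal (q k) * indicator (E k) x = (if k = i then ennreal (q i) else 0)"
            using i(2) by (cases "k = i") (simp_all add: indicator_def, blast)
        qed
        also have "\<dots> = ennreal (q i)" using i(1) by simp
        also have "\<dots> \<le> ennreal (A / bdist \<Omega> x * log_weight \<beta> m (bdist \<Omega> x / R))"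
          by (intro ennreal_leI w i(2))
        also have "\<dots> = ?w" using E(1,3)[OF i(2)] ak[of i] by simp
        finally show ?thesis .
      next
        case False
        then have "(\<Sum>k<n. ennreal (q k) * indicator (E k) x) = 0"
          by (intro sum.neutral) (auto simp: indicator_def)
        then show ?thesis by (simp only: zero_le)
      qed
    qed
    finally show ?thesis .
  qed
  show ?thesis
  proof (rule ccontr)
    assume "?I \<noteq> \<infinity>"
    then obtain y where y: "?I = ennreal y" "0 \<le> y" by (cases ?I) auto
    obtain n where n: "(y + 1) / (A * \<mu> / a) \<le> (\<Sum>k<n. G k)"
      using log_weight_sum_unbounded[OF \<beta>(2) b0 \<open>b < 1\<close>] unfolding G_def by blast
    have "0 < A * \<mu> / a" using \<open>0 < A\<close> \<mu>(1) a by simp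
    then have "y + 1 \<le> A * \<mu> / a * (\<Sum>k<n. G k)"
      using n by (simp only: pos_divide_le_eq mult.commute)
    then have "ennreal (y + 1) \<le> ennreal y"
      using sum_le[of n] unfolding y(1) by (meson ennreal_leI order_trans)
    then show False using y(2) by (simp add: ennreal_le_iff del: ennreal_plus)
  qed
qed

text \<open>A tent function supported away from the boundary has a positive mean and vanishes where
  the distance is at most \<open>\<rho>\<close>. There its deviation from the mean is a nonzero
  constant, and the weight alone makes the integral diverge.\<close>

lemma log_Hardy_integral_infinite:
  fixes \<Omega> :: "'a::euclidean_space set"
  assumes L: "bounded_Lipschitz_domain \<Omega>" and R: "0 < R" "\<forall>x\<in>\<Omega>. bdist \<Omega> x < R"
    and "1 \<le> m" and \<beta>: "0 < \<beta>" "\<beta> \<le> 1"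
  shows "\<exists>u\<in>BV \<Omega>. log_Hardy_integral \<Omega> R \<beta> m u = \<infinity>"
proof -
  note \<Omega> = bounded_Lipschitz_domainD[OF L]
  obtain x0 where "x0 \<in> \<Omega>" using \<Omega>(3) by blast
  \<comment> \<open>Half the distance, so that points of the ball around \<open>x0\<close> keep a
    distance larger than \<open>\<rho>\<close> from the frontier.\<close>
  define \<rho> where "\<rho> = bdist \<Omega> x0 / 2"
  have "0 < \<rho>" using bdist_pos[OF L \<open>x0 \<in> \<Omega>\<close>] by (simp add: \<rho>_def)
  have far: "\<rho> < bdist \<Omega> x" if "x \<in> ball x0 \<rho>" for x
    using infdist_triangle[of x0 "frontier \<Omega>" x] that by (simp add: \<rho>_def bdist_def)
  have sub: "ball x0 \<rho> \<subseteq> \<Omega>"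
  proof (rule ccontr)
    assume "\<not> ball x0 \<rho> \<subseteq> \<Omega>"
    then have "ball x0 \<rho> \<inter> frontier \<Omega> \<noteq> {}"
      using \<open>0 < \<rho>\<close> \<open>x0 \<in> \<Omega>\<close> centre_in_ball[of x0 \<rho>]
      by (intro connected_Int_frontier) (simp, blast, blast)
    then obtain y where y: "y \<in> ball x0 \<rho>" "y \<in> frontier \<Omega>" by blast
    then show False using far[OF y(1)] \<open>0 < \<rho>\<close> by (simp add: bdist_def)
  qed
  define u where "u x = max 0 (\<rho> - dist x0 x)" for x
  have lip: "\<bar>u x - u y\<bar> \<le> norm (x - y)" for x y
  proof -
    have "\<bar>dist x0 x - dist x0 y\<bar> \<le> norm (x - y)"
      using abs_dist_diff_le[of x x0 y] by (simp add: dist_commute dist_norm)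
    then show ?thesis unfolding u_def by linarith
  qed
  have supp: "u x = 0" if "x \<notin> ball x0 \<rho>" for x using that by (simp add: u_def)
  have uc: "continuous_on S u" for S unfolding u_def[abs_def] by (intro continuous_intros)
  have iu: "integrable lborel u" by (rule integrable_lborel_compact_support[OF uc supp])
  have ind: "indicator \<Omega> x *\<^sub>R u x = u x" for x
    using supp[of x] sub by (cases "x \<in> ball x0 \<rho>") (auto simp: indicator_def)
  have "integrable lebesgue u"
    using iu integrable_completion[of u lborel] borel_measurable_integrable[OF iu] by simp
  then have uint: "u absolutely_integrable_on \<Omega>"
    unfolding set_integrable_def ind .
  have "u \<in> BV \<Omega>"
    using uint BV_seminorm_Lipschitz_less_top[OF lip supp sub \<open>0 < \<rho>\<close>] by (simp add: BV_def)
  define A where "A = average \<Omega> u"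
  have "0 < A"
  proof -
    have iB: "integrable lborel (indicator (ball x0 (\<rho> / 2)) :: 'a \<Rightarrow> real)"
      using emeasure_bounded_finite[OF bounded_ball, of x0 "\<rho> / 2"]
      by (intro integrable_real_indicator) auto
    have "0 < \<rho> / 2 * measure lborel (ball x0 (\<rho> / 2))"
      using \<open>0 < \<rho>\<close> measure_lborel_ball_pos[of "\<rho> / 2" x0] by simp
    also have "\<dots> = (LINT x|lborel. \<rho> / 2 * indicator (ball x0 (\<rho> / 2)) x)" by simp
    also have "\<dots> \<le> (LINT x|lborel. u x)"
    proof (rule integral_mono)
      show "integrable lborel (\<lambda>x. \<rho> / 2 * indicator (ball x0 (\<rho> / 2)) x)"
        using iB by (rule integrable_mult_right)
      show "\<rho> / 2 * indicator (ball x0 (\<rho> / 2)) x \<le> u x" for x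
        by (cases "x \<in> ball x0 (\<rho> / 2)") (auto simp: u_def max_def)
    qed (rule iu)
    also have "\<dots> = (LINT x|lebesgue. u x)"
      by (rule integral_completion[symmetric]) (rule borel_measurable_integrable[OF iu])
    also have "\<dots> = (LINT y:\<Omega>|lebesgue. u y)" unfolding set_lebesgue_integral_def ind ..
    finally show ?thesis
      using measure_lborel_open_pos[OF \<Omega>(1,4,3)] \<Omega>(1) by (simp add: A_def average_def measure_completion)
  qed
  obtain p where p: "p \<in> frontier \<Omega>" using \<Omega>(5) by blast
  obtain r e s M where ch: "boundary_chart \<Omega> p r e s M" using ex_boundary_chart[OF L p] by blast
  \<comment> \<open>The first bound fits the layer into the chart, the second keeps it outside the
    support of \<open>u\<close>.\<close>
  define a where "a = min (r / 4) \<rho>"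
  have a: "0 < a" "a \<le> r / 4" "a \<le> \<rho>"
    using boundary_chartD(1)[OF ch] \<open>0 < \<rho>\<close> by (auto simp: a_def)
  have "\<infinity> = (\<integral>\<^sup>+x\<in>{x\<in>\<Omega>. bdist \<Omega> x \<le> a}. ennreal (A / bdist \<Omega> x * log_weight \<beta> m (bdist \<Omega> x / R)) \<partial>lborel)"
    using chart_log_weight_diverges[OF L p ch a(1,2) R \<beta> \<open>0 < A\<close>] by simp
  also have "\<dots> \<le> (\<integral>\<^sup>+x\<in>\<Omega>. ennreal (\<bar>u x - average \<Omega> u\<bar> / bdist \<Omega> x * log_weight \<beta> m (bdist \<Omega> x / R)) \<partial>lborel)"
  proof (intro nn_integral_mono)
    fix x
    show "ennreal (A / bdist \<Omega> x * log_weight \<beta> m (bdist \<Omega> x / R)) * indicator {x\<in>\<Omega>. bdist \<Omega> x \<le> a} x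
        \<le> ennreal (\<bar>u x - average \<Omega> u\<bar> / bdist \<Omega> x * log_weight \<beta> m (bdist \<Omega> x / R)) * indicator \<Omega> x"
    proof (cases "x \<in> \<Omega> \<and> bdist \<Omega> x \<le> a")
      case True
      then have "x \<notin> ball x0 \<rho>" using far[of x] a(3) by linarith
      then have "\<bar>u x - average \<Omega> u\<bar> = A"
        using supp \<open>0 < A\<close> by (simp add: A_def)
      then show ?thesis using True by simp
    qed auto
  qed
  also have "\<dots> = log_Hardy_integral \<Omega> R \<beta> m u"
    using R \<open>1 \<le> m\<close> by (intro log_Hardy_integral_eq[OF L, symmetric]) auto
  finally have "log_Hardy_integral \<Omega> R \<beta> m u = \<infinity>" by (simp add: top_unique)
  then show ?thesis using \<open>u \<in> BV \<Omega>\<close> by blast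
qed

text \<open>The constant is quantified before \<open>R\<close> and \<open>m\<close>, which expresses
  that it depends on \<Omega> and \<beta> only, the dimension being fixed by the type. The failure
  comes from a single \<open>u\<close> whose left side is infinite.\<close>

theorem corollary1p2:
  fixes \<Omega> :: "'a::euclidean_space set"
  assumes "bounded_Lipschitz_domain \<Omega>"
  shows "(\<forall>\<beta>>1. \<exists>C>0. \<forall>R>0. (\<forall>x\<in>\<Omega>. bdist \<Omega> x < R) \<longrightarrow>
            (\<forall>m\<ge>1. \<forall>u\<in>BV \<Omega>.
               enn2ereal (log_Hardy_integral \<Omega> R \<beta> m u) \<le> ereal (C * 2 ^ m) * BV_seminorm \<Omega> u)) \<and>
         (\<forall>R>0. (\<forall>x\<in>\<Omega>. bdist \<Omega> x < R) \<longrightarrow>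
            (\<forall>m\<ge>1. \<forall>\<beta>. 0 < \<beta> \<and> \<beta> \<le> 1 \<longrightarrow>
               \<not> (\<exists>C::real. \<forall>u\<in>BV \<Omega>.
                  enn2ereal (log_Hardy_integral \<Omega> R \<beta> m u) \<le> ereal (C * 2 ^ m) * BV_seminorm \<Omega> u)))"
proof (intro conjI allI impI)
  fix \<beta> :: real assume "1 < \<beta>"
  obtain C where C: "0 < C" "\<And>R m u. 0 < R \<Longrightarrow> \<forall>x\<in>\<Omega>. bdist \<Omega> x < R \<Longrightarrow> 1 \<le> m \<Longrightarrow> u \<in> BV \<Omega> \<Longrightarrow>
      enn2ereal (log_Hardy_integral \<Omega> R \<beta> m u) \<le> ereal C * BV_seminorm \<Omega> u"
    using log_Hardy_inequality[OF assms \<open>1 < \<beta>\<close>] by blast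
  \<comment> \<open>The bound proved above is independent of \<open>m\<close>; as
    \<open>2 ^ m\<close> is at least 1 and the seminorm is nonnegative, it implies the stated
    one.\<close>
  have grow: "ereal C * BV_seminorm \<Omega> u \<le> ereal (C * 2 ^ m) * BV_seminorm \<Omega> u" for m u
    using C(1) by (intro ereal_mult_right_mono BV_seminorm_nonneg) (simp add: mult_le_cancel_left1)
  show "\<exists>C>0. \<forall>R>0. (\<forall>x\<in>\<Omega>. bdist \<Omega> x < R) \<longrightarrow> (\<forall>m\<ge>1. \<forall>u\<in>BV \<Omega>.
      enn2ereal (log_Hardy_integral \<Omega> R \<beta> m u) \<le> ereal (C * 2 ^ m) * BV_seminorm \<Omega> u)"
    using C(1) order_trans[OF C(2) grow] by (intro exI[of _ C] conjI allI impI ballI) assumption+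
next
  fix R :: real and m :: nat and \<beta> :: real
  assume R: "0 < R" "\<forall>x\<in>\<Omega>. bdist \<Omega> x < R" and "1 \<le> m" and \<beta>: "0 < \<beta> \<and> \<beta> \<le> 1"
  obtain u where u: "u \<in> BV \<Omega>" "log_Hardy_integral \<Omega> R \<beta> m u = \<infinity>"
    using log_Hardy_integral_infinite[OF assms R \<open>1 \<le> m\<close>] \<beta> by blast
  have "\<bar>BV_seminorm \<Omega> u\<bar> \<noteq> \<infinity>"
    using u(1) BV_seminorm_nonneg[of \<Omega> u] by (auto simp: BV_def)
  then obtain V where "BV_seminorm \<Omega> u = ereal V" by (cases "BV_seminorm \<Omega> u") auto
  \<comment> \<open>The seminorm is a real number, so the right side is finite for every real
    \<open>C\<close>, whatever its sign, and cannot bound infinity.\<close>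
  then have "\<not> enn2ereal (log_Hardy_integral \<Omega> R \<beta> m u) \<le> ereal (C * 2 ^ m) * BV_seminorm \<Omega> u" for C
    by (simp add: u(2))
  then show "\<not> (\<exists>C::real. \<forall>u\<in>BV \<Omega>.
      enn2ereal (log_Hardy_integral \<Omega> R \<beta> m u) \<le> ereal (C * 2 ^ m) * BV_seminorm \<Omega> u)"
    using u(1) by blast
qed

end
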